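(* Let $A\in\mathrm{Mat}_N^+(\mathbb{Z})$ be diagonalizable over $\mathbb{C}$. (1) If all eigenvalues of $A$ have the same modulus, then $\hat h_A^+(P)\ge h(P)$ for all $P\in\mathbb{G}_m^N(\overline{\mathbb{Q}})$. (2) If the eigenvalues of $A$ have exactly two distinct moduli, then $\hat h_A(P)\ge h(P)$ for all $P\in\mathbb{G}_m^N(\overline{\mathbb{Q}})$.
   Context: $\mathrm{Mat}_N^+(\mathbb{Z})$ denotes the $N\times N$ integer matrices with nonzero determinant. For $A=(a_{ij})$, $\varphi_A(x_1,\dots,x_N)=\bigl(\prod_j x_j^{a_{1j}},\dots,\prod_j x_j^{a_{Nj}}\bigr)$ on $\mathbb{G}_m^N(\overline{\mathbb{Q}})$, and $\varphi_A^n=\varphi_{A^n}$. $h$ is the absolute logarithmic Weil height: $h(x_1,\dots,x_N)=\sum_{v\in M_K}\max\{0,\log\|x_1\|_v,\dots,\log\|x_N\|_v\}$ (normalized absolute values). Let $\delta_A$ be the spectral radius of $A$ and let $\ell_A+1$ be the largest size of a Jordan block of $A$ for an eigenvalue of modulus $\delta_A$. Define $\hat h_A^+(P)=\limsup_{n\to\infty} h(\varphi_A^n(P))/(n^{\ell_A}\delta_A^n)$. Let $A'=|\det A|\cdot A^{-1}\in\mathrm{Mat}_N^+(\mathbb{Z})$, $\hat h_A^-(P)=\hat h_{A'}^+(P)$, and $\hat h_A=\hat h_A^++\hat h_A^-$ (total canonical height). *)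

theory Defs
  imports "HOL-Computational_Algebra.Polynomial"
    "HOL-Library.Extended_Real" "HOL-Library.Liminf_Limsup"
    "Jordan_Normal_Form.Jordan_Normal_Form" "Jordan_Normal_Form.Spectral_Radius"
    "Jordan_Normal_Form.Determinant"
begin

definition subfield_C :: "complex set \<Rightarrow> bool" where
  "subfield_C K \<longleftrightarrow> 0 \<in> K \<and> 1 \<in> K \<and>
     (\<forall>x\<in>K. \<forall>y\<in>K. x + y \<in> K \<and> x * y \<in> K) \<and> (\<forall>x\<in>K. - x \<in> K \<and> inverse x \<in> K)"

definition gen_field :: "complex set \<Rightarrow> complex set" where
  "gen_field S = \<Inter> {K. subfield_C K \<and> S \<subseteq> K}"

definition field_embs :: "complex set \<Rightarrow> (complex \<Rightarrow> complex) set" where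
  "field_embs K = {\<sigma>. (\<forall>x. x \<notin> K \<longrightarrow> \<sigma> x = 0) \<and> \<sigma> 1 = 1 \<and>
      (\<forall>x\<in>K. \<forall>y\<in>K. \<sigma> (x + y) = \<sigma> x + \<sigma> y \<and> \<sigma> (x * y) = \<sigma> x * \<sigma> y)}"

definition ints_of :: "complex set \<Rightarrow> complex set" where
  "ints_of K = {x \<in> K. algebraic_int x}"

text \<open>With K = Q(x_1,...,x_N), d = [K:Q] = number of embeddings K -> C, O_K its ring of integers
  and I = O_K + x_1 O_K + ... + x_N O_K:
  sum over archimedean places of n_v/d * max(0, log|x_i|_v) = (1/d) sum_sigma log max(1, |sigma x_i|),
  sum over finite places = (1/d) log [I : O_K].\<close>
definition weil_height :: "complex vec \<Rightarrow> real" where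
  "weil_height x = (let n = dim_vec x;
      K = gen_field {x $ i | i. i < n};
      E = field_embs K;
      OK = ints_of K;
      I = {a0 + (\<Sum>i<n. a i * x $ i) | a0 a. a0 \<in> OK \<and> (\<forall>i<n. a i \<in> OK)};
      cosets = {(\<lambda>z. y + z) ` OK | y. y \<in> I}
    in ((\<Sum>\<sigma>\<in>E. ln (Max (insert 1 {cmod (\<sigma> (x $ i)) | i. i < n}))) + ln (real (card cosets)))
        / real (card E))"

definition Gm :: "nat \<Rightarrow> complex vec set" where
  "Gm N = {x. dim_vec x = N \<and> (\<forall>i<N. x $ i \<noteq> 0 \<and> algebraic (x $ i))}"

definition phi :: "int mat \<Rightarrow> complex vec \<Rightarrow> complex vec" where
  "phi A x = vec (dim_row A) (\<lambda>i. \<Prod>j<dim_col A. (x $ j) powi (A $$ (i, j)))"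

definition jordan_ell :: "complex mat \<Rightarrow> nat" where
  "jordan_ell B = (let n_as = (SOME n_as. jordan_nf B n_as)
     in Max {k. \<exists>a. (k, a) \<in> set n_as \<and> cmod a = spectral_radius B} - 1)"

definition can_height_plus :: "int mat \<Rightarrow> complex vec \<Rightarrow> ereal" where
  "can_height_plus A P = (let B = map_mat of_int A :: complex mat;
      \<delta> = spectral_radius B; l = jordan_ell B
    in limsup (\<lambda>n. ereal (weil_height (phi (A ^\<^sub>m n) P) / (real n ^ l * \<delta> ^ n))))"

text \<open>A' = |det A| * A^{-1}, characterised as the (unique) integer matrix with A A' = |det A| I.\<close>
definition dual_mat :: "int mat \<Rightarrow> int mat" where
  "dual_mat A = (SOME B. B \<in> carrier_mat (dim_row A) (dim_row A) \<and>
      A * B = of_int \<bar>det A\<bar> \<cdot>\<^sub>m 1\<^sub>m (dim_row A))"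

definition can_height_minus :: "int mat \<Rightarrow> complex vec \<Rightarrow> ereal" where
  "can_height_minus A P = can_height_plus (dual_mat A) P"

definition can_height :: "int mat \<Rightarrow> complex vec \<Rightarrow> ereal" where
  "can_height A P = can_height_plus A P + can_height_minus A P"

definition diagonalizable_C :: "int mat \<Rightarrow> bool" where
  "diagonalizable_C A \<longleftrightarrow> (\<exists>D. diagonal_mat D \<and> similar_mat (map_mat of_int A :: complex mat) D)"

end

(* Let K be the field generated by the coordinates of P and, for an integer matrix B, let w(B) be
   [K : Q] times the height of phi_B(P), computed over K as a sum over embeddings plus the logarithm
   of the index of the ring of integers in the fractional ideal spanned by 1 and the coordinates.
   Then w is subadditive, w(mI) >= m w(I), and w(E) is bounded by a multiple of the largest entry
   of E; hence w(I) <= a w(B) + b w(C) + O(eps) whenever a B + b C is within eps of the identity I,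
   for real a, b >= 0.  Since A is diagonalizable, recurrence of powers of unit complex numbers
   gives arbitrarily large k for which A^k / delta^k (one modulus), respectively
   A^k / delta^k + A'^k / delta'^k (two moduli), is as close to the identity as desired. *)
theory Submission
  imports Defs "HOL-Library.Set_Algebras" "HOL-Computational_Algebra.Fundamental_Theorem_Algebra"
    "Jordan_Normal_Form.Jordan_Normal_Form_Uniqueness"
begin

section \<open>Spans and algebraic integers\<close>

text \<open>The index estimates rest on one fact: a finitely generated nonzero fractional ideal of
  the ring of integers is invertible. It is derived here from integer relations. Invertibility lets
  ideals be cancelled in products, and it replaces localisation when a linear relation has to be
  made integral and nontrivial modulo a maximal ideal. A single bound then serves twice: multiplying
  both terms of M \<subseteq> M' by a module of rank r raises the index at most to its r-th power.
  With r = 1 it compares products of ideals over one field, with r = [K : F] it compares ideals over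
  two fields. The second use is forced by the definition of the height over the field generated by
  the coordinates of the point at hand: these fields may change with the iterate, whereas
  subadditivity needs one fixed field. The height over the fixed field K, divided by [K : Q], is at
  most the true height at every image of P and equals it at P, which are the directions that the
  final estimate asks for.\<close>

inductive_set span_over :: "complex set \<Rightarrow> complex set \<Rightarrow> complex set" for R S where
  zero: "0 \<in> span_over R S"
| step: "a \<in> R \<Longrightarrow> s \<in> S \<Longrightarrow> z \<in> span_over R S \<Longrightarrow> a * s + z \<in> span_over R S"

definition subring_C :: "complex set \<Rightarrow> bool" where
  "subring_C R \<longleftrightarrow> 0 \<in> R \<and> 1 \<in> R \<and> (\<forall>x\<in>R. \<forall>y\<in>R. x + y \<in> R \<and> x * y \<in> R) \<and> (\<forall>x\<in>R. - x \<in> R)"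

lemma subring_C_diff: "subring_C R \<Longrightarrow> x \<in> R \<Longrightarrow> y \<in> R \<Longrightarrow> x - y \<in> R"
  unfolding subring_C_def by (metis diff_conv_add_uminus)

lemma subring_C_sum: "subring_C R \<Longrightarrow> (\<And>i. i \<in> I \<Longrightarrow> f i \<in> R) \<Longrightarrow> sum f I \<in> R"
  by (induction I rule: infinite_finite_induct) (auto simp: subring_C_def)

lemma subring_C_power: "subring_C R \<Longrightarrow> x \<in> R \<Longrightarrow> x ^ n \<in> R"
  by (induction n) (auto simp: subring_C_def)

lemma subring_C_prod: "subring_C R \<Longrightarrow> (\<And>i. i \<in> I \<Longrightarrow> f i \<in> R) \<Longrightarrow> prod f I \<in> R"
  by (induction I rule: infinite_finite_induct) (auto simp: subring_C_def)

lemma subring_C_of_int: "subring_C R \<Longrightarrow> of_int n \<in> R"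
proof -
  assume R: "subring_C R"
  have nat: "of_nat m \<in> R" for m
    by (induction m) (use R in \<open>auto simp: subring_C_def\<close>)
  show ?thesis
    by (cases n rule: int_cases2) (use R nat in \<open>auto simp: subring_C_def\<close>)
qed

lemma subring_C_Ints: "subring_C \<int>"
  by (auto simp: subring_C_def)

lemma subfield_imp_subring: "subfield_C F \<Longrightarrow> subring_C F"
  by (auto simp: subfield_C_def subring_C_def)

lemma subfield_C_divide: "subfield_C F \<Longrightarrow> x \<in> F \<Longrightarrow> y \<in> F \<Longrightarrow> x / y \<in> F"
  by (auto simp: subfield_C_def divide_inverse)

lemma span_mono: "R \<subseteq> R' \<Longrightarrow> S \<subseteq> S' \<Longrightarrow> x \<in> span_over R S \<Longrightarrow> x \<in> span_over R' S'"
  by (rotate_tac 2, induction rule: span_over.induct) (auto intro: span_over.intros)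

lemma span_add: "x \<in> span_over R S \<Longrightarrow> y \<in> span_over R S \<Longrightarrow> x + y \<in> span_over R S"
  by (induction rule: span_over.induct) (auto intro: span_over.intros simp: add.assoc)

lemma span_scale:
  assumes R: "subring_C R" and a: "a \<in> R" and x: "x \<in> span_over R S"
  shows "a * x \<in> span_over R S"
  using x
proof induction
  case (step b s z)
  then have "(a * b) * s + a * z \<in> span_over R S"
    using R a by (intro span_over.step) (auto simp: subring_C_def)
  then show ?case by (simp add: algebra_simps)
qed (auto intro: span_over.intros)

lemma span_base: "subring_C R \<Longrightarrow> s \<in> S \<Longrightarrow> s \<in> span_over R S"
  using span_over.step[of 1 R s S 0] by (auto simp: subring_C_def intro: span_over.zero)

lemma span_scale_base: "a \<in> R \<Longrightarrow> s \<in> S \<Longrightarrow> a * s \<in> span_over R S"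
  using span_over.step[of a R s S 0] by (auto intro: span_over.zero)

lemma span_minus: "subring_C R \<Longrightarrow> x \<in> span_over R S \<Longrightarrow> - x \<in> span_over R S"
  using span_scale[of R "-1" x S] by (auto simp: subring_C_def)

lemma span_diff: "subring_C R \<Longrightarrow> x \<in> span_over R S \<Longrightarrow> y \<in> span_over R S \<Longrightarrow> x - y \<in> span_over R S"
  using span_add[of x R S "-y"] span_minus by auto

lemma span_sum: "(\<And>i. i \<in> I \<Longrightarrow> f i \<in> span_over R S) \<Longrightarrow> sum f I \<in> span_over R S"
  by (induction I rule: infinite_finite_induct) (auto intro: span_add span_over.zero)

lemma span_subset_span:
  assumes R: "subring_C R" and "T \<subseteq> span_over R S"
  shows "span_over R T \<subseteq> span_over R S"
proof
  fix x assume "x \<in> span_over R T"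
  then show "x \<in> span_over R S"
    by induction (use assms in \<open>auto intro: span_over.zero span_add span_scale\<close>)
qed

lemma span_closed_subset:
  assumes "0 \<in> M" "\<And>x y. x \<in> M \<Longrightarrow> y \<in> M \<Longrightarrow> x + y \<in> M" "\<And>a s. a \<in> R \<Longrightarrow> s \<in> S \<Longrightarrow> a * s \<in> M"
  shows "span_over R S \<subseteq> M"
proof
  fix x assume "x \<in> span_over R S"
  then show "x \<in> M"
    by induction (use assms in auto)
qed

lemma span_mult:
  assumes R: "subring_C R" and x: "x \<in> span_over R S" and y: "y \<in> span_over R T"
  shows "x * y \<in> span_over R (S * T)"
  using x
proof induction
  case (step a s z)
  have "s * y \<in> span_over R (S * T)"
    using y
  proof induction
    case (step b t w)
    have "b * (s * t) + s * w \<in> span_over R (S * T)"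
      by (intro span_over.step) (use step \<open>s \<in> S\<close> in auto)
    then show ?case by (simp add: algebra_simps)
  qed (auto intro: span_over.zero)
  then have "a * (s * y) + z * y \<in> span_over R (S * T)"
    using span_add[OF span_scale[OF R \<open>a \<in> R\<close>] step.IH] by blast
  then show ?case by (simp add: algebra_simps)
qed (auto intro: span_over.zero)

lemma span_times_span_left:
  assumes R: "subring_C R"
  shows "span_over R (span_over R S * T) = span_over R (S * T)"
proof
  show "span_over R (span_over R S * T) \<subseteq> span_over R (S * T)"
  proof (rule span_subset_span[OF R], rule subsetI)
    fix x assume "x \<in> span_over R S * T"
    then obtain s t where "x = s * t" "s \<in> span_over R S" "t \<in> T" by (rule set_times_elim)
    then show "x \<in> span_over R (S * T)" using span_mult[OF R] span_base[OF R] by blast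
  qed
  show "span_over R (S * T) \<subseteq> span_over R (span_over R S * T)"
  proof
    have "S * T \<subseteq> span_over R S * T" using span_base[OF R] by (intro set_times_mono2) auto
    then show "x \<in> span_over R (span_over R S * T)" if "x \<in> span_over R (S * T)" for x
      using that by (rule span_mono[OF order_refl])
  qed
qed

lemma span_times_span_right:
  "subring_C R \<Longrightarrow> span_over R (S * span_over R T) = span_over R (S * T)"
  using span_times_span_left[of R T S] by (simp add: mult.commute)

lemma span_finite_sum:
  assumes R: "subring_C R" and "finite B" and "z \<in> span_over R B"
  shows "\<exists>c. (\<forall>b. c b \<in> R) \<and> z = (\<Sum>b\<in>B. c b * b)"
  using assms(3)
proof induction
  case zero
  show ?case by (rule exI[of _ "\<lambda>_. 0"]) (use R in \<open>auto simp: subring_C_def\<close>)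
next
  case (step a s z)
  then obtain c where c: "\<forall>b. c b \<in> R" "z = (\<Sum>b\<in>B. c b * b)" by auto
  have "(\<Sum>b\<in>B. (if b = s then a else 0) * b) = (\<Sum>b\<in>B. if s = b then a * b else 0)"
    by (intro sum.cong) auto
  also have "\<dots> = a * s" using \<open>finite B\<close> \<open>s \<in> B\<close> by (subst sum.delta') auto
  finally have "a * s + z = (\<Sum>b\<in>B. (c b + (if b = s then a else 0)) * b)"
    by (simp add: distrib_right sum.distrib c(2))
  then show ?case
    using c R step by (intro exI[of _ "\<lambda>b. c b + (if b = s then a else 0)"]) (auto simp: subring_C_def)
qed

text \<open>A complex number that stabilises a finitely generated lattice is an eigenvalue of an integer
  matrix, hence a root of its characteristic polynomial.\<close>
lemma algebraic_int_of_lattice: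
  assumes B: "finite B" and b: "b \<in> B" "b \<noteq> 0"
    and stab: "\<And>b. b \<in> B \<Longrightarrow> z * b \<in> span_over \<int> B"
  shows "algebraic_int z"
proof -
  obtain bs where bs: "set bs = B" "distinct bs" using finite_distinct_list[OF B] by auto
  define n where "n = length bs"
  have "\<exists>c. (\<forall>b'. c b' \<in> \<int>) \<and> z * b = (\<Sum>b'\<in>B. c b' * b')" if "b \<in> B" for b
    using span_finite_sum[OF subring_C_Ints B stab[OF that]] .
  then obtain c where c: "\<And>b b'. b \<in> B \<Longrightarrow> c b b' \<in> \<int>"
      "\<And>b. b \<in> B \<Longrightarrow> z * b = (\<Sum>b'\<in>B. c b b' * b')" by metis
  have "\<exists>k::int. b \<in> B \<longrightarrow> c b b' = of_int k" for b b' using c(1)[of b b'] by (cases "b \<in> B") (auto elim: Ints_cases)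
  then obtain k :: "complex \<Rightarrow> complex \<Rightarrow> int" where k: "\<And>b b'. b \<in> B \<Longrightarrow> c b b' = of_int (k b b')" by metis
  \<comment> \<open>Row i holds integer coordinates of z times the i-th generator, so the vector of
    generators is an eigenvector for z. It is nonzero because b is.\<close>
  define M where "M = mat n n (\<lambda>(i,j). k (bs ! i) (bs ! j))"
  define v where "v = vec n (\<lambda>i. bs ! i)"
  have M: "M \<in> carrier_mat n n" by (simp add: M_def)
  let ?M = "map_mat of_int M :: complex mat"
  have "?M *\<^sub>v v = z \<cdot>\<^sub>v v"
  proof (rule eq_vecI)
    fix i assume "i < dim_vec (z \<cdot>\<^sub>v v)"
    then have i: "i < n" by (simp add: v_def)
    then have iB: "bs ! i \<in> B" using bs n_def by auto
    have "(?M *\<^sub>v v) $ i = (\<Sum>j<n. of_int (k (bs ! i) (bs ! j)) * bs ! j)"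
      using i by (simp add: M_def v_def scalar_prod_def lessThan_atLeast0)
    also have "\<dots> = (\<Sum>b'\<in>B. of_int (k (bs ! i) b') * b')"
      using bs by (subst sum.reindex_bij_betw[of "(!) bs" "{..<n}" B, symmetric])
        (auto simp: n_def bij_betw_nth)
    also have "\<dots> = z * bs ! i" using c(2)[OF iB] k[OF iB] by simp
    finally show "(?M *\<^sub>v v) $ i = (z \<cdot>\<^sub>v v) $ i" using i by (simp add: v_def)
  qed (auto simp: M_def v_def)
  moreover have "v \<noteq> 0\<^sub>v n"
  proof
    assume "v = 0\<^sub>v n"
    moreover obtain i where "i < n" "bs ! i = b" using b bs by (metis in_set_conv_nth n_def)
    ultimately show False using b by (metis index_vec index_zero_vec(1) v_def)
  qed
  ultimately have "eigenvalue ?M z"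
    unfolding eigenvalue_def eigenvector_def using M by (intro exI[of _ v]) (auto simp: v_def)
  then have "poly (char_poly ?M) z = 0"
    using eigenvalue_root_char_poly[of ?M n] M by auto
  then have "poly (map_poly of_int (char_poly M)) z = 0"
    by (simp add: of_int_hom.char_poly_hom[OF M])
  moreover have "lead_coeff (char_poly M) = 1"
    using degree_monic_char_poly[OF M] by auto
  ultimately show ?thesis unfolding algebraic_int_altdef_ipoly by blast
qed

text \<open>The powers of x below the degree of a monic relation span a lattice stable under x.
  Membership of 1 ensures that a product of two such lattices is nonzero.\<close>

lemma algebraic_int_lattice:
  assumes "algebraic_int x"
  obtains B where "finite B" "1 \<in> B" "\<And>b. b \<in> B \<Longrightarrow> x * b \<in> span_over \<int> B"
proof -
  obtain p where p: "lead_coeff p = 1" "\<forall>i. poly.coeff p i \<in> \<int>" "poly p x = 0"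
    using assms by (auto simp: algebraic_int.simps)
  define n where "n = degree p"
  have n: "n > 0" using p by (intro Nat.gr0I) (auto simp: n_def elim!: degree_eq_zeroE)
  let ?B = "(\<lambda>i. x ^ i) ` {..<n}"
  have "0 = (\<Sum>i\<le>n. poly.coeff p i * x ^ i)" using p(3) by (simp add: poly_altdef n_def)
  also have "\<dots> = x ^ n + (\<Sum>i<n. poly.coeff p i * x ^ i)"
    using p(1) by (simp add: n_def flip: lessThan_Suc_atMost)
  finally have "x ^ n = (\<Sum>i<n. (- poly.coeff p i) * x ^ i)"
    by (simp add: sum_negf eq_neg_iff_add_eq_0)
  then have xn: "x ^ n \<in> span_over \<int> ?B"
    using p(2) by (auto intro!: span_sum span_scale_base simp del: mult_minus_left)
  show thesis
  proof (rule that[of ?B])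
    show "1 \<in> ?B" using n by (auto intro!: image_eqI[of _ _ 0])
    fix b assume "b \<in> ?B"
    then obtain i where i: "i < n" "b = x ^ i" by auto
    show "x * b \<in> span_over \<int> ?B"
    proof (cases "Suc i = n")
      case True
      then show ?thesis using xn i by auto
    next
      case False
      then have "x ^ Suc i \<in> ?B" using i by (intro imageI) simp
      then show ?thesis using i span_base[OF subring_C_Ints, of "x ^ Suc i" ?B] by simp
    qed
  qed auto
qed

text \<open>The products of the generators of a lattice stable under x and of one stable under y
  span a lattice stable under both.\<close>

lemma algebraic_int_plus_times:
  assumes "algebraic_int x" "algebraic_int y"
  shows "algebraic_int (x + y)" and "algebraic_int (x * y :: complex)"
proof -
  obtain B where B: "finite B" "1 \<in> B" "\<And>b. b \<in> B \<Longrightarrow> x * b \<in> span_over \<int> B"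
    using algebraic_int_lattice[OF assms(1)] by metis
  obtain C where C: "finite C" "1 \<in> C" "\<And>b. b \<in> C \<Longrightarrow> y * b \<in> span_over \<int> C"
    using algebraic_int_lattice[OF assms(2)] by metis
  note R = subring_C_Ints
  have fin: "finite (B * C)" using B C by (auto intro: finite_set_times)
  have one: "1 \<in> B * C" using set_times_intro[OF B(2) C(2)] by simp
  have stab: "(x + y) * d \<in> span_over \<int> (B * C)" "x * y * d \<in> span_over \<int> (B * C)" if "d \<in> B * C" for d
  proof -
    from that obtain b c where bc: "b \<in> B" "c \<in> C" "d = b * c" by (auto elim: set_times_elim)
    have "(x * b) * c \<in> span_over \<int> (B * C)" "b * (y * c) \<in> span_over \<int> (B * C)"
      "(x * b) * (y * c) \<in> span_over \<int> (B * C)"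
      using B(3) C(3) bc by (auto intro!: span_mult[OF R] intro: span_base[OF R])
    then show "(x + y) * d \<in> span_over \<int> (B * C)" "x * y * d \<in> span_over \<int> (B * C)"
      using span_add[of "(x * b) * c" \<int> "B * C" "b * (y * c)"] bc by (simp_all add: algebra_simps)
  qed
  show "algebraic_int (x + y)" "algebraic_int (x * y)"
    using algebraic_int_of_lattice[OF fin one] stab by auto
qed

lemma subring_ints_of: "subfield_C F \<Longrightarrow> subring_C (ints_of F)"
  by (auto simp: subring_C_def ints_of_def subfield_C_def algebraic_int_plus_times)

lemma algebraic_int_diff: "algebraic_int x \<Longrightarrow> algebraic_int y \<Longrightarrow> algebraic_int (x - y :: complex)"
  using algebraic_int_plus_times(1)[of x "- y"] by simp

section \<open>Invertible fractional ideals\<close>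

lemma subset_times_one: "1 \<in> (T::complex set) \<Longrightarrow> S \<subseteq> S * T"
  using set_times_intro[of _ S 1 T] by auto

text \<open>If \<open>x\<close> is a root of \<open>\<Sum> a\<^sub>j X\<^sup>j\<close>, then
  \<open>q\<^sub>j = \<Sum>i>j. a\<^sub>i x\<^sup>i\<^sup>-\<^sup>j\<^sup>-\<^sup>1\<close> stabilises the lattice spanned by
  \<open>1, x, \<dots>, x\<^sup>n\<^sup>-\<^sup>1\<close>.\<close>
lemma algebraic_int_partial_quotient:
  fixes a :: "nat \<Rightarrow> int" and x :: complex
  assumes root: "(\<Sum>i\<le>n. of_int (a i) * x ^ i) = 0" and "n > 0"
  shows "algebraic_int (\<Sum>i\<in>{j<..n}. of_int (a i) * x ^ (i - Suc j))" (is "algebraic_int ?q")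
proof -
  let ?B = "(\<lambda>i. x ^ i) ` {..<n}"
  show ?thesis
  proof (rule algebraic_int_of_lattice[of ?B 1])
    show "1 \<in> ?B" using \<open>n > 0\<close> by (auto intro!: image_eqI[of _ _ 0])
    fix b assume "b \<in> ?B"
    then obtain k where k: "k < n" "b = x ^ k" by auto
    show "?q * b \<in> span_over \<int> ?B"
    proof (cases "k \<le> j")
      case True
      have "?q * b = (\<Sum>i\<in>{j<..n}. of_int (a i) * x ^ (i - Suc j + k))"
        unfolding k(2) sum_distrib_right by (simp only: power_add mult.assoc)
      also have "\<dots> \<in> span_over \<int> ?B"
        using True by (intro span_sum span_scale_base imageI) auto
      finally show ?thesis .
    next
      case False
      have "?q * b = (\<Sum>i\<in>{j<..n}. of_int (a i) * x ^ i) * x ^ (k - Suc j)"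
        unfolding k sum_distrib_right
      proof (rule sum.cong)
        fix i assume i: "i \<in> {j<..n}"
        then have "i - Suc j + k = i + (k - Suc j)" using False by auto
        then show "of_int (a i) * x ^ (i - Suc j) * x ^ k = of_int (a i) * x ^ i * x ^ (k - Suc j)"
          by (metis mult.assoc power_add)
      qed simp
      also have "(\<Sum>i\<in>{j<..n}. of_int (a i) * x ^ i) = - (\<Sum>i\<le>j. of_int (a i) * x ^ i)"
      proof -
        have "{..n} = {..j} \<union> {j<..n}" using False k by auto
        then have "(\<Sum>i\<le>n. of_int (a i) * x ^ i) = (\<Sum>i\<le>j. of_int (a i) * x ^ i) + (\<Sum>i\<in>{j<..n}. of_int (a i) * x ^ i)"
          by (simp only:) (rule sum.union_disjoint, auto)
        then show ?thesis using root by (simp add: eq_neg_iff_add_eq_0 add.commute)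
      qed
      also have "- (\<Sum>i\<le>j. of_int (a i) * x ^ i) * x ^ (k - Suc j)
          = (\<Sum>i\<le>j. of_int (- a i) * x ^ (i + (k - Suc j)))"
        by (simp add: sum_distrib_right sum_negf power_add mult.assoc)
      also have "\<dots> \<in> span_over \<int> ?B"
        using False k by (intro span_sum span_scale_base imageI) auto
      finally show ?thesis .
    qed
  qed auto
qed

text \<open>Division by the content makes the coefficients coprime, and Bezout's identity yields u.
  This is the arithmetic input for inverting the ideal generated by 1 and x.\<close>

lemma algebraic_primitive_relation:
  assumes "algebraic (x::complex)"
  obtains a :: "nat \<Rightarrow> int" and n u where "n > 0" "(\<Sum>i\<le>n. of_int (a i) * x ^ i) = 0"
    "(\<Sum>i\<le>n. u i * a i) = 1"
proof -
  obtain p :: "int poly" where p: "poly (map_poly of_int p) x = 0" "p \<noteq> 0"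
    using assms by (auto elim: algebraicE')
  define q where "q = primitive_part p"
  have pq: "p = Polynomial.smult (content p) q" by (simp add: q_def)
  have "poly (map_poly of_int p) x = of_int (content p) * poly (map_poly of_int q) x"
    by (subst pq) (simp add: of_int_hom.map_poly_hom_smult)
  then have root: "poly (map_poly of_int q) x = 0" using p by auto
  have q0: "q \<noteq> 0" and cq: "content q = 1" using p by (auto simp: q_def)
  define n where "n = degree q"
  have "(\<Sum>i\<le>n. of_int (poly.coeff q i) * x ^ i) = 0"
    using root by (simp add: poly_altdef n_def)
  moreover have "n > 0"
  proof (rule Nat.gr0I)
    assume "n = 0"
    then obtain c where "q = [:c:]" by (auto simp: n_def elim: degree_eq_zeroE)
    then show False using root q0 by simp
  qed
  moreover have "\<exists>u. (\<Sum>i\<le>m. u i * poly.coeff q i) = (GCD i\<in>{..m}. poly.coeff q i)" for m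
  proof (induction m)
    case 0
    show ?case by (intro exI[of _ "\<lambda>_. sgn (poly.coeff q 0)"]) (simp add: abs_sgn mult.commute)
  next
    case (Suc m)
    then obtain u where u: "(\<Sum>i\<le>m. u i * poly.coeff q i) = (GCD i\<in>{..m}. poly.coeff q i)" by auto
    obtain r s where "r * poly.coeff q (Suc m) + s * (GCD i\<in>{..m}. poly.coeff q i) = gcd (poly.coeff q (Suc m)) (GCD i\<in>{..m}. poly.coeff q i)"
      using bezout_int by blast
    then show ?case
      by (intro exI[of _ "\<lambda>i. if i = Suc m then r else s * u i"])
        (simp add: atMost_Suc u[symmetric] sum_distrib_left mult.assoc)
  qed
  then obtain u where "(\<Sum>i\<le>n. u i * poly.coeff q i) = (GCD i\<in>{..n}. poly.coeff q i)" by blast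
  moreover have "(GCD i\<in>{..n}. poly.coeff q i) = content q"
  proof -
    have "{..degree q} = insert (degree q) {0..<degree q}" by auto
    then show ?thesis by (simp add: content_def coeffs_def n_def q0)
  qed
  ultimately show thesis using that cq by metis
qed

section \<open>Fractional ideals given by finite sets of generators\<close>

locale algebraic_field =
  fixes F :: "complex set"
  assumes F: "subfield_C F" and alg: "x \<in> F \<Longrightarrow> algebraic x"
begin

abbreviation "\<O> \<equiv> ints_of F"

lemma O: "subring_C \<O>" by (rule subring_ints_of[OF F])
lemma FR: "subring_C F" by (rule subfield_imp_subring[OF F])
lemma O_subset: "\<O> \<subseteq> F" by (auto simp: ints_of_def)
lemma O_one: "1 \<in> \<O>" and O_zero: "0 \<in> \<O>" using O by (auto simp: subring_C_def)

lemma F_mult: "x \<in> F \<Longrightarrow> y \<in> F \<Longrightarrow> x * y \<in> F"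
  using F by (auto simp: subfield_C_def)

lemma O_add: "x \<in> \<O> \<Longrightarrow> y \<in> \<O> \<Longrightarrow> x + y \<in> \<O>"
  and O_mult: "x \<in> \<O> \<Longrightarrow> y \<in> \<O> \<Longrightarrow> x * y \<in> \<O>"
  and O_minus: "x \<in> \<O> \<Longrightarrow> - x \<in> \<O>"
  using O by (auto simp: subring_C_def)

abbreviation "\<I> S \<equiv> span_over \<O> S"

lemma span_one: "\<I> {1} = \<O>"
proof
  show "\<I> {1} \<subseteq> \<O>" by (rule span_closed_subset) (auto simp: O_zero O_add)
  show "\<O> \<subseteq> \<I> {1}" using span_scale_base[of _ \<O> 1 "{1}"] by auto
qed

lemma span_in_field: "S \<subseteq> F \<Longrightarrow> \<I> S \<subseteq> F"
  using O_subset by (intro span_closed_subset) (use F in \<open>auto simp: subfield_C_def\<close>)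

text \<open>T generates the inverse ideal. With generating sets in place of ideals, products of
  ideals become products of sets.\<close>

definition invertible :: "complex set \<Rightarrow> bool" where
  "invertible S \<longleftrightarrow> (\<exists>T. finite T \<and> T \<subseteq> F \<and> \<I> (S * T) = \<O>)"

text \<open>For the partial quotients q_j of a primitive relation, both q_j and x * q_j are
  algebraic integers, and a_j = q_(j-1) - x * q_j. The product of (1, x) with the ideal of all q_j
  is therefore integral and contains every a_j, hence 1.\<close>

lemma invertible_pair_one:
  assumes x: "x \<in> F"
  shows "invertible {1, x}"
proof -
  obtain a n u where n: "n > 0" and root: "(\<Sum>i\<le>n. of_int (a i) * x ^ i) = 0"
    and u: "(\<Sum>i\<le>n. u i * a i) = (1::int)"
    using algebraic_primitive_relation[OF alg[OF x]] by blast
  define q where "q j = (\<Sum>i\<in>{j<..n}. of_int (a i) * x ^ (i - Suc j))" for j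
  have qF: "q j \<in> F" for j
    unfolding q_def using FR x
    by (intro subring_C_sum) (auto intro!: F_mult subring_C_power subring_C_of_int)
  have qO: "q j \<in> \<O>" for j
    using algebraic_int_partial_quotient[OF root n, of j] qF[of j] by (simp add: ints_of_def q_def)
  \<comment> \<open>Horner's recursion. For j = 0 the predecessor would be the value of the whole
    relation at x, which is 0.\<close>
  have rec: "x * q j = (if j = 0 then 0 else q (j - 1)) - of_int (a j)" if "j \<le> n" for j
  proof -
    have "of_int (a j) + x * q j = (\<Sum>i\<in>{j..n}. of_int (a i) * x ^ (i - j))"
    proof -
      have "{j..n} = insert j {j<..n}" using that by auto
      then have "(\<Sum>i\<in>{j..n}. of_int (a i) * x ^ (i - j)) = of_int (a j) + (\<Sum>i\<in>{j<..n}. of_int (a i) * x ^ (i - j))"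
        by simp
      also have "(\<Sum>i\<in>{j<..n}. of_int (a i) * x ^ (i - j)) = x * q j"
        unfolding q_def sum_distrib_left
        by (intro sum.cong) (auto simp: mult_ac Suc_diff_Suc simp flip: power_Suc)
      finally show ?thesis by simp
    qed
    also have "\<dots> = (if j = 0 then 0 else q (j - 1))"
    proof (cases j)
      case 0
      then show ?thesis using root by (simp add: atLeast0AtMost)
    next
      case (Suc k)
      then have "{j..n} = {k<..n}" by auto
      then show ?thesis using Suc by (simp add: q_def)
    qed
    finally show ?thesis by (simp add: algebra_simps)
  qed
  have xqO: "x * q j \<in> \<O>" if "j \<le> n" for j
    using rec[OF that] qO O_zero subring_C_of_int[OF O] by (auto intro!: subring_C_diff[OF O] O_minus)
  define T where "T = q ` {..n}"
  have "\<I> ({1, x} * T) = \<O>"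
  proof
    have "{1, x} * T \<subseteq> \<O>"
      by (auto simp: T_def qO xqO elim!: set_times_elim)
    then show "\<I> ({1, x} * T) \<subseteq> \<O>"
      by (intro span_closed_subset) (auto simp: O_zero intro: O_add O_mult)
    have "of_int (a j) \<in> \<I> ({1, x} * T)" if "j \<le> n" for j
    proof -
      have "x * q j \<in> \<I> ({1, x} * T)"
        using that by (intro span_base[OF O] set_times_intro) (auto simp: T_def)
      moreover have "j \<noteq> 0 \<Longrightarrow> 1 * q (j - 1) \<in> \<I> ({1, x} * T)"
        using that by (intro span_base[OF O] set_times_intro) (auto simp: T_def)
      ultimately have "(if j = 0 then 0 else q (j - 1)) - x * q j \<in> \<I> ({1, x} * T)"
        by (intro span_diff[OF O]) (auto intro: span_over.zero)
      then show ?thesis using rec[OF that] by simp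
    qed
    then have "(\<Sum>i\<le>n. of_int (u i) * of_int (a i)) \<in> \<I> ({1, x} * T)"
      by (intro span_sum span_scale[OF O] subring_C_of_int[OF O]) auto
    also have "(\<Sum>i\<le>n. of_int (u i) * of_int (a i)) = (of_int (\<Sum>i\<le>n. u i * a i) :: complex)" by simp
    finally have one: "1 \<in> \<I> ({1, x} * T)" by (simp add: u)
    show "\<O> \<subseteq> \<I> ({1, x} * T)" using span_scale[OF O _ one] by auto
  qed
  then show ?thesis unfolding invertible_def by (intro exI[of _ T]) (auto simp: T_def qF)
qed

lemma span_prod_eq:
  assumes "\<I> S = \<I> S'" shows "\<I> (S * T) = \<I> (S' * T)"
  using span_times_span_left[OF O, of S T] span_times_span_left[OF O, of S' T] assms by simp

text \<open>The cancellation rule: with S the product of an ideal and its inverse, it inserts or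
  removes both factors at once.\<close>

lemma span_O_times: "\<I> S = \<O> \<Longrightarrow> \<I> (S * T) = \<I> T"
  using span_prod_eq[of S "{1}" T] mult_1_left[of T] by (simp add: span_one)

text \<open>If T inverts S * Q, then Q * T inverts S.\<close>

lemma invertible_factor:
  assumes "invertible (S * Q)" "finite Q" "Q \<subseteq> F"
  shows "invertible S"
proof -
  obtain T where T: "finite T" "T \<subseteq> F" "\<I> (S * Q * T) = \<O>" using assms by (auto simp: invertible_def)
  show ?thesis unfolding invertible_def
    using T assms by (intro exI[of _ "Q * T"]) (auto intro!: finite_set_times F_mult elim!: set_times_elim simp: mult.assoc)
qed

lemma invertible_mult:
  assumes "invertible S" "invertible S'"
  shows "invertible (S * S')"
proof -
  obtain T where T: "finite T" "T \<subseteq> F" "\<I> (S * T) = \<O>" using assms by (auto simp: invertible_def)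
  obtain T' where T': "finite T'" "T' \<subseteq> F" "\<I> (S' * T') = \<O>" using assms by (auto simp: invertible_def)
  have "\<I> ((S * S') * (T * T')) = \<I> ((S * T) * (S' * T'))" by (simp add: mult_ac)
  also have "\<dots> = \<O>" using T T' span_O_times by simp
  finally show ?thesis unfolding invertible_def
    using T T' by (intro exI[of _ "T * T'"]) (auto intro!: finite_set_times F_mult elim!: set_times_elim)
qed

lemma invertible_singleton:
  assumes "x \<in> F" "x \<noteq> 0" shows "invertible {x}"
  unfolding invertible_def
proof (intro exI[of _ "{inverse x}"] conjI)
  have "{x} * {inverse x} = {1}" using assms by (auto simp: set_times_def)
  then show "\<I> ({x} * {inverse x}) = \<O>" by (simp add: span_one)
qed (use assms F in \<open>auto simp: subfield_C_def\<close>)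

lemma invertible_pair:
  assumes "a \<in> F" "b \<in> F" "a \<noteq> 0"
  shows "invertible {a, b}"
proof -
  have "invertible ({a} * {1, b / a})"
    using assms by (intro invertible_mult invertible_singleton invertible_pair_one subfield_C_divide[OF F])
  also have "{a} * {1, b / a} = {a, b}" using assms by (auto simp: set_times_def)
  finally show ?thesis .
qed

text \<open>Pruefer's identity \<open>(\<aa> + \<bb>)(\<bb> + \<cc>)(\<cc> + \<aa>) = (\<aa> + \<bb> + \<cc>)(\<aa>\<bb> + \<bb>\<cc> + \<cc>\<aa>)\<close> reduces
  invertibility to ideals with two generators.\<close>
lemma invertible_finite_nonzero:
  assumes "finite S" "S \<noteq> {}" "S \<subseteq> F - {0}"
  shows "invertible S"
  using assms
proof (induction "card S" arbitrary: S rule: less_induct)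
  case less
  show ?case
  proof (cases "card S \<le> 2")
    case True
    then consider "card S = 1" | "card S = 2" using less.prems by (metis One_nat_def Suc_leI card_gt_0_iff le_neq_implies_less less_2_cases_iff linorder_not_less not_one_le_zero)
    then show ?thesis
    proof cases
      case 1
      then show ?thesis using less.prems by (auto simp: card_1_singleton_iff intro!: invertible_singleton)
    next
      case 2
      then show ?thesis using less.prems by (auto simp: card_2_iff intro!: invertible_pair)
    qed
  next
    case False
    then obtain a S' where a: "S = insert a S'" "a \<notin> S'"
      by (metis Suc_leI card_le_Suc_iff le_zero_eq nat_le_linear not_less_eq_eq less.prems(2) insert_Diff ex_in_conv Diff_iff singletonI)
    with less.prems False have S': "finite S'" "card S' \<ge> 2" by auto
    then obtain b C where b: "S' = insert b C" "b \<notin> C"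
      by (metis card_eq_0_iff ex_in_conv insert_Diff Diff_iff singletonI not_numeral_le_zero)
    with S' have C: "finite C" "C \<noteq> {}" by auto
    have cards: "card S = Suc (Suc (card C))" using a b C by simp
    have "card C > 0" using C by (simp add: card_gt_0_iff)
    have inv: "invertible {a, b}" "invertible (insert b C)" "invertible (insert a C)"
      using less.prems a b C cards \<open>card C > 0\<close> by (auto intro!: less.hyps simp: card_insert_if)
    \<comment> \<open>The three ideals of the identity are generated by a, by b and by C, and
      \<open>?Q\<close> collects their pairwise products. The identity already holds between the
      sets of products, where multiplicities are invisible.\<close>
    let ?Q = "insert (a * b) ({b} * C \<union> C * {a})"
    have "{a, b} * insert b C * insert a C = S * ?Q"
      unfolding a b
    proof (intro equalityI subsetI)
      fix x assume "x \<in> {a, b} * insert b C * insert a C"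
      then obtain u v w where uvw: "x = u * v * w" "u \<in> {a, b}" "v \<in> insert b C" "w \<in> insert a C"
        by (auto elim!: set_times_elim)
      let ?S = "insert a (insert b C)"
      have "\<exists>s\<in>?S. \<exists>q\<in>?Q. x = s * q"
      proof -
        consider "v = b" "w = a" | "v = b" "w \<in> C" "u = a" | "v = b" "w \<in> C" "u = b" | "v \<in> C" "w = a"
          | "v \<in> C" "w \<in> C" using uvw by auto
        then show ?thesis
        proof cases
          case 1
          then show ?thesis using uvw by (intro bexI[of _ u] bexI[of _ "a * b"]) ((simp add: mult_ac; fail) | (auto; fail))+
        next
          case 2
          then show ?thesis using uvw by (intro bexI[of _ a] bexI[of _ "b * w"]) ((simp add: mult_ac; fail) | (auto; fail))+
        next
          case 3
          then show ?thesis using uvw by (intro bexI[of _ b] bexI[of _ "b * w"]) ((simp add: mult_ac; fail) | (auto; fail))+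
        next
          case 4
          then show ?thesis using uvw by (intro bexI[of _ u] bexI[of _ "v * a"]) ((simp add: mult_ac; fail) | (auto; fail))+
        next
          case 5
          have "u * w \<in> ?Q" using uvw 5 by (auto simp: mult.commute[of a w])
          then show ?thesis using uvw 5 by (rule_tac bexI[of _ v], rule_tac bexI[of _ "u * w"]) auto
        qed
      qed
      then show "x \<in> ?S * ?Q" by (auto intro: set_times_intro)
    next
      fix x assume "x \<in> insert a (insert b C) * ?Q"
      then obtain s q where sq: "x = s * q" "s \<in> insert a (insert b C)" "q \<in> ?Q" by (auto elim!: set_times_elim)
      have "\<exists>u\<in>{a,b}. \<exists>v\<in>insert b C. \<exists>w\<in>insert a C. x = u * v * w"
      proof -
        have "q = a * b \<or> (\<exists>c\<in>C. q = b * c) \<or> (\<exists>c\<in>C. q = c * a)"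
          using sq(3) by (auto elim!: set_times_elim)
        with sq(2) consider "q = a * b" "s \<in> {a, b}" | "q = a * b" "s \<in> C"
          | c where "q = b * c" "c \<in> C" "s = a" | c where "q = b * c" "c \<in> C" "s = b"
          | c where "q = b * c" "c \<in> C" "s \<in> C"
          | c where "q = c * a" "c \<in> C" "s \<in> {a, b}" | c where "q = c * a" "c \<in> C" "s \<in> C"
          by blast
        then show ?thesis
        proof cases
          case 1 then show ?thesis using sq by (intro bexI[of _ s] bexI[of _ b] bexI[of _ a]) ((simp add: mult_ac; fail) | (auto; fail))+
        next
          case 2 then show ?thesis using sq by (intro bexI[of _ a] bexI[of _ b] bexI[of _ s]) ((simp add: mult_ac; fail) | (auto; fail))+
        next
          case (3 c) then show ?thesis using sq by (intro bexI[of _ b] bexI[of _ c] bexI[of _ a]) ((simp add: mult_ac; fail) | (auto; fail))+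
        next
          case (4 c) then show ?thesis using sq by (intro bexI[of _ b] bexI[of _ b] bexI[of _ c]) ((simp add: mult_ac; fail) | (auto; fail))+
        next
          case (5 c) then show ?thesis using sq by (intro bexI[of _ b] bexI[of _ c] bexI[of _ s]) ((simp add: mult_ac; fail) | (auto; fail))+
        next
          case (6 c) then show ?thesis using sq by (intro bexI[of _ s] bexI[of _ c] bexI[of _ a]) ((simp add: mult_ac; fail) | (auto; fail))+
        next
          case (7 c) then show ?thesis using sq by (intro bexI[of _ a] bexI[of _ c] bexI[of _ s]) ((simp add: mult_ac; fail) | (auto; fail))+
        qed
      qed
      then show "x \<in> {a, b} * insert b C * insert a C" by (auto intro: set_times_intro)
    qed
    then have "invertible (S * ?Q)" using inv by (metis invertible_mult)
    then show ?thesis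
      by (rule invertible_factor) (use less.prems a b C in \<open>auto intro!: finite_set_times F_mult elim!: set_times_elim\<close>)
  qed
qed

lemma span_remove_zero: "\<I> (S - {0}) = \<I> S"
proof
  show "\<I> (S - {0}) \<subseteq> \<I> S" by (auto intro: span_mono[of \<O> \<O> "S - {0}" S])
  show "\<I> S \<subseteq> \<I> (S - {0})"
    by (intro span_subset_span[OF O]) (metis DiffI empty_iff insert_iff span_base[OF O] span_over.zero subsetI)
qed

lemma invertible_finite:
  assumes "finite S" "S \<subseteq> F" "s \<in> S" "s \<noteq> 0"
  shows "invertible S"
proof -
  have "invertible (S - {0})" using assms by (intro invertible_finite_nonzero) auto
  then show ?thesis unfolding invertible_def using span_prod_eq[OF span_remove_zero[of S]] by metis
qed

end

section \<open>Indices of lattices\<close>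

definition additive_subgroup :: "complex set \<Rightarrow> bool" where
  "additive_subgroup B \<longleftrightarrow> 0 \<in> B \<and> (\<forall>x\<in>B. \<forall>y\<in>B. x - y \<in> B)"

text \<open>Written in the shape of \<open>cosets\<close> in \<open>weil_height\<close>, so that the
  height unfolds to it literally.\<close>

definition quot :: "complex set \<Rightarrow> complex set \<Rightarrow> complex set set" where
  "quot A B = {(\<lambda>z. y + z) ` B | y. y \<in> A}"

text \<open>An infinite quotient receives the value 0, so an upper bound on \<open>idx\<close> is
  informative only together with finiteness of the quotient.\<close>

definition idx :: "complex set \<Rightarrow> complex set \<Rightarrow> nat" where
  "idx A B = card (quot A B)"

lemma quot_image: "quot A B = (\<lambda>y. (\<lambda>z. y + z) ` B) ` A"
  by (auto simp: quot_def)

lemma additive_subgroup_add: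
  assumes "additive_subgroup B" "x \<in> B" "y \<in> B" shows "x + y \<in> B"
proof -
  have "0 - y \<in> B" using assms unfolding additive_subgroup_def by blast
  then have "x - (0 - y) \<in> B" using assms unfolding additive_subgroup_def by blast
  then show ?thesis by simp
qed

lemma coset_eq_iff:
  assumes B: "additive_subgroup B"
  shows "(\<lambda>z. y + z) ` B = (\<lambda>z. y' + z) ` B \<longleftrightarrow> y - y' \<in> B"
proof
  assume eq: "(\<lambda>z. y + z) ` B = (\<lambda>z. y' + z) ` B"
  have "y \<in> (\<lambda>z. y + z) ` B" using B by (auto simp: additive_subgroup_def image_iff)
  then obtain z where "z \<in> B" "y = y' + z" using eq by auto
  then show "y - y' \<in> B" by simp
next
  assume d: "y - y' \<in> B"
  have neg: "y' - y \<in> B"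
    using d B unfolding additive_subgroup_def by (metis diff_0 minus_diff_eq)
  show "(\<lambda>z. y + z) ` B = (\<lambda>z. y' + z) ` B"
  proof (intro equalityI image_subsetI)
    fix z assume "z \<in> B"
    then show "y + z \<in> (\<lambda>z. y' + z) ` B"
      using additive_subgroup_add[OF B d] by (intro image_eqI[of _ _ "y - y' + z"]) auto
    show "y' + z \<in> (\<lambda>z. y + z) ` B"
      using additive_subgroup_add[OF B neg \<open>z \<in> B\<close>] by (intro image_eqI[of _ _ "y' - y + z"]) auto
  qed
qed

lemma quot_representatives:
  assumes B: "additive_subgroup B" and fin: "finite (quot A B)"
  obtains T where "T \<subseteq> A" "finite T" "card T = idx A B" "\<And>x. x \<in> A \<Longrightarrow> \<exists>t\<in>T. x - t \<in> B"
    "\<And>t t'. t \<in> T \<Longrightarrow> t' \<in> T \<Longrightarrow> t - t' \<in> B \<Longrightarrow> t = t'"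
proof -
  let ?f = "\<lambda>y. (\<lambda>z. y + z) ` B"
  obtain T where T: "T \<subseteq> A" "inj_on ?f T" "quot A B = ?f ` T"
    using subset_image_inj[of "quot A B" ?f A] by (auto simp: quot_image)
  show thesis
  proof (rule that[OF T(1)])
    show "finite T" using T fin finite_imageD by metis
    show "card T = idx A B" using T by (simp add: idx_def card_image)
    fix x assume "x \<in> A"
    then have "?f x \<in> ?f ` T" using T by (metis image_eqI quot_image)
    then show "\<exists>t\<in>T. x - t \<in> B" using coset_eq_iff[OF B] by auto
  next
    show "t = t'" if "t \<in> T" "t' \<in> T" "t - t' \<in> B" for t t'
      using inj_onD[OF T(2) _ that(1,2)] that(3) coset_eq_iff[OF B] by simp
  qed
qed

lemma idx_le_card:
  assumes B: "additive_subgroup B" and T: "finite T" "\<And>x. x \<in> A \<Longrightarrow> \<exists>t\<in>T. x - t \<in> B"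
  shows "finite (quot A B)" "idx A B \<le> card T"
proof -
  have "quot A B \<subseteq> (\<lambda>y. (\<lambda>z. y + z) ` B) ` T"
    unfolding quot_image
  proof (rule image_subsetI)
    fix x assume "x \<in> A"
    then obtain t where t: "t \<in> T" "x - t \<in> B" using T(2) by blast
    then have "(\<lambda>z. x + z) ` B = (\<lambda>z. t + z) ` B" using coset_eq_iff[OF B] by simp
    then show "(\<lambda>z. x + z) ` B \<in> (\<lambda>y. (\<lambda>z. y + z) ` B) ` T" using t(1) by (rule image_eqI)
  qed
  then show "finite (quot A B)" "idx A B \<le> card T"
    unfolding idx_def using T(1) by (auto intro: finite_subset intro!: surj_card_le)
qed

lemma idx_pos:
  assumes "finite (quot A B)" "a \<in> A" shows "idx A B > 0"
  using assms by (auto simp: idx_def card_gt_0_iff quot_image)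

lemma finite_quot_between:
  assumes BC: "additive_subgroup B" "additive_subgroup C" and sub: "C \<subseteq> B" "B \<subseteq> A" and fin: "finite (quot A C)"
  shows "finite (quot A B)" "finite (quot B C)"
proof -
  obtain T where T: "finite T" "\<And>x. x \<in> A \<Longrightarrow> \<exists>t\<in>T. x - t \<in> C"
    using quot_representatives[OF BC(2) fin] by metis
  then show "finite (quot A B)" using idx_le_card(1)[OF BC(1), of T A] sub by blast
  show "finite (quot B C)"
    using fin unfolding quot_image by (rule finite_subset[OF image_mono[OF sub(2)]])
qed

text \<open>If T represents A modulo B and U represents B modulo C, then the sums t + u represent A
  modulo C, each coset exactly once.\<close>

lemma idx_mult:
  assumes A: "additive_subgroup A" and B: "additive_subgroup B" and C: "additive_subgroup C"
    and sub: "C \<subseteq> B" "B \<subseteq> A"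
    and fin: "finite (quot A B)" "finite (quot B C)"
  shows "finite (quot A C)" "idx A C = idx A B * idx B C"
proof -
  obtain T where T: "T \<subseteq> A" "finite T" "card T = idx A B" "\<And>x. x \<in> A \<Longrightarrow> \<exists>t\<in>T. x - t \<in> B"
    "\<And>t t'. t \<in> T \<Longrightarrow> t' \<in> T \<Longrightarrow> t - t' \<in> B \<Longrightarrow> t = t'"
    using quot_representatives[OF B fin(1)] by metis
  obtain U where U: "U \<subseteq> B" "finite U" "card U = idx B C" "\<And>x. x \<in> B \<Longrightarrow> \<exists>t\<in>U. x - t \<in> C"
    "\<And>t t'. t \<in> U \<Longrightarrow> t' \<in> U \<Longrightarrow> t - t' \<in> C \<Longrightarrow> t = t'"
    using quot_representatives[OF C fin(2)] by metis
  let ?f = "\<lambda>(t, u). (\<lambda>z. (t + u) + z) ` C"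
  have "quot A C = ?f ` (T \<times> U)"
  proof (intro equalityI subsetI)
    fix X assume "X \<in> quot A C"
    then obtain x where x: "x \<in> A" "X = (\<lambda>z. x + z) ` C" by (auto simp: quot_def)
    obtain t where t: "t \<in> T" "x - t \<in> B" using T(4) x by blast
    obtain u where u: "u \<in> U" "x - t - u \<in> C" using U(4) t by blast
    have "X = ?f (t, u)" unfolding x using coset_eq_iff[OF C, of x "t + u"] u by (simp add: algebra_simps)
    then show "X \<in> ?f ` (T \<times> U)" using t u by blast
  next
    fix X assume "X \<in> ?f ` (T \<times> U)"
    then obtain t u where "t \<in> T" "u \<in> U" "X = ?f (t, u)" by auto
    moreover then have "t + u \<in> A" using T(1) U(1) sub additive_subgroup_add[OF A] by blast
    ultimately show "X \<in> quot A C" unfolding quot_image by auto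
  qed
  moreover have "inj_on ?f (T \<times> U)"
  proof (rule inj_onI, clarsimp)
    fix t u t' u' assume tu: "t \<in> T" "u \<in> U" "t' \<in> T" "u' \<in> U"
      and eq: "(\<lambda>z. t + u + z) ` C = (\<lambda>z. t' + u' + z) ` C"
    then have c: "(t + u) - (t' + u') \<in> C" using coset_eq_iff[OF C] by blast
    \<comment> \<open>Modulo B the terms u and u' disappear, which forces t = t'; what remains is u
      - u' \<in> C.\<close>
    have "u' - u \<in> B" using tu U(1) B by (auto simp: additive_subgroup_def)
    then have "(t + u) - (t' + u') + (u' - u) \<in> B" using additive_subgroup_add[OF B] c sub by blast
    then have "t = t'" using T(5)[of t t'] tu by (simp add: algebra_simps)
    moreover then have "u = u'" using U(5)[of u u'] tu c by (simp add: algebra_simps)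
    ultimately show "t = t' \<and> u = u'" by simp
  qed
  ultimately show "finite (quot A C)" "idx A C = idx A B * idx B C"
    using T U by (auto simp: idx_def card_image card_cartesian_product)
qed

section \<open>Indices under multiplication by a module of bounded rank\<close>

text \<open>The indices run from 0 to r, so r + 1 elements are tested for dependence. In this form J
  may be a mere lattice, such as a ring of integers, and the bound passes to subsets.\<close>

definition dim_le :: "complex set \<Rightarrow> complex set \<Rightarrow> nat \<Rightarrow> bool" where
  "dim_le F J r \<longleftrightarrow> (\<forall>e. (\<forall>i\<le>r. e i \<in> J) \<longrightarrow>
     (\<exists>a. (\<forall>i\<le>r. a i \<in> F) \<and> (\<exists>i\<le>r. a i \<noteq> 0) \<and> (\<Sum>i\<le>r. a i * e i) = 0))"

definition submodule_of :: "complex set \<Rightarrow> complex set \<Rightarrow> bool" where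
  "submodule_of R M \<longleftrightarrow> 0 \<in> M \<and> (\<forall>x\<in>M. \<forall>y\<in>M. x + y \<in> M) \<and> (\<forall>a\<in>R. \<forall>x\<in>M. a * x \<in> M)"

lemma submodule_additive: "subring_C R \<Longrightarrow> submodule_of R M \<Longrightarrow> additive_subgroup M"
  unfolding submodule_of_def additive_subgroup_def subring_C_def
  by (metis diff_conv_add_uminus mult_minus1)

lemma submodule_span: "subring_C R \<Longrightarrow> submodule_of R (span_over R S)"
  by (auto simp: submodule_of_def span_over.zero span_add span_scale)

lemma submodule_sum: "submodule_of R M \<Longrightarrow> (\<And>i. i \<in> I \<Longrightarrow> f i \<in> M) \<Longrightarrow> sum f I \<in> M"
  by (induction I rule: infinite_finite_induct) (auto simp: submodule_of_def)

context algebraic_field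
begin

text \<open>Let T generate the inverse of the ideal of the a_i. The products a_i * t are integral
  and span \<O>, so they do not all lie in the proper ideal p; some t is the required
  factor.\<close>

lemma local_scaling:
  fixes a :: "nat \<Rightarrow> complex"
  assumes p: "submodule_of \<O> p" "1 \<notin> p" and a: "\<And>i. i \<le> s \<Longrightarrow> a i \<in> F" "k \<le> s" "a k \<noteq> 0"
  obtains c where "\<And>i. i \<le> s \<Longrightarrow> c * a i \<in> \<O>" "\<exists>i\<le>s. c * a i \<notin> p"
proof -
  let ?S = "a ` {..s::nat}"
  have "invertible ?S" using a by (intro invertible_finite[of _ "a k"]) auto
  then obtain T where T: "\<I> (?S * T) = \<O>" unfolding invertible_def by blast
  have "\<not> ?S * T \<subseteq> p"
  proof
    assume "?S * T \<subseteq> p"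
    then have "\<I> (?S * T) \<subseteq> p"
      using p(1) by (intro span_closed_subset) (auto simp: submodule_of_def)
    then show False using T O_one p(2) by auto
  qed
  then obtain i t where it: "i \<le> s" "t \<in> T" "a i * t \<notin> p" by (auto elim!: set_times_elim)
  show thesis
  proof (rule that[of t])
    fix j assume "j \<le> s"
    then have "a j * t \<in> \<I> (?S * T)" using it by (intro span_base[OF O] set_times_intro) auto
    then show "t * a j \<in> \<O>" using T by (simp add: mult.commute)
  qed (use it in \<open>auto simp: mult.commute\<close>)
qed

text \<open>For a simple quotient \<open>M'/M \<cong> O/p\<close> the quotient \<open>M'J/MJ\<close> is a vector space over the finite
  field \<open>O/p\<close>, and a linear relation over \<open>F\<close> can be rescaled to be integral and
  nontrivial modulo \<open>p\<close>, so its dimension is at most that of \<open>J\<close> over \<open>F\<close>.\<close>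
lemma idx_times_simple:
  assumes M: "submodule_of \<O> M" and M': "submodule_of \<O> M'" and sub: "M \<subseteq> M'" "M \<noteq> M'"
    and simple: "\<And>M1. submodule_of \<O> M1 \<Longrightarrow> M \<subseteq> M1 \<Longrightarrow> M1 \<subseteq> M' \<Longrightarrow> M1 = M \<or> M1 = M'"
    and fin: "finite (quot M' M)" and J: "submodule_of \<O> J" and dim: "dim_le F J r"
  shows "finite (quot (\<I> (M' * J)) (\<I> (M * J))) \<and> idx (\<I> (M' * J)) (\<I> (M * J)) \<le> idx M' M ^ r"
proof -
  obtain m where m: "m \<in> M'" "m \<notin> M" using sub by auto
  \<comment> \<open>The annihilator of m modulo M. As M'/M is simple, it is a maximal ideal and a
    \<mapsto> a * m induces \<O>/p \<cong> M'/M.\<close>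
  define p where "p = {a \<in> \<O>. a * m \<in> M}"
  define N where "N = \<I> (M * J)"
  have p: "submodule_of \<O> p"
    using M O unfolding submodule_of_def p_def by (auto simp: O_zero O_add O_mult distrib_right mult.assoc)
  have N: "submodule_of \<O> N" unfolding N_def by (rule submodule_span[OF O])
  note Ngrp = submodule_additive[OF O N] and Mgrp = submodule_additive[OF O M]
  have one_p: "1 \<notin> p" using m by (simp add: p_def)
  \<comment> \<open>The submodule M + \<O> m' lies between M and M' and differs from M, so it is
    M'.\<close>
  have gen: "\<exists>a\<in>\<O>. x - a * m' \<in> M" if x: "x \<in> M'" and m': "m' \<in> M'" "m' \<notin> M" for x m'
  proof -
    let ?M1 = "{a * m' + u | a u. a \<in> \<O> \<and> u \<in> M}"
    have "submodule_of \<O> ?M1"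
      unfolding submodule_of_def
    proof (intro conjI ballI)
      have "0 \<in> M" using M by (simp add: submodule_of_def)
      then have "0 * m' + 0 \<in> ?M1" using O_zero by blast
      then show "0 \<in> ?M1" by simp
      fix x assume "x \<in> ?M1"
      then obtain a u where x: "x = a * m' + u" "a \<in> \<O>" "u \<in> M" by auto
      show "x + y \<in> ?M1" if yM: "y \<in> ?M1" for y
      proof -
        obtain b v where y: "y = b * m' + v" "b \<in> \<O>" "v \<in> M" using yM by auto
        have "u + v \<in> M" using x y M by (simp add: submodule_of_def)
        moreover have "x + y = (a + b) * m' + (u + v)" by (simp add: x y algebra_simps)
        ultimately show ?thesis using O_add[OF x(2) y(2)] by blast
      qed
      show "b * x \<in> ?M1" if "b \<in> \<O>" for b
      proof -
        have "b * u \<in> M" using x that M by (simp add: submodule_of_def)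
        moreover have "b * x = (b * a) * m' + (b * u)" by (simp add: x algebra_simps)
        ultimately show ?thesis using O_mult[OF that x(2)] by blast
      qed
    qed
    moreover have "M \<subseteq> ?M1"
    proof
      fix u assume "u \<in> M"
      then have "0 * m' + u \<in> ?M1" using O_zero by blast
      then show "u \<in> ?M1" by simp
    qed
    moreover have "?M1 \<subseteq> M'" using M' m' sub by (auto simp: submodule_of_def)
    moreover have "m' \<in> ?M1"
    proof -
      have "0 \<in> M" using M by (simp add: submodule_of_def)
      then have "1 * m' + 0 \<in> ?M1" using O_one by blast
      then show ?thesis by simp
    qed
    ultimately have "?M1 = M'" using simple[of ?M1] m' by blast
    then obtain a u where "x = a * m' + u" "a \<in> \<O>" "u \<in> M" using x by blast
    then show ?thesis by (intro bexI[of _ a]) auto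
  qed
  \<comment> \<open>This makes \<O>/p a field.\<close>
  have inv: "\<exists>b\<in>\<O>. 1 - b * a \<in> p" if a: "a \<in> \<O>" "a \<notin> p" for a
  proof -
    have "a * m \<in> M'" using M' m a by (simp add: submodule_of_def)
    moreover have "a * m \<notin> M" using a by (simp add: p_def)
    ultimately obtain b where "b \<in> \<O>" "m - b * (a * m) \<in> M" using gen[OF m(1)] by blast
    then show ?thesis using a by (intro bexI[of _ b])
      (auto simp: p_def algebra_simps O_one O_mult subring_C_diff[OF O])
  qed
  have kill: "a * (e * m) \<in> N" if "a \<in> p" "e \<in> J" for a e
  proof -
    have "(a * m) * e \<in> N" unfolding N_def
      using that by (intro span_base[OF O] set_times_intro) (auto simp: p_def)
    then show ?thesis by (simp add: mult_ac)
  qed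
  \<comment> \<open>\<open>P s\<close> says that some s elements of J, multiplied by m, are linearly
    independent over \<O>/p modulo N. It holds for s = 0 and fails for s = r + 1, so there is some s
    \<le> r where it holds for the last time before failing.\<close>
  define P where "P s \<longleftrightarrow> (\<exists>e. (\<forall>i<s. e i \<in> J) \<and> (\<forall>a. (\<forall>i<s. a i \<in> \<O>) \<longrightarrow>
     (\<Sum>i<s. a i * (e i * m)) \<in> N \<longrightarrow> (\<forall>i<s. a i \<in> p)))" for s :: nat
  have P0: "P 0" by (simp add: P_def)
  have Pr: "\<not> P (Suc r)"
  proof
    assume "P (Suc r)"
    then obtain e where e: "\<And>i. i \<le> r \<Longrightarrow> e i \<in> J"
      "\<And>a. (\<forall>i\<le>r. a i \<in> \<O>) \<Longrightarrow> (\<Sum>i\<le>r. a i * (e i * m)) \<in> N \<Longrightarrow> (\<forall>i\<le>r. a i \<in> p)"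
      unfolding P_def by (auto simp: less_Suc_eq_le lessThan_Suc_atMost)
    obtain a k where a: "\<And>i. i \<le> r \<Longrightarrow> a i \<in> F" "k \<le> r" "a k \<noteq> 0" "(\<Sum>i\<le>r. a i * e i) = 0"
    proof -
      have "\<exists>a. (\<forall>i\<le>r. a i \<in> F) \<and> (\<exists>i\<le>r. a i \<noteq> 0) \<and> (\<Sum>i\<le>r. a i * e i) = 0"
        using dim[unfolded dim_le_def, rule_format, of e] e(1) by blast
      then show thesis using that by blast
    qed
    obtain c where c: "\<And>i. i \<le> r \<Longrightarrow> c * a i \<in> \<O>" "\<exists>i\<le>r. c * a i \<notin> p"
      using local_scaling[OF p one_p, of r a k] a(1-3) by blast
    have "(\<Sum>i\<le>r. c * a i * (e i * m)) = c * m * (\<Sum>i\<le>r. a i * e i)"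
      by (simp add: sum_distrib_left mult_ac)
    also have "\<dots> \<in> N" using a(4) N by (simp add: submodule_of_def)
    finally show False using e(2)[of "\<lambda>i. c * a i"] c by blast
  qed
  obtain s where s: "P s" "\<not> P (Suc s)" "s \<le> r"
  proof -
    have "\<exists>s\<le>r. P s \<and> \<not> P (Suc s)"
    proof (rule ccontr)
      assume "\<not> ?thesis"
      then have "s \<le> Suc r \<Longrightarrow> P s" for s
        by (induction s) (use P0 in auto)
      then show False using Pr by blast
    qed
    then show thesis using that by blast
  qed
  obtain e where e: "\<And>i. i < s \<Longrightarrow> e i \<in> J"
      "\<And>a. (\<forall>i<s. a i \<in> \<O>) \<Longrightarrow> (\<Sum>i<s. a i * (e i * m)) \<in> N \<Longrightarrow> (\<forall>i<s. a i \<in> p)"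
    using s(1) unfolding P_def by blast
  obtain T where T: "T \<subseteq> M'" "finite T" "card T = idx M' M" "\<And>x. x \<in> M' \<Longrightarrow> \<exists>t\<in>T. x - t \<in> M"
    using quot_representatives[OF Mgrp fin] by metis
  have "\<forall>t\<in>T. \<exists>a\<in>\<O>. t - a * m \<in> M" using gen m T(1) by blast
  then obtain f where f: "\<And>t. t \<in> T \<Longrightarrow> f t \<in> \<O>" "\<And>t. t \<in> T \<Longrightarrow> t - f t * m \<in> M" by metis
  \<comment> \<open>Representatives of \<O> modulo p, at most as many as there are cosets of M in
    M'.\<close>
  define R where "R = f ` T"
  have R: "finite R" "card R \<le> idx M' M" using T card_image_le[OF T(2), of f] by (auto simp: R_def)
  have rep: "\<exists>\<rho>\<in>R. a - \<rho> \<in> p" if a: "a \<in> \<O>" for a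
  proof -
    have "a * m \<in> M'" using M' m a by (simp add: submodule_of_def)
    then obtain t where t: "t \<in> T" "a * m - t \<in> M" using T(4) by blast
    have "(a * m - t) + (t - f t * m) \<in> M" using t f(2) additive_subgroup_add[OF Mgrp] by blast
    then have "a - f t \<in> p" using f(1) t a by (auto simp: p_def algebra_simps subring_C_diff[OF O])
    then show ?thesis using t by (auto simp: R_def)
  qed
  \<comment> \<open>All combinations of the independent family with coefficients in
    \<open>R\<close>. They turn out to represent M' J modulo N, and there are at most
    \<open>card R ^ s\<close> of them.\<close>
  define W where "W = (\<lambda>\<rho>. \<Sum>i<s. \<rho> i * (e i * m)) ` (PiE {..<s} (\<lambda>_. R))"
  have W: "finite W" "card W \<le> idx M' M ^ r"
  proof -
    show "finite W" unfolding W_def using R by (intro finite_imageI finite_PiE) auto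
    have "card W \<le> card (PiE {..<s} (\<lambda>_. R))" unfolding W_def
      using R by (intro card_image_le finite_PiE) auto
    also have "\<dots> = card R ^ s" by (simp add: card_PiE)
    also have "\<dots> \<le> idx M' M ^ s" using R by (intro power_mono) auto
    also have "\<dots> \<le> idx M' M ^ r" using idx_pos[OF fin m(1)] s by (intro power_increasing) auto
    finally show "card W \<le> idx M' M ^ r" .
  qed
  have cover: "\<exists>w\<in>W. e' * m - w \<in> N" if e': "e' \<in> J" for e'
  proof -
    \<comment> \<open>Append e' to the independent family. The s + 1 elements are dependent, and
      independence of the first s forces the coefficient of e' out of p; inverting it modulo p
      solves for e' * m.\<close>
    let ?e = "\<lambda>i. if i < s then e i else e'"
    have "\<exists>a. (\<forall>i<Suc s. a i \<in> \<O>) \<and> (\<Sum>i<Suc s. a i * (?e i * m)) \<in> N \<and> (\<exists>i<Suc s. a i \<notin> p)"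
    proof (rule ccontr)
      assume "\<not> ?thesis"
      then have "P (Suc s)" unfolding P_def by (intro exI[of _ ?e]) (use e(1) e' in auto)
      then show False using s by blast
    qed
    then obtain a where a: "\<And>i. i < Suc s \<Longrightarrow> a i \<in> \<O>" "(\<Sum>i<Suc s. a i * (?e i * m)) \<in> N" "\<exists>i<Suc s. a i \<notin> p"
      by metis
    have sum: "(\<Sum>i<Suc s. a i * (?e i * m)) = (\<Sum>i<s. a i * (e i * m)) + a s * (e' * m)" by simp
    have as: "a s \<notin> p"
    proof
      assume asp: "a s \<in> p"
      have "(\<Sum>i<Suc s. a i * (?e i * m)) - a s * (e' * m) \<in> N"
        using a(2) kill[OF asp e'] Ngrp unfolding additive_subgroup_def by blast
      then have "\<forall>i<s. a i \<in> p" using e(2)[of a] a(1) sum by simp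
      then show False using a(3) asp by (auto simp: less_Suc_eq)
    qed
    obtain b where b: "b \<in> \<O>" "1 - b * a s \<in> p" using inv as a(1) by blast
    have "\<exists>\<rho>\<in>R. - b * a i - \<rho> \<in> p" if "i < s" for i
      using rep b a(1) that by (metis O_minus O_mult less_Suc_eq)
    then obtain \<rho> where \<rho>: "\<And>i. i < s \<Longrightarrow> \<rho> i \<in> R" "\<And>i. i < s \<Longrightarrow> - b * a i - \<rho> i \<in> p" by metis
    define w where "w = (\<Sum>i<s. \<rho> i * (e i * m))"
    have "w \<in> W" unfolding W_def w_def
      by (intro image_eqI[of _ _ "restrict \<rho> {..<s}"]) (auto simp: \<rho> intro!: sum.cong)
    moreover have "e' * m - w \<in> N"
    proof -
      have "(1 - b * a s) * (e' * m) \<in> N" by (rule kill[OF b(2) e'])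
      moreover have "b * (\<Sum>i<Suc s. a i * (?e i * m)) \<in> N" using N a(2) b by (simp add: submodule_of_def)
      moreover have "(\<Sum>i<s. (- b * a i - \<rho> i) * (e i * m)) \<in> N"
        by (rule submodule_sum[OF N]) (use \<rho> e(1) kill in auto)
      ultimately have "(1 - b * a s) * (e' * m) + b * (\<Sum>i<Suc s. a i * (?e i * m)) + (\<Sum>i<s. (- b * a i - \<rho> i) * (e i * m)) \<in> N"
        using additive_subgroup_add[OF Ngrp] by blast
      also have "(\<Sum>i<s. (- b * a i - \<rho> i) * (e i * m)) = - b * (\<Sum>i<s. a i * (e i * m)) - w"
        unfolding w_def sum_distrib_left by (simp add: left_diff_distrib sum_subtractf sum_negf mult.assoc)
      finally show ?thesis unfolding sum by (simp add: algebra_simps)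
    qed
    ultimately show ?thesis by blast
  qed
  \<comment> \<open>Since M' = \<O> m + M, everything in M' J is a multiple of the single element m
    by an element of J, up to N.\<close>
  have decomp: "\<exists>e'\<in>J. x - e' * m \<in> N" if "x \<in> \<I> (M' * J)" for x
    using that
  proof induction
    case zero
    then show ?case using N J by (intro bexI[of _ 0]) (auto simp: submodule_of_def)
  next
    case (step a y z)
    then obtain e1 where e1: "e1 \<in> J" "z - e1 * m \<in> N" by blast
    obtain x j where y: "y = x * j" "x \<in> M'" "j \<in> J" using step by (auto elim: set_times_elim)
    obtain c where c: "c \<in> \<O>" "x - c * m \<in> M" using gen[OF y(2) m] by blast
    have "a * ((x - c * m) * j) \<in> N" unfolding N_def
      using step y c by (intro span_scale_base set_times_intro) auto
    then have "a * ((x - c * m) * j) + (z - e1 * m) \<in> N" using additive_subgroup_add[OF Ngrp] e1 by blast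
    moreover have "a * c * j + e1 \<in> J" using J O_mult step c e1 y by (simp add: submodule_of_def)
    ultimately show ?case by (intro bexI[of _ "a * c * j + e1"]) (auto simp: y algebra_simps)
  qed
  have "\<exists>w\<in>W. x - w \<in> N" if x: "x \<in> \<I> (M' * J)" for x
  proof -
    obtain e' where e': "e' \<in> J" "x - e' * m \<in> N" using decomp[OF x] by blast
    obtain w where w: "w \<in> W" "e' * m - w \<in> N" using cover[OF e'(1)] by blast
    have "(x - e' * m) + (e' * m - w) \<in> N" using e' w additive_subgroup_add[OF Ngrp] by blast
    then show ?thesis using w by auto
  qed
  then show ?thesis using idx_le_card[OF Ngrp W(1)] W(2) unfolding N_def by (meson le_trans)
qed

text \<open>Indices multiply along M \<subseteq> M1 \<subseteq> M', before and after multiplication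
  by J, so simple quotients suffice. The induction on the index descends because both parts of a
  proper chain have index above 1.\<close>

theorem idx_times_le:
  assumes "submodule_of \<O> M" "submodule_of \<O> M'" "M \<subseteq> M'" "finite (quot M' M)"
    and J: "submodule_of \<O> J" and dim: "dim_le F J r"
  shows "finite (quot (\<I> (M' * J)) (\<I> (M * J))) \<and> idx (\<I> (M' * J)) (\<I> (M * J)) \<le> idx M' M ^ r"
  using assms(1-4)
proof (induction "idx M' M" arbitrary: M M' rule: less_induct)
  case less
  note grp = submodule_additive[OF O]
  note sp = grp[OF submodule_span[OF O]]
  show ?case
  proof (cases "M = M'")
    case True
    have "idx (\<I> (M * J)) (\<I> (M * J)) \<le> card {0::complex}" "finite (quot (\<I> (M * J)) (\<I> (M * J)))"
      using idx_le_card[OF sp, of "{0}"] by auto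
    moreover have "1 \<le> idx M' M ^ r" using less.prems by (intro one_le_power Suc_leI[of 0, folded One_nat_def] idx_pos[of _ _ 0]) (auto simp: submodule_of_def)
    ultimately show ?thesis using True by simp
  next
    case ne: False
    show ?thesis
    proof (cases "\<exists>M1. submodule_of \<O> M1 \<and> M \<subseteq> M1 \<and> M1 \<subseteq> M' \<and> M1 \<noteq> M \<and> M1 \<noteq> M'")
      case False
      then show ?thesis using less.prems ne J dim by (intro idx_times_simple) auto
    next
      case True
      then obtain M1 where M1: "submodule_of \<O> M1" "M \<subseteq> M1" "M1 \<subseteq> M'" "M1 \<noteq> M" "M1 \<noteq> M'" by blast
      note g = grp[OF less.prems(1)] grp[OF less.prems(2)] grp[OF M1(1)]
      have fin: "finite (quot M' M1)" "finite (quot M1 M)"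
        using finite_quot_between[OF g(3) g(1) M1(2,3) less.prems(4)] by auto
      have idx: "idx M' M = idx M' M1 * idx M1 M"
        using idx_mult(2)[OF g(2,3,1) M1(2,3) fin] .
      have big: "idx A B > 1" if AB: "submodule_of \<O> A" "submodule_of \<O> B" "B \<subseteq> A" "A \<noteq> B" "finite (quot A B)" for A B
      proof (rule ccontr)
        assume "\<not> idx A B > 1"
        obtain T where T: "T \<subseteq> A" "finite T" "card T = idx A B" "\<And>x. x \<in> A \<Longrightarrow> \<exists>t\<in>T. x - t \<in> B"
          using quot_representatives[OF grp[OF AB(2)] AB(5)] by metis
        \<comment> \<open>If there is only one coset, it is the coset of 0, so A would be contained
          in B.\<close>
        have "0 \<in> A" using AB(1) by (simp add: submodule_of_def)
        with T obtain t where t: "t \<in> T" "0 - t \<in> B" by blast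
        with T \<open>\<not> idx A B > 1\<close> have "T = {t}"
          by (metis One_nat_def card_le_Suc0_iff_eq empty_iff insertI1 linorder_not_le not_less_eq_eq singletonD subsetI subset_singletonD)
        have "x \<in> B" if "x \<in> A" for x
        proof -
          have "x - t \<in> B" using T(4)[OF that] \<open>T = {t}\<close> by auto
          then have "(x - t) - (0 - t) \<in> B" using t grp[OF AB(2)] unfolding additive_subgroup_def by blast
          then show ?thesis by simp
        qed
        then show False using AB(3,4) by blast
      qed
      have i: "idx M' M1 > 1" "idx M1 M > 1" using big M1 less.prems fin by auto
      have IH: "finite (quot (\<I> (M' * J)) (\<I> (M1 * J))) \<and> idx (\<I> (M' * J)) (\<I> (M1 * J)) \<le> idx M' M1 ^ r"
        "finite (quot (\<I> (M1 * J)) (\<I> (M * J))) \<and> idx (\<I> (M1 * J)) (\<I> (M * J)) \<le> idx M1 M ^ r"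
        using less.hyps[of M' M1] less.hyps[of M1 M] M1 less.prems fin i idx by auto
      have sub: "\<I> (M * J) \<subseteq> \<I> (M1 * J)" "\<I> (M1 * J) \<subseteq> \<I> (M' * J)"
        using set_times_mono2[OF M1(2) order_refl[of J]] set_times_mono2[OF M1(3) order_refl[of J]]
        by (auto intro: span_mono[OF order_refl])
      have "idx (\<I> (M' * J)) (\<I> (M * J)) = idx (\<I> (M' * J)) (\<I> (M1 * J)) * idx (\<I> (M1 * J)) (\<I> (M * J))"
        "finite (quot (\<I> (M' * J)) (\<I> (M * J)))"
        using idx_mult[OF sp sp sp sub] IH by auto
      moreover have "idx (\<I> (M' * J)) (\<I> (M1 * J)) * idx (\<I> (M1 * J)) (\<I> (M * J)) \<le> idx M' M1 ^ r * idx M1 M ^ r"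
        using IH by (intro mult_mono) auto
      ultimately show ?thesis by (simp add: idx power_mult_distrib)
    qed
  qed
qed

end

section \<open>Indices of fractional ideals\<close>

lemma span_subset_mono: "S \<subseteq> S' \<Longrightarrow> span_over R S \<subseteq> span_over R S'"
  by (auto intro: span_mono[OF order_refl])

text \<open>If c is the leading coefficient of an integer relation of degree n, then c * x plus the
  coefficient of degree n - 1 is a partial quotient and hence integral. The sign of c then makes the
  multiplier positive.\<close>

lemma algebraic_int_multiple:
  assumes "algebraic (x::complex)"
  obtains D :: nat where "D > 0" "algebraic_int (of_nat D * x)"
proof -
  obtain p :: "int poly" where p: "poly (map_poly of_int p) x = 0" "p \<noteq> 0"
    using assms by (auto elim: algebraicE')
  define n where "n = degree p"
  define c where "c = poly.coeff p n"
  have c: "c \<noteq> 0" using p by (simp add: c_def n_def)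
  have root: "(\<Sum>i\<le>n. of_int (poly.coeff p i) * x ^ i) = 0"
    using p(1) by (simp add: poly_altdef n_def)
  have "n > 0"
  proof (rule Nat.gr0I)
    assume "n = 0"
    then obtain c where "p = [:c:]" by (auto simp: n_def elim: degree_eq_zeroE)
    then show False using p by simp
  qed
  have "algebraic_int (of_int c * x)"
  \<comment> \<open>For n = 1 the index n - 2 of the partial quotient would be truncated to 0, so
    this case is read off the relation.\<close>
  proof (cases "n = 1")
    case True
    then have "of_int c * x = - of_int (poly.coeff p 0)"
      using root by (simp add: c_def add_eq_0_iff2)
    then show ?thesis by simp
  next
    case False
    then have set: "{n - 2<..n} = {n - 1, n}" using \<open>n > 0\<close> by auto
    have "algebraic_int (\<Sum>i\<in>{n - 2<..n}. of_int (poly.coeff p i) * x ^ (i - Suc (n - 2)))"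
      by (rule algebraic_int_partial_quotient[OF root \<open>n > 0\<close>])
    also have "(\<Sum>i\<in>{n - 2<..n}. of_int (poly.coeff p i) * x ^ (i - Suc (n - 2))) = of_int (poly.coeff p (n - 1)) + of_int c * x"
      unfolding set using False \<open>n > 0\<close> by (simp add: c_def numeral_2_eq_2 Suc_diff_Suc)
    finally show ?thesis
      using algebraic_int_diff[of "of_int (poly.coeff p (n - 1)) + of_int c * x" "of_int (poly.coeff p (n - 1))"] by simp
  qed
  then have "algebraic_int (of_int (sgn c) * (of_int c * x))"
    by (intro algebraic_int_plus_times(2)[of "of_int (sgn c)"] algebraic_int_of_int)
  also have "of_int (sgn c) * (of_int c * x) = of_nat (nat \<bar>c\<bar>) * x"
    by (simp add: sgn_if)
  finally show thesis using that[of "nat \<bar>c\<bar>"] c by auto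
qed

lemma algebraic_int_common_multiple:
  assumes "finite S" "\<And>s. s \<in> S \<Longrightarrow> algebraic (s::complex)"
  obtains D :: nat where "D > 0" "\<And>s. s \<in> S \<Longrightarrow> algebraic_int (of_nat D * s)"
proof -
  obtain d :: "complex \<Rightarrow> nat" where d: "\<And>s. s \<in> S \<Longrightarrow> d s > 0" "\<And>s. s \<in> S \<Longrightarrow> algebraic_int (of_nat (d s) * s)"
  proof -
    have "\<forall>s\<in>S. \<exists>D::nat. D > 0 \<and> algebraic_int (of_nat D * s)"
      using assms(2) algebraic_int_multiple by blast
    then show thesis using that by metis
  qed
  show thesis
  proof (rule that[of "\<Prod>s\<in>S. d s"])
    show "(\<Prod>s\<in>S. d s) > 0" using d by (simp add: prod_pos)
    fix s assume s: "s \<in> S"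
    have "algebraic_int (of_nat (\<Prod>t\<in>S - {s}. d t) * (of_nat (d s) * s))"
      by (rule algebraic_int_plus_times(2)[OF algebraic_int_of_nat d(2)[OF s]])
    then show "algebraic_int (of_nat (\<Prod>s\<in>S. d s) * s)"
      using s assms by (simp add: prod.remove[of S s] mult_ac)
  qed
qed

section \<open>Powers of ideals and powers of their generators\<close>

lemma set_power_list:
  "x \<in> S ^ k \<Longrightarrow> \<exists>xs. length xs = k \<and> set xs \<subseteq> S \<and> x = prod_list (xs :: complex list)"
proof (induction k arbitrary: x)
  case (Suc k)
  then obtain s y where sy: "x = s * y" "s \<in> S" "y \<in> S ^ k" by (auto elim: set_times_elim)
  then obtain xs where "length xs = k" "set xs \<subseteq> S" "y = prod_list xs" using Suc.IH by blast
  then show ?case using sy by (intro exI[of _ "s # xs"]) auto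
qed auto

lemma prod_list_in_set_power: "set xs \<subseteq> S \<Longrightarrow> prod_list (xs :: complex list) \<in> S ^ length xs"
  by (induction xs) auto

lemma prod_list_extract_power:
  "count_list xs s \<ge> m \<Longrightarrow> \<exists>ys. length xs = m + length ys \<and> set ys \<subseteq> set xs \<and>
     prod_list (xs :: complex list) = s ^ m * prod_list ys"
proof (induction m arbitrary: xs)
  case 0
  then show ?case by (intro exI[of _ xs]) auto
next
  case (Suc m)
  then have "count_list xs s \<noteq> 0" by linarith
  then have "s \<in> set xs" by (simp add: count_list_0_iff)
  then obtain as bs where xs: "xs = as @ s # bs" by (meson split_list)
  then have "count_list (as @ bs) s \<ge> m" using Suc.prems by simp
  then obtain ys where "length (as @ bs) = m + length ys" "set ys \<subseteq> set (as @ bs)"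
    "prod_list (as @ bs) = s ^ m * prod_list ys" using Suc.IH by blast
  then show ?case using xs by (intro exI[of _ ys]) (auto simp: mult_ac)
qed

text \<open>Among card S * m + m factors from S, some s occurs at least m times. Splitting off s ^ m
  leaves card S * m factors.\<close>

lemma set_power_pigeonhole:
  fixes S :: "complex set"
  assumes S: "finite S" "S \<noteq> {}"
  shows "S ^ (card S * m + m) \<subseteq> (\<lambda>s. s ^ m) ` S * S ^ (card S * m)"
proof
  fix x assume "x \<in> S ^ (card S * m + m)"
  then obtain xs where xs: "length xs = card S * m + m" "set xs \<subseteq> S" "x = prod_list xs"
    using set_power_list by blast
  have "\<exists>s\<in>S. count_list xs s \<ge> m"
  proof (rule ccontr)
    assume "\<not> ?thesis"
    then have *: "\<forall>s\<in>S. count_list xs s < m" by auto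
    with S(2) have "m > 0" by auto
    have "length xs = (\<Sum>s\<in>S. count_list xs s)" using sum_count_set[OF xs(2) S(1)] by simp
    also have "\<dots> \<le> (\<Sum>s\<in>S. m)" using * by (intro sum_mono) auto
    finally show False using xs(1) \<open>m > 0\<close> by simp
  qed
  then obtain s where s: "s \<in> S" "count_list xs s \<ge> m" by blast
  obtain ys where "length xs = m + length ys" "set ys \<subseteq> set xs" "prod_list xs = s ^ m * prod_list ys"
    using prod_list_extract_power[OF s(2)] by blast
  then show "x \<in> (\<lambda>s. s ^ m) ` S * S ^ (card S * m)"
    using xs s prod_list_in_set_power[of ys S] by (auto intro!: set_times_intro)
qed

lemma one_in_set_power: "1 \<in> (S :: complex set) \<Longrightarrow> 1 \<in> S ^ m"
  by (induction m) (simp, metis mult_1 power_Suc set_times_intro)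

lemma finite_set_power: "finite (S :: complex set) \<Longrightarrow> finite (S ^ m)"
  by (induction m) (auto intro: finite_set_times)

context algebraic_field
begin

text \<open>Two elements of a field satisfy e1 * e0 - e0 * e1 = 0, a nontrivial relation unless both
  vanish.\<close>

lemma dim_le_self: "J \<subseteq> F \<Longrightarrow> dim_le F J 1"
  unfolding dim_le_def
proof (intro allI impI)
  fix e :: "nat \<Rightarrow> complex" assume J: "J \<subseteq> F" and e: "\<forall>i\<le>1. e i \<in> J"
  have eF: "e 0 \<in> F" "e 1 \<in> F" using J e by auto
  have s: "{..1::nat} = {0, 1}" by auto
  show "\<exists>a. (\<forall>i\<le>1. a i \<in> F) \<and> (\<exists>i\<le>1. a i \<noteq> 0) \<and> (\<Sum>i\<le>1. a i * e i) = 0"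
  proof (cases "e 0 = 0 \<and> e 1 = 0")
    case True
    then show ?thesis using F by (intro exI[of _ "\<lambda>_. 1"]) (auto simp: s subfield_C_def)
  next
    case False
    then show ?thesis using eF F
      by (intro exI[of _ "\<lambda>i. if i = 0 then e 1 else - e 0"])
        (auto simp: s subfield_C_def algebra_simps intro: exI[of _ "0::nat"] exI[of _ "1::nat"])
  qed
qed

lemma span_additive: "additive_subgroup (\<I> S)"
  by (rule submodule_additive[OF O submodule_span[OF O]])

lemma O_additive: "additive_subgroup \<O>"
  using span_additive[of "{1}"] span_one by simp

lemma O_submodule: "submodule_of \<O> \<O>"
  using submodule_span[OF O, of "{1}"] span_one by simp

lemma O_subset_span: "1 \<in> S \<Longrightarrow> \<O> \<subseteq> \<I> S"
  using span_subset_mono[of "{1}" S] span_one by auto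

lemma set_times_in_field: "S \<subseteq> F \<Longrightarrow> T \<subseteq> F \<Longrightarrow> S * T \<subseteq> F"
  by (auto elim!: set_times_elim intro: F_mult)

lemma set_power_in_field: "S \<subseteq> F \<Longrightarrow> S ^ m \<subseteq> F"
  using F by (induction m) (auto simp: subfield_C_def elim!: set_times_elim)

text \<open>The case of rank 1: multiplication by a fractional ideal does not increase an index.
  Applied to the ideal or to its inverse, it yields upper and lower bounds.\<close>

lemma idx_span_times_le:
  assumes "\<I> S \<subseteq> \<I> S'" "finite (quot (\<I> S') (\<I> S))" "T \<subseteq> F"
  shows "finite (quot (\<I> (S' * T)) (\<I> (S * T))) \<and> idx (\<I> (S' * T)) (\<I> (S * T)) \<le> idx (\<I> S') (\<I> S)"
  using idx_times_le[OF submodule_span[OF O] submodule_span[OF O] assms(1,2) submodule_span[OF O] dim_le_self[OF span_in_field[OF assms(3)]]]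
  by (simp add: span_times_span_left[OF O] span_times_span_right[OF O])

lemma invertible_set_power:
  assumes "finite S" "S \<subseteq> F" "1 \<in> S"
  obtains T where "T \<subseteq> F" "\<I> (S ^ m * T) = \<O>"
  using invertible_finite[of "S ^ m" 1] assms one_in_set_power[of S m]
  unfolding invertible_def by (metis finite_set_power set_power_in_field zero_neq_one)

text \<open>With c = card S * m, the pigeonhole principle puts S ^ (c + m) into P * S ^ c, where P
  consists of the m-th powers. Cancelling the invertible factor S ^ c leaves the claim.\<close>

lemma span_power_subset:
  assumes S: "finite S" "S \<subseteq> F" "1 \<in> S"
  shows "\<I> (S ^ m) \<subseteq> \<I> ((\<lambda>s. s ^ m) ` S)"
proof -
  let ?c = "card S * m" and ?P = "(\<lambda>s. s ^ m) ` S"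
  obtain T where T: "\<I> (S ^ ?c * T) = \<O>" using invertible_set_power[OF S] by metis
  have "\<I> (S ^ m) = \<I> ((S ^ ?c * T) * S ^ m)" using span_O_times[OF T] by simp
  also have "(S ^ ?c * T) * S ^ m = S ^ (?c + m) * T" by (simp add: power_add mult_ac)
  also have "\<I> \<dots> \<subseteq> \<I> (?P * S ^ ?c * T)"
    using S by (intro span_subset_mono set_times_mono2 set_power_pigeonhole) auto
  also have "?P * S ^ ?c * T = (S ^ ?c * T) * ?P" by (simp add: mult_ac)
  also have "\<I> \<dots> = \<I> ?P" by (rule span_O_times[OF T])
  finally show ?thesis .
qed

end

text \<open>Extension of scalars; with base field \<open>\<rat>\<close> it also yields finiteness of all indices.\<close>
lemma idx_extension:
  assumes "algebraic_field F" "algebraic_field K" and FK: "F \<subseteq> K" and dim: "dim_le F K r"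
    and one: "1 \<in> S" and fin: "finite (quot (span_over (ints_of F) S) (ints_of F))"
  shows "finite (quot (span_over (ints_of K) S) (ints_of K)) \<and>
    idx (span_over (ints_of K) S) (ints_of K) \<le> idx (span_over (ints_of F) S) (ints_of F) ^ r"
proof -
  interpret F: algebraic_field F by fact
  interpret K: algebraic_field K by fact
  have OFK: "ints_of F \<subseteq> ints_of K" using FK by (auto simp: ints_of_def)
  \<comment> \<open>Extension of scalars is multiplication by the ring of integers of K, viewed as a
    module over that of F; this is the J to which the bound on products is applied.\<close>
  have ext: "F.\<I> (F.\<I> S * ints_of K) = K.\<I> S" for S
  proof -
    have "F.\<I> (F.\<I> S * ints_of K) = F.\<I> (S * ints_of K)" by (rule span_times_span_left[OF F.O])
    also have "\<dots> = K.\<I> S"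
    proof
      show "F.\<I> (S * ints_of K) \<subseteq> K.\<I> S"
      proof (rule span_closed_subset)
        fix a x assume a: "a \<in> ints_of F" "x \<in> S * ints_of K"
        then obtain s t where "x = s * t" "s \<in> S" "t \<in> ints_of K" by (auto elim: set_times_elim)
        then have "(a * t) * s \<in> K.\<I> S" using a OFK by (intro span_scale_base K.O_mult) auto
        then show "a * x \<in> K.\<I> S" by (simp add: \<open>x = s * t\<close> mult_ac)
      qed (auto intro: span_over.zero span_add)
      show "K.\<I> S \<subseteq> F.\<I> (S * ints_of K)"
      proof (rule span_closed_subset)
        fix a s assume "a \<in> ints_of K" "s \<in> S"
        then have "s * a \<in> F.\<I> (S * ints_of K)" by (intro span_base[OF F.O]) auto
        then show "a * s \<in> F.\<I> (S * ints_of K)" by (simp add: mult.commute)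
      qed (auto intro: span_over.zero span_add)
    qed
    finally show ?thesis .
  qed
  have J: "submodule_of (ints_of F) (ints_of K)"
    using OFK by (auto simp: submodule_of_def K.O_zero K.O_add intro: K.O_mult)
  have dim': "dim_le F (ints_of K) r" using dim K.O_subset unfolding dim_le_def by blast
  have "F.\<I> (ints_of F * ints_of K) = ints_of K" using ext[of "{1}"] by (simp add: F.span_one K.span_one)
  then show ?thesis
    using F.idx_times_le[OF F.O_submodule submodule_span[OF F.O] F.O_subset_span[OF one] fin J dim'] ext[of S] by simp
qed

section \<open>Number fields and finiteness of indices\<close>

lemma Rats_subset_subfield: "subfield_C F \<Longrightarrow> \<rat> \<subseteq> F"
proof
  fix x :: complex assume F: "subfield_C F" and "x \<in> \<rat>"
  then obtain a b where "x = of_int a / of_int b" by (auto elim: Rats_cases')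
  then show "x \<in> F" using subring_C_of_int[OF subfield_imp_subring[OF F]] by (auto intro: subfield_C_divide[OF F])
qed

lemma subfield_C_Rats: "subfield_C \<rat>"
  by (auto simp: subfield_C_def)

lemma algebraic_field_Rats: "algebraic_field \<rat>"
proof
  show "subfield_C \<rat>" by (rule subfield_C_Rats)
  fix x :: complex assume "x \<in> \<rat>"
  then obtain a b where x: "x = of_int a / of_int b" "b > 0" by (auto elim: Rats_cases')
  show "algebraic x"
    by (rule algebraicI[of "[:- of_int a, of_int b:]"]) (use x in \<open>auto simp: coeff_pCons split: nat.splits\<close>)
qed

lemma ints_of_Rats: "ints_of \<rat> = \<int>"
  by (auto simp: ints_of_def rational_algebraic_int_is_int int_imp_algebraic_int intro: Ints_subset_Rats[THEN subsetD])

locale number_field = algebraic_field +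
  assumes fin_dim: "\<exists>r. dim_le \<rat> F r"
begin

text \<open>A common denominator D places the ideal inside the span of 1 and 1/D. Over the rationals
  that span has at most D cosets modulo \<int>, and extension of scalars carries the finiteness to
  F.\<close>

lemma finite_quot_span:
  assumes S: "finite S" "S \<subseteq> F" "1 \<in> S"
  shows "finite (quot (\<I> S) \<O>)"
proof -
  obtain D :: nat where D: "D > 0" "\<And>s. s \<in> S \<Longrightarrow> algebraic_int (of_nat D * s)"
    using algebraic_int_common_multiple[OF S(1)] alg S(2) by blast
  let ?S = "{1, 1 / of_nat D}"
  interpret Q: algebraic_field "\<rat>" by (rule algebraic_field_Rats)
  obtain r where r: "dim_le \<rat> F r" using fin_dim by blast
  have multiple: "\<exists>k::int. x = of_int k / of_nat D" if "x \<in> span_over \<int> ?S" for x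
    using that
  proof induction
    case zero
    show ?case by (intro exI[of _ 0]) simp
  next
    case (step a s z)
    then obtain k where k: "z = of_int k / of_nat D" by blast
    obtain j where j: "a = of_int j" using step(1) by (auto elim: Ints_cases)
    have "s = 1 \<or> s = 1 / of_nat D" using step by simp
    then show ?case
    proof
      assume "s = 1"
      then have "a * s + z = of_int (j * int D + k) / of_nat D" using D(1) by (simp add: k j field_simps)
      then show ?thesis by blast
    next
      assume "s = 1 / of_nat D"
      then have "a * s + z = of_int (j + k) / of_nat D" using D(1) by (simp add: k j add_divide_distrib)
      then show ?thesis by blast
    qed
  qed
  have "finite (quot (Q.\<I> ?S) (ints_of \<rat>))"
  proof (rule idx_le_card(1)[OF Q.O_additive, of "(\<lambda>k. of_nat k / of_nat D) ` {..<D}"])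
    fix x assume "x \<in> Q.\<I> ?S"
    then obtain k :: int where k: "x = of_int k / of_nat D" using multiple by (auto simp: ints_of_Rats)
    have "of_int k = (of_int (int D * (k div int D) + k mod int D) :: complex)" by simp
    also have "\<dots> = of_nat D * of_int (k div int D) + of_nat (nat (k mod int D))"
      using D(1) by (simp only: of_int_add of_int_mult of_int_of_nat_eq) (simp add: of_nat_nat)
    finally have "x - of_nat (nat (k mod int D)) / of_nat D = of_int (k div int D)"
      using D(1) by (simp add: k field_simps)
    then have "x - of_nat (nat (k mod int D)) / of_nat D \<in> ints_of \<rat>"
      by (simp only: ints_of_Rats Ints_of_int)
    moreover have "nat (k mod int D) < D" using D(1) by (simp add: nat_less_iff)
    ultimately show "\<exists>t\<in>(\<lambda>k. of_nat k / of_nat D) ` {..<D}. x - t \<in> ints_of \<rat>"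
      by blast
  qed auto
  then have "finite (quot (\<I> ?S) \<O>)"
    using idx_extension[OF algebraic_field_Rats algebraic_field_axioms Rats_subset_subfield[OF F] r, of ?S] by auto
  moreover have "\<I> S \<subseteq> \<I> ?S"
  proof (rule span_subset_span[OF O], rule subsetI)
    fix s assume s: "s \<in> S"
    have "of_nat D * s \<in> \<O>"
      using D(2) s S F_mult subring_C_of_int[OF FR, of D] by (auto simp: ints_of_def)
    then have "(of_nat D * s) * (1 / of_nat D) \<in> \<I> ?S" by (intro span_scale_base) auto
    then show "s \<in> \<I> ?S" using D(1) by simp
  qed
  ultimately show ?thesis
    using finite_quot_between(2)[OF span_additive O_additive O_subset_span[OF S(3)]] by blast
qed

text \<open>For 1 \<in> S this is the norm of the inverse ideal; its logarithm is the finite part of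
  the height before division by the degree.\<close>

definition ideal_index :: "complex set \<Rightarrow> nat" where
  "ideal_index S = idx (\<I> S) \<O>"

lemma ideal_index_pos: "finite S \<Longrightarrow> S \<subseteq> F \<Longrightarrow> 1 \<in> S \<Longrightarrow> ideal_index S > 0"
  unfolding ideal_index_def by (rule idx_pos[OF finite_quot_span span_over.zero])

lemma ideal_index_mono:
  assumes "finite S'" "S' \<subseteq> F" "1 \<in> S" "1 \<in> S'" "\<I> S \<subseteq> \<I> S'"
  shows "ideal_index S \<le> ideal_index S'"
proof -
  note fin = finite_quot_between[OF span_additive O_additive O_subset_span[OF assms(3)] assms(5) finite_quot_span[OF assms(1,2,4)]]
  have "idx (\<I> S') \<O> = idx (\<I> S') (\<I> S) * idx (\<I> S) \<O>"
    by (rule idx_mult(2)[OF span_additive span_additive O_additive O_subset_span[OF assms(3)] assms(5) fin])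
  moreover have "idx (\<I> S') (\<I> S) > 0" using fin(1) by (rule idx_pos[OF _ span_over.zero])
  ultimately show ?thesis by (simp add: ideal_index_def)
qed

text \<open>In the chain \<O> \<subseteq> \<I> S \<subseteq> \<I> (S * T), the upper step is \<O>
  \<subseteq> \<I> T multiplied by S, so its index is at most that of T.\<close>

lemma ideal_index_times_le:
  assumes "finite S" "S \<subseteq> F" "1 \<in> S" "finite T" "T \<subseteq> F" "1 \<in> T"
  shows "ideal_index (S * T) \<le> ideal_index S * ideal_index T"
proof -
  have fT: "finite (quot (\<I> T) (\<I> {1}))" using finite_quot_span[OF assms(4-6)] by (simp add: span_one)
  have sub: "\<I> {1} \<subseteq> \<I> T" using assms by (intro span_subset_mono) auto
  have "finite (quot (\<I> (T * S)) (\<I> ({1} * S)))" "idx (\<I> (T * S)) (\<I> ({1} * S)) \<le> idx (\<I> T) (\<I> {1})"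
    using idx_span_times_le[OF sub fT assms(2)] by auto
  then have "finite (quot (\<I> (S * T)) (\<I> S))" "idx (\<I> (S * T)) (\<I> S) \<le> ideal_index T"
    using mult_1_left[of S] by (auto simp: span_one mult.commute ideal_index_def)
  moreover have "\<I> S \<subseteq> \<I> (S * T)" using assms by (intro span_subset_mono subset_times_one)
  ultimately show ?thesis
    using idx_mult(2)[OF span_additive span_additive O_additive O_subset_span[OF assms(3)] _ _ finite_quot_span[OF assms(1-3)], of "S * T"]
    by (simp add: ideal_index_def mult.commute)
qed

text \<open>The inverse of \<I> (S ^ m) turns the step from S ^ m to S ^ (m + 1) into \<O>
  \<subseteq> \<I> S. As this cannot increase the index, every step in the chain of powers has at
  least the index of S.\<close>

lemma ideal_index_set_power_ge:
  assumes S: "finite S" "S \<subseteq> F" "1 \<in> S"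
  shows "ideal_index S ^ m \<le> ideal_index (S ^ m)"
proof (induction m)
  case 0
  then show ?case using ideal_index_pos[of "S ^ 0"] F by (simp add: subfield_C_def)
next
  case (Suc m)
  note P = finite_set_power[OF S(1)] set_power_in_field[OF S(2)] one_in_set_power[OF S(3)]
  have sub: "\<I> (S ^ m) \<subseteq> \<I> (S ^ Suc m)"
    using subset_times_one[OF S(3), of "S ^ m"] by (intro span_subset_mono) (simp add: mult.commute)
  note fin = finite_quot_between[OF span_additive O_additive O_subset_span[OF P(3)] sub finite_quot_span[OF P]]
  obtain T where T: "T \<subseteq> F" "\<I> (S ^ m * T) = \<O>" using invertible_set_power[OF S] by metis
  have "\<I> (S ^ Suc m * T) = \<I> S" using span_O_times[OF T(2), of S] by (simp add: mult_ac)
  then have "ideal_index S \<le> idx (\<I> (S ^ Suc m)) (\<I> (S ^ m))"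
    using idx_span_times_le[OF sub fin(1) T(1)] T(2) by (simp add: ideal_index_def)
  then have "ideal_index S * ideal_index S ^ m \<le> idx (\<I> (S ^ Suc m)) (\<I> (S ^ m)) * ideal_index (S ^ m)"
    using Suc.IH by (rule mult_le_mono)
  also have "\<dots> = ideal_index (S ^ Suc m)"
    unfolding ideal_index_def
    by (rule idx_mult(2)[OF span_additive span_additive O_additive O_subset_span[OF P(3)] sub fin, symmetric])
  finally show ?case by simp
qed

text \<open>The m-th powers of the generators span an ideal that contains the m-th power of the
  ideal, so the bound for the latter passes to them.\<close>

lemma ideal_index_power_ge:
  assumes S: "finite S" "S \<subseteq> F" "1 \<in> S"
  shows "ideal_index S ^ m \<le> ideal_index ((\<lambda>s. s ^ m) ` S)"
proof -
  have "1 \<in> (\<lambda>s. s ^ m) ` S" using S(3) by (intro image_eqI[of _ _ 1]) auto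
  then have "ideal_index (S ^ m) \<le> ideal_index ((\<lambda>s. s ^ m) ` S)"
    using S by (intro ideal_index_mono span_power_subset one_in_set_power) (auto intro!: subring_C_power[OF FR])
  then show ?thesis using ideal_index_set_power_ge[OF S, of m] by simp
qed

end

section \<open>Extensions of embeddings\<close>

definition poly_over :: "complex set \<Rightarrow> complex poly \<Rightarrow> bool" where
  "poly_over F p \<longleftrightarrow> (\<forall>i. poly.coeff p i \<in> F)"

lemma poly_over_0: "subfield_C F \<Longrightarrow> poly_over F 0"
  by (simp add: poly_over_def subfield_C_def)

lemma poly_over_add: "subfield_C F \<Longrightarrow> poly_over F p \<Longrightarrow> poly_over F q \<Longrightarrow> poly_over F (p + q)"
  by (simp add: poly_over_def subfield_C_def)

lemma poly_over_minus: "subfield_C F \<Longrightarrow> poly_over F p \<Longrightarrow> poly_over F (- p)"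
  by (simp add: poly_over_def subfield_C_def)

lemma poly_over_diff: "subfield_C F \<Longrightarrow> poly_over F p \<Longrightarrow> poly_over F q \<Longrightarrow> poly_over F (p - q)"
  using poly_over_add[of F p "- q"] poly_over_minus by auto

lemma poly_over_mult: "subfield_C F \<Longrightarrow> poly_over F p \<Longrightarrow> poly_over F q \<Longrightarrow> poly_over F (p * q)"
  unfolding poly_over_def coeff_mult
  by (intro allI subring_C_sum[OF subfield_imp_subring]) (auto simp: subfield_C_def)

lemma poly_over_monom: "subfield_C F \<Longrightarrow> c \<in> F \<Longrightarrow> poly_over F (Polynomial.monom c n)"
  by (auto simp: poly_over_def coeff_monom subfield_C_def)

lemma poly_over_smult: "subfield_C F \<Longrightarrow> c \<in> F \<Longrightarrow> poly_over F p \<Longrightarrow> poly_over F (Polynomial.smult c p)"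
  by (auto simp: poly_over_def subfield_C_def)

lemma poly_over_pderiv: "subfield_C F \<Longrightarrow> poly_over F p \<Longrightarrow> poly_over F (pderiv p)"
proof -
  assume F: "subfield_C F" and p: "poly_over F p"
  have "of_nat n * x \<in> F" if "x \<in> F" for n x
    using subring_C_of_int[OF subfield_imp_subring[OF F], of "int n"] that F by (auto simp: subfield_C_def)
  then show ?thesis using p by (simp add: poly_over_def coeff_pderiv del: of_nat_Suc)
qed

lemma poly_over_eval: "subfield_C F \<Longrightarrow> poly_over F p \<Longrightarrow> x \<in> F \<Longrightarrow> poly p x \<in> F"
  using subring_C_power[OF subfield_imp_subring, of F x] unfolding poly_altdef poly_over_def
  by (intro subring_C_sum[OF subfield_imp_subring]) (auto simp: subfield_C_def)

lemma poly_over_mono: "F \<subseteq> L \<Longrightarrow> poly_over F p \<Longrightarrow> poly_over L p"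
  by (auto simp: poly_over_def)

lemma poly_over_division:
  assumes F: "subfield_C F" and f: "poly_over F f" "lead_coeff f = 1" and p: "poly_over F p"
  obtains q r where "poly_over F q" "poly_over F r" "p = q * f + r" "r = 0 \<or> degree r < degree f"
proof -
  have "\<exists>q r. poly_over F q \<and> poly_over F r \<and> p = q * f + r \<and> (r = 0 \<or> degree r < degree f)"
    using p
  proof (induction "degree p" arbitrary: p rule: less_induct)
    case less
    show ?case
    proof (cases "p = 0 \<or> degree p < degree f")
      case True
      then show ?thesis using less.prems by (intro exI[of _ 0] exI[of _ p]) (auto simp: poly_over_0[OF F])
    next
      case False
      define t where "t = Polynomial.monom (lead_coeff p) (degree p - degree f)"
      have t: "poly_over F t" unfolding t_def using less.prems by (intro poly_over_monom[OF F]) (simp add: poly_over_def)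
      have t0: "t \<noteq> 0" using False by (simp add: t_def)
      have f0: "f \<noteq> 0" using f by auto
      have deg: "degree (t * f) = degree p"
        using False t0 f0 by (simp add: degree_mult_eq t_def degree_monom_eq)
      have lc: "poly.coeff (t * f) (degree p) = lead_coeff p"
        using deg f lead_coeff_mult[of t f] False by (simp add: t_def degree_monom_eq)
      define p' where "p' = p - t * f"
      have p': "poly_over F p'" unfolding p'_def by (intro poly_over_diff[OF F] poly_over_mult[OF F] less.prems t f)
      have "p' = 0 \<or> degree p' < degree p"
      \<comment> \<open>For constants the degree cannot drop, so cancelling the leading term must
        give the zero polynomial.\<close>
      proof (cases "degree p = 0")
        case True
        then have "degree p' = 0" "poly.coeff p' 0 = 0"
          using deg lc degree_diff_le[of p 0 "t * f"] by (auto simp: p'_def)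
        then show ?thesis by (metis degree_eq_zeroE coeff_pCons_0 pCons_0_0)
      next
        case False
        have "degree p' \<le> degree p" unfolding p'_def using deg by (intro degree_diff_le) auto
        moreover have "poly.coeff p' (degree p) = 0" by (simp add: p'_def lc)
        ultimately show ?thesis using False by (metis le_neq_implies_less leading_coeff_0_iff)
      qed
      then have "\<exists>q r. poly_over F q \<and> poly_over F r \<and> p' = q * f + r \<and> (r = 0 \<or> degree r < degree f)"
      proof
        assume "p' = 0"
        then show ?thesis by (intro exI[of _ 0]) (auto simp: poly_over_0[OF F])
      qed (use less.hyps p' in blast)
      then obtain q r where qr: "poly_over F q" "poly_over F r" "p' = q * f + r" "r = 0 \<or> degree r < degree f" by blast
      then have "p = (t + q) * f + r" by (simp add: p'_def algebra_simps)
      then show ?thesis using qr poly_over_add[OF F t qr(1)] by blast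
    qed
  qed
  then show thesis using that by blast
qed

context
  fixes F \<sigma> assumes F: "subfield_C F" and \<sigma>: "\<sigma> \<in> field_embs F"
begin

lemma emb_add: "x \<in> F \<Longrightarrow> y \<in> F \<Longrightarrow> \<sigma> (x + y) = \<sigma> x + \<sigma> y"
  and emb_mult: "x \<in> F \<Longrightarrow> y \<in> F \<Longrightarrow> \<sigma> (x * y) = \<sigma> x * \<sigma> y"
  and emb_one: "\<sigma> 1 = 1"
  and emb_outside: "x \<notin> F \<Longrightarrow> \<sigma> x = 0"
  using \<sigma> by (auto simp: field_embs_def)

lemma emb_zero: "\<sigma> 0 = 0"
  using emb_add[of 0 0] F by (auto simp: subfield_C_def)

lemma emb_sum: "(\<And>i. i \<in> I \<Longrightarrow> f i \<in> F) \<Longrightarrow> \<sigma> (sum f I) = (\<Sum>i\<in>I. \<sigma> (f i))"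
  by (induction I rule: infinite_finite_induct)
    (auto simp: emb_zero emb_add subring_C_sum[OF subfield_imp_subring[OF F]])

lemma emb_uminus: "x \<in> F \<Longrightarrow> \<sigma> (- x) = - \<sigma> x"
  using emb_add[of x "- x"] F by (auto simp: subfield_C_def emb_zero add_eq_0_iff)

lemma emb_nonzero: "x \<in> F \<Longrightarrow> x \<noteq> 0 \<Longrightarrow> \<sigma> x \<noteq> 0"
  using emb_mult[of x "inverse x"] F by (auto simp: subfield_C_def emb_one)

lemma emb_power: "x \<in> F \<Longrightarrow> \<sigma> (x ^ n) = \<sigma> x ^ n"
  by (induction n) (auto simp: emb_one emb_mult subring_C_power[OF subfield_imp_subring[OF F]])

lemma emb_of_nat: "\<sigma> (of_nat n) = of_nat n"
proof (induction n)
  case (Suc n)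
  have "of_nat n \<in> F" using subring_C_of_int[OF subfield_imp_subring[OF F], of "int n"] by simp
  then show ?case using Suc F by (simp add: emb_add emb_one subfield_C_def)
qed (simp add: emb_zero)

lemma emb_poly_add: "poly_over F p \<Longrightarrow> poly_over F q \<Longrightarrow> map_poly \<sigma> (p + q) = map_poly \<sigma> p + map_poly \<sigma> q"
  by (rule poly_eqI) (simp add: coeff_map_poly emb_zero emb_add poly_over_def)

lemma emb_poly_mult: "poly_over F p \<Longrightarrow> poly_over F q \<Longrightarrow> map_poly \<sigma> (p * q) = map_poly \<sigma> p * map_poly \<sigma> q"
proof (rule poly_eqI)
  fix n assume pq: "poly_over F p" "poly_over F q"
  have "\<sigma> (\<Sum>i\<le>n. poly.coeff p i * poly.coeff q (n - i)) = (\<Sum>i\<le>n. \<sigma> (poly.coeff p i * poly.coeff q (n - i)))"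
    using pq F by (intro emb_sum) (auto simp: poly_over_def subfield_C_def)
  also have "\<dots> = (\<Sum>i\<le>n. \<sigma> (poly.coeff p i) * \<sigma> (poly.coeff q (n - i)))"
    using pq by (intro sum.cong) (auto simp: poly_over_def emb_mult)
  finally show "poly.coeff (map_poly \<sigma> (p * q)) n = poly.coeff (map_poly \<sigma> p * map_poly \<sigma> q) n"
    by (simp add: coeff_map_poly emb_zero coeff_mult)
qed

lemma emb_poly_pderiv: "poly_over F p \<Longrightarrow> map_poly \<sigma> (pderiv p) = pderiv (map_poly \<sigma> p)"
proof (rule poly_eqI)
  fix n assume p: "poly_over F p"
  have "of_nat (Suc n) \<in> F" using subring_C_of_int[OF subfield_imp_subring[OF F], of "int (Suc n)"] by (simp only: of_int_of_nat_eq)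
  then show "poly.coeff (map_poly \<sigma> (pderiv p)) n = poly.coeff (pderiv (map_poly \<sigma> p)) n"
    using p emb_of_nat[of "Suc n"] by (simp add: coeff_map_poly emb_zero coeff_pderiv emb_mult poly_over_def del: of_nat_Suc)
qed

lemma emb_poly_degree: "poly_over F p \<Longrightarrow> degree (map_poly \<sigma> p) = degree p"
  by (cases "p = 0") (auto simp: degree_map_poly emb_nonzero poly_over_def)

lemma emb_poly_monic: "poly_over F p \<Longrightarrow> lead_coeff p = 1 \<Longrightarrow> lead_coeff (map_poly \<sigma> p) = 1"
  by (simp add: emb_poly_degree coeff_map_poly emb_zero emb_one)

end

section \<open>Linear dependence and finite extensions\<close>

text \<open>Gaussian elimination: if some element has a nonzero b-coordinate, subtracting multiples
  of it removes b from all the others, which costs one generator and one element.\<close>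

lemma span_over_field_dim_le:
  assumes F: "subfield_C F" and B: "finite B" and I: "finite I" "card B < card I"
    and e: "\<And>i. i \<in> I \<Longrightarrow> e i \<in> span_over F B"
  shows "\<exists>a. (\<forall>i\<in>I. a i \<in> F) \<and> (\<exists>i\<in>I. a i \<noteq> 0) \<and> (\<Sum>i\<in>I. a i * e i) = 0"
  using B I e
proof (induction B arbitrary: I e rule: finite_induct)
  case empty
  then obtain k where k: "k \<in> I" by fastforce
  have "e i = 0" if "i \<in> I" for i using empty(3)[OF that] by cases auto
  then show ?case using k F by (intro exI[of _ "\<lambda>_. 1"]) (auto simp: subfield_C_def)
next
  case (insert b B)
  have "\<exists>c e'. c \<in> F \<and> e' \<in> span_over F B \<and> e i = c * b + e'" if "i \<in> I" for i
    using insert.prems(3)[OF that]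
  proof induction
    case zero
    show ?case using F by (intro exI[of _ 0]) (auto simp: subfield_C_def intro: span_over.zero)
  next
    case (step a s z)
    then obtain c e' where ce: "c \<in> F" "e' \<in> span_over F B" "z = c * b + e'" by blast
    show ?case
    proof (cases "s = b")
      case True
      then have "a * s + z = (a + c) * b + e'" by (simp add: ce algebra_simps)
      moreover have "a + c \<in> F" using ce step F by (auto simp: subfield_C_def)
      ultimately show ?thesis using ce(2) by blast
    next
      case False
      then have "a * s + e' \<in> span_over F B" using step ce by (intro span_over.step) auto
      moreover have "a * s + z = c * b + (a * s + e')" by (simp add: ce)
      ultimately show ?thesis using ce by blast
    qed
  qed
  then obtain c e' where ce: "\<And>i. i \<in> I \<Longrightarrow> c i \<in> F" "\<And>i. i \<in> I \<Longrightarrow> e' i \<in> span_over F B"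
    "\<And>i. i \<in> I \<Longrightarrow> e i = c i * b + e' i" by metis
  have R: "subring_C F" by (rule subfield_imp_subring[OF F])
  show ?case
  proof (cases "\<exists>k\<in>I. c k \<noteq> 0")
    case False
    have "\<exists>a. (\<forall>i\<in>I. a i \<in> F) \<and> (\<exists>i\<in>I. a i \<noteq> 0) \<and> (\<Sum>i\<in>I. a i * e' i) = 0"
      using insert.prems insert.hyps ce by (intro insert.IH) auto
    moreover have "(\<Sum>i\<in>I. a i * e' i) = (\<Sum>i\<in>I. a i * e i)" for a
      using False ce(3) by (intro sum.cong) auto
    ultimately show ?thesis by simp
  next
    case True
    then obtain k where k: "k \<in> I" "c k \<noteq> 0" by blast
    define f where "f i = e' i - (c i / c k) * e' k" for i
    have "\<exists>a. (\<forall>i\<in>I - {k}. a i \<in> F) \<and> (\<exists>i\<in>I - {k}. a i \<noteq> 0) \<and> (\<Sum>i\<in>I - {k}. a i * f i) = 0"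
    proof (rule insert.IH)
      show "card B < card (I - {k})" using insert.prems insert.hyps k by simp
      fix i assume "i \<in> I - {k}"
      then show "f i \<in> span_over F B"
        unfolding f_def using ce k by (intro span_diff[OF R] span_scale[OF R] subfield_C_divide[OF F]) auto
    qed (use insert.prems in auto)
    then obtain a where a: "\<And>i. i \<in> I - {k} \<Longrightarrow> a i \<in> F" "\<exists>i\<in>I - {k}. a i \<noteq> 0" "(\<Sum>i\<in>I - {k}. a i * f i) = 0"
      by blast
    \<comment> \<open>The total multiple of the pivot \<open>e k\<close> that was subtracted; with
      opposite sign it becomes the coefficient of \<open>e k\<close>.\<close>
    define s where "s = (\<Sum>i\<in>I - {k}. a i * (c i / c k))"
    have sF: "s \<in> F" unfolding s_def using a ce k F
      by (intro subring_C_sum[OF R]) (auto simp: subfield_C_def intro!: subfield_C_divide[OF F])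
    define a' where "a' = (\<lambda>i. if i = k then - s else a i)"
    have "(\<Sum>i\<in>I. a' i * e i) = - s * e k + (\<Sum>i\<in>I - {k}. a i * e i)"
      using insert.prems k by (subst sum.remove[of I k]) (auto simp: a'_def intro!: sum.cong)
    also have "(\<Sum>i\<in>I - {k}. a i * e i) = (\<Sum>i\<in>I - {k}. a i * f i) + (\<Sum>i\<in>I - {k}. a i * (c i / c k) * e k)"
      unfolding sum.distrib[symmetric]
      by (intro sum.cong) (use ce k in \<open>auto simp: f_def field_simps\<close>)
    also have "(\<Sum>i\<in>I - {k}. a i * (c i / c k) * e k) = s * e k" by (simp add: s_def sum_distrib_right)
    finally have "(\<Sum>i\<in>I. a' i * e i) = 0" using a by simp
    moreover have "\<forall>i\<in>I. a' i \<in> F" using a sF F by (auto simp: a'_def subfield_C_def)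
    moreover have "\<exists>i\<in>I. a' i \<noteq> 0" using a(2) by (auto simp: a'_def)
    ultimately show ?thesis by blast
  qed
qed

lemma dim_le_span:
  assumes "subfield_C F" "finite B" "card B \<le> r" "J \<subseteq> span_over F B"
  shows "dim_le F J r"
  unfolding dim_le_def
proof (intro allI impI)
  fix e assume "\<forall>i\<le>r. e i \<in> J"
  then have "\<exists>a. (\<forall>i\<in>{..r}. a i \<in> F) \<and> (\<exists>i\<in>{..r}. a i \<noteq> 0) \<and> (\<Sum>i\<in>{..r}. a i * e i) = 0"
    using assms(3,4) by (intro span_over_field_dim_le[OF assms(1,2)]) auto
  then show "\<exists>a. (\<forall>i\<le>r. a i \<in> F) \<and> (\<exists>i\<le>r. a i \<noteq> 0) \<and> (\<Sum>i\<le>r. a i * e i) = 0"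
    by (simp only: Ball_def Bex_def atMost_iff)
qed

lemma algebraic_over_of_dim_le:
  assumes F: "subfield_C F" and L: "subring_C L" and dim: "dim_le F L r" and x: "x \<in> L"
  obtains p where "p \<noteq> 0" "poly_over F p" "poly p x = 0"
proof -
  have "\<forall>i\<le>r. x ^ i \<in> L" using subring_C_power[OF L x] by blast
  then obtain a where a: "\<forall>i\<le>r. a i \<in> F" "\<exists>i\<le>r. a i \<noteq> 0" "(\<Sum>i\<le>r. a i * x ^ i) = 0"
    using dim[unfolded dim_le_def, rule_format, of "\<lambda>i. x ^ i"] by blast
  define p where "p = (\<Sum>i\<le>r. Polynomial.monom (a i) i)"
  have coeff: "poly.coeff p i = (if i \<le> r then a i else 0)" for i
    by (simp add: p_def coeff_sum coeff_monom)
  show thesis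
  proof (rule that[of p])
    show "p \<noteq> 0" using a(2) coeff by (metis coeff_0)
    show "poly_over F p" using a(1) F by (auto simp: poly_over_def coeff subfield_C_def)
    show "poly p x = 0" using a(3) by (simp add: p_def poly_sum poly_monom)
  qed
qed

text \<open>For x \<noteq> 0, factors x are cancelled from a relation until its constant term c is
  nonzero. Then c + x * q(x) = 0 exhibits - q(x) / c as the inverse of x.\<close>

lemma subfield_of_dim_le:
  assumes F: "subfield_C F" and L: "subring_C L" and FL: "F \<subseteq> L" and dim: "dim_le F L r"
  shows "subfield_C L"
proof -
  have "inverse x \<in> L" if x: "x \<in> L" for x
  proof (cases "x = 0")
    case True
    then show ?thesis using L by (simp add: subring_C_def)
  next
    case False
    obtain p where p: "p \<noteq> 0" "poly_over F p" "poly p x = 0"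
      using algebraic_over_of_dim_le[OF F L dim x] by blast
    then show ?thesis
    proof (induction "degree p" arbitrary: p rule: less_induct)
      case less
      obtain c q where cq: "p = pCons c q" by (cases p)
      have q: "poly_over F q" unfolding poly_over_def
      proof
        fix i show "poly.coeff q i \<in> F" using less.prems(2) coeff_pCons_Suc[of c q i] cq unfolding poly_over_def by metis
      qed
      have c: "c \<in> F" using less.prems(2) cq unfolding poly_over_def by (metis coeff_pCons_0)
      have eq: "c + x * poly q x = 0" using less.prems(3) cq by simp
      have q0: "q \<noteq> 0" using eq cq less.prems(1) by auto
      show ?case
      proof (cases "c = 0")
        case True
        then have "poly q x = 0" using eq False by simp
        then show ?thesis using less.hyps[OF _ q0 q] cq q0 by simp
      next
        case False
        have "x * (- poly q x * inverse c) = 1" using eq False by (simp add: field_simps add_eq_0_iff2)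
        then have "inverse x = - poly q x * inverse c" by (rule inverse_unique)
        moreover have "poly q x \<in> L" unfolding poly_altdef
        proof (rule subring_C_sum[OF L])
          fix i
          have "poly.coeff q i \<in> L" "x ^ i \<in> L" using q FL subring_C_power[OF L x] by (auto simp: poly_over_def)
          then show "poly.coeff q i * x ^ i \<in> L" using L by (simp add: subring_C_def)
        qed
        moreover have "inverse c \<in> L" using c F FL by (auto simp: subfield_C_def)
        ultimately show ?thesis using L by (simp add: subring_C_def)
      qed
    qed
  qed
  then show ?thesis using L by (auto simp: subring_C_def subfield_C_def)
qed

lemma gen_field_subfield: "subfield_C (gen_field S)"
  by (auto simp: gen_field_def subfield_C_def)

lemma gen_field_superset: "S \<subseteq> gen_field S"
  by (auto simp: gen_field_def)

lemma gen_field_least: "subfield_C K \<Longrightarrow> S \<subseteq> K \<Longrightarrow> gen_field S \<subseteq> K"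
  by (auto simp: gen_field_def)

text \<open>\<open>L/F\<close> is finite, and its degree bounds the dimension and equals the number of
  extensions of each embedding of \<open>F\<close>.\<close>
definition finite_extension :: "complex set \<Rightarrow> complex set \<Rightarrow> nat \<Rightarrow> bool" where
  "finite_extension F L r \<longleftrightarrow> r > 0 \<and> F \<subseteq> L \<and> (\<exists>B. finite B \<and> card B \<le> r \<and> L \<subseteq> span_over F B) \<and>
     (\<forall>\<sigma>\<in>field_embs F. card {\<tau> \<in> field_embs L. \<forall>x\<in>F. \<tau> x = \<sigma> x} = r)"

text \<open>With f the minimal polynomial of \<alpha>, the extensions of \<sigma> to F(\<alpha>)
  correspond to the complex roots of the image of f under \<sigma>. These roots are simple, so their
  number is the degree of f, which is also a bound for the number of generators.\<close>

lemma simple_extension: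
  assumes F: "subfield_C F" and \<alpha>: "poly_over F p0" "p0 \<noteq> 0" "poly p0 \<alpha> = 0"
  shows "\<exists>r. finite_extension F (gen_field (F \<union> {\<alpha>})) r"
proof -
  define Q where "Q f \<longleftrightarrow> poly_over F f \<and> f \<noteq> 0 \<and> poly f \<alpha> = 0" for f
  obtain f0 where f0: "Q f0" "\<And>g. Q g \<Longrightarrow> degree f0 \<le> degree g"
  proof -
    have "Q p0" using \<alpha> by (simp add: Q_def)
    then show thesis using that[of "arg_min degree Q"] arg_min_nat_lemma[of Q p0 degree] by blast
  qed
  define f where "f = Polynomial.smult (inverse (lead_coeff f0)) f0"
  define d where "d = degree f"
  have f: "poly_over F f" "lead_coeff f = 1" "poly f \<alpha> = 0"
    using f0(1) F unfolding f_def Q_def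
    by (auto intro!: poly_over_smult simp: subfield_C_def poly_over_def)
  have f_min: "d \<le> degree g" if "poly_over F g" "g \<noteq> 0" "poly g \<alpha> = 0" for g
    using f0(2)[of g] that f0(1) by (simp add: Q_def d_def f_def)
  have fnz: "f \<noteq> 0" using f(2) by auto
  have d0: "d > 0"
  proof (rule Nat.gr0I)
    assume "d = 0"
    then obtain c where "f = [:c:]" unfolding d_def by (metis degree_eq_zeroE)
    then show False using f by simp
  qed
  define L where "L = (\<lambda>p. poly p \<alpha>) ` {p. poly_over F p}"
  define B where "B = (\<lambda>i. \<alpha> ^ i) ` {..<d}"
  have LB: "L \<subseteq> span_over F B"
  proof
    fix x assume "x \<in> L"
    then obtain p where p: "poly_over F p" "x = poly p \<alpha>" by (auto simp: L_def)
    obtain q r where qr: "poly_over F r" "p = q * f + r" "r = 0 \<or> degree r < degree f"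
      using poly_over_division[OF F f(1,2) p(1)] by metis
    then have "x = poly r \<alpha>" using p f by simp
    also have "\<dots> \<in> span_over F B"
    proof (cases "r = 0")
      case False
      then show ?thesis
        unfolding poly_altdef B_def using qr
        by (intro span_sum span_scale_base imageI) (auto simp: poly_over_def d_def)
    qed (simp add: span_over.zero)
    finally show "x \<in> span_over F B" .
  qed
  have B: "finite B" "card B \<le> d" using card_image_le[of "{..<d}" "\<lambda>i. \<alpha> ^ i"] by (auto simp: B_def)
  have L_ring: "subring_C L"
    unfolding subring_C_def L_def
  proof (intro conjI ballI)
    show "0 \<in> (\<lambda>p. poly p \<alpha>) ` {p. poly_over F p}" by (rule image_eqI[of _ _ 0]) (auto simp: poly_over_0[OF F])
    show "1 \<in> (\<lambda>p. poly p \<alpha>) ` {p. poly_over F p}"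
      using poly_over_monom[OF F, of 1 0] F by (intro image_eqI[of _ _ "Polynomial.monom 1 0"]) (auto simp: poly_monom subfield_C_def)
    fix x assume "x \<in> (\<lambda>p. poly p \<alpha>) ` {p. poly_over F p}"
    then obtain p where p: "poly_over F p" "x = poly p \<alpha>" by auto
    show "- x \<in> (\<lambda>p. poly p \<alpha>) ` {p. poly_over F p}"
      using p poly_over_minus[OF F] by (intro image_eqI[of _ _ "- p"]) auto
    fix y assume "y \<in> (\<lambda>p. poly p \<alpha>) ` {p. poly_over F p}"
    then obtain q where q: "poly_over F q" "y = poly q \<alpha>" by auto
    show "x + y \<in> (\<lambda>p. poly p \<alpha>) ` {p. poly_over F p}"
      using p q poly_over_add[OF F] by (intro image_eqI[of _ _ "p + q"]) auto
    show "x * y \<in> (\<lambda>p. poly p \<alpha>) ` {p. poly_over F p}"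
      using p q poly_over_mult[OF F] by (intro image_eqI[of _ _ "p * q"]) auto
  qed
  have FL: "F \<subseteq> L" unfolding L_def
  proof
    fix x assume "x \<in> F"
    then show "x \<in> (\<lambda>p. poly p \<alpha>) ` {p. poly_over F p}"
      using poly_over_monom[OF F, of x 0] by (intro image_eqI[of _ _ "Polynomial.monom x 0"]) (auto simp: poly_monom)
  qed
  have \<alpha>L: "\<alpha> \<in> L" unfolding L_def
    using poly_over_monom[OF F, of 1 1] F by (intro image_eqI[of _ _ "Polynomial.monom 1 1"]) (auto simp: poly_monom subfield_C_def)
  have L: "subfield_C L" by (rule subfield_of_dim_le[OF F L_ring FL dim_le_span[OF F B LB]])
  have genL: "gen_field (F \<union> {\<alpha>}) = L"
  proof
    show "gen_field (F \<union> {\<alpha>}) \<subseteq> L" using L FL \<alpha>L by (intro gen_field_least) auto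
    have K: "subfield_C (gen_field (F \<union> {\<alpha>}))" and sub: "F \<union> {\<alpha>} \<subseteq> gen_field (F \<union> {\<alpha>})"
      by (auto simp: gen_field_subfield intro: gen_field_superset[THEN subsetD])
    show "L \<subseteq> gen_field (F \<union> {\<alpha>})"
      unfolding L_def using sub poly_over_eval[OF K _, of _ \<alpha>] poly_over_mono[of F "gen_field (F \<union> {\<alpha>})"] by auto
  qed
  have "card {\<tau> \<in> field_embs L. \<forall>x\<in>F. \<tau> x = \<sigma> x} = d" if \<sigma>: "\<sigma> \<in> field_embs F" for \<sigma>
  proof -
    let ?m = "map_poly \<sigma>"
    note emb = emb_add[OF F \<sigma>] emb_mult[OF F \<sigma>] emb_one[OF F \<sigma>] emb_zero[OF F \<sigma>]
    have fs: "degree (?m f) = d" "lead_coeff (?m f) = 1"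
      using emb_poly_degree[OF F \<sigma> f(1)] emb_poly_monic[OF F \<sigma> f(1,2)] by (auto simp: d_def)
    \<comment> \<open>A polynomial over F vanishing at \<alpha> is a multiple of f, so its image
      under \<sigma> vanishes at the roots of the image of f. This is what makes \<alpha> \<mapsto>
      \<beta> define a map on F(\<alpha>).\<close>
    have dvd: "poly (?m p) \<beta> = 0" if p: "poly_over F p" "poly p \<alpha> = 0" "poly (?m f) \<beta> = 0" for p \<beta>
    proof -
      obtain q r where qr: "poly_over F q" "poly_over F r" "p = q * f + r" "r = 0 \<or> degree r < degree f"
        using poly_over_division[OF F f(1,2) p(1)] by metis
      have "poly r \<alpha> = 0" using qr f p by simp
      then have "r = 0" using f_min[OF qr(2)] qr(4) unfolding d_def by (metis leD)
      then show ?thesis using qr f(1) p emb_poly_mult[OF F \<sigma> qr(1) f(1)] by simp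
    qed
    have simple: "poly (pderiv (?m f)) \<beta> \<noteq> 0" if \<beta>: "poly (?m f) \<beta> = 0" for \<beta>
    proof -
      \<comment> \<open>The minimal polynomial of \<beta>, pulled back along \<sigma>, so that all
        divisions take place over F and not over its image.\<close>
      define Q' where "Q' g \<longleftrightarrow> poly_over F g \<and> g \<noteq> 0 \<and> poly (?m g) \<beta> = 0" for g
      obtain g0 where g0: "Q' g0" "\<And>h. Q' h \<Longrightarrow> degree g0 \<le> degree h"
      proof -
        have "Q' f" using f fnz \<beta> by (simp add: Q'_def)
        then show thesis using that[of "arg_min degree Q'"] arg_min_nat_lemma[of Q' f degree] by blast
      qed
      define c where "c = inverse (lead_coeff g0)"
      define g where "g = Polynomial.smult c g0"
      have c: "c \<in> F" "c \<noteq> 0" using g0(1) F by (auto simp: c_def Q'_def subfield_C_def poly_over_def)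
      have g: "poly_over F g" "lead_coeff g = 1"
        using g0(1) c F unfolding g_def Q'_def by (auto intro!: poly_over_smult simp: c_def)
      have "?m g = Polynomial.smult (\<sigma> c) (?m g0)"
        by (rule poly_eqI) (use g0(1) c emb in \<open>simp add: g_def coeff_map_poly Q'_def poly_over_def\<close>)
      then have g\<beta>: "poly (?m g) \<beta> = 0" using g0(1) by (simp add: Q'_def)
      have deg_g: "degree g = degree g0" using c by (simp add: g_def)
      have div: "\<exists>q. poly_over F q \<and> h = q * g" if h: "poly_over F h" "poly (?m h) \<beta> = 0" for h
      proof -
        obtain q r where qr: "poly_over F q" "poly_over F r" "h = q * g + r" "r = 0 \<or> degree r < degree g"
          using poly_over_division[OF F g h(1)] by metis
        have "poly (?m r) \<beta> = 0"
          using h(2) g\<beta> emb_poly_add[OF F \<sigma> poly_over_mult[OF F qr(1) g(1)] qr(2)] emb_poly_mult[OF F \<sigma> qr(1) g(1)]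
          by (simp add: qr(3))
        then have "r = 0" using g0(2)[of r] qr(2,4) deg_g unfolding Q'_def by (metis leD)
        then show ?thesis using qr by auto
      qed
      obtain q where q: "poly_over F q" "f = q * g" using div[OF f(1) \<beta>] by blast
      have nz: "q \<noteq> 0" "g \<noteq> 0" using q fnz by auto
      then have degs: "d = degree q + degree g" by (simp add: d_def q degree_mult_eq)
      have "degree g > 0"
      proof (rule Nat.gr0I)
        assume "degree g = 0"
        then obtain c where "g = [:c:]" by (metis degree_eq_zeroE)
        then have "g = [:1:]" using g(2) by simp
        then show False using g\<beta> emb by (simp add: Polynomial.map_poly_pCons)
      qed
      \<comment> \<open>In f = q * g the factor q has smaller degree than f and cannot vanish at
        \<alpha>. So g vanishes there, and by minimality of f its degree is at least d.\<close>
      then have "poly q \<alpha> \<noteq> 0" using f_min[OF q(1) nz(1)] degs by auto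
      then have "poly g \<alpha> = 0" using f(3) q by simp
      then have dg: "degree g \<ge> d" using f_min g nz by blast
      show ?thesis
      proof
        assume "poly (pderiv (?m f)) \<beta> = 0"
        then have "poly (?m (pderiv f)) \<beta> = 0" using emb_poly_pderiv[OF F \<sigma> f(1)] by simp
        then obtain q' where q': "pderiv f = q' * g" using div[OF poly_over_pderiv[OF F f(1)]] by blast
        \<comment> \<open>In characteristic 0 the derivative is nonzero, yet it would be a multiple
          of g, whose degree is larger.\<close>
        have "pderiv f \<noteq> 0" using d0 by (simp add: pderiv_eq_0_iff d_def)
        then have "degree g \<le> degree (pderiv f)" using q' by (auto simp: degree_mult_eq)
        also have "\<dots> < d" using d0 by (simp add: degree_pderiv d_def)
        finally show False using dg by simp
      qed
    qed
    have "rsquarefree (?m f)" unfolding rsquarefree_roots using simple by auto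
    then have fac: "?m f = (\<Prod>z | poly (?m f) z = 0. [:- z, 1:])"
      using complex_poly_decompose_rsquarefree[of "?m f"] fs(2) by simp
    have "degree (\<Prod>z | poly (?m f) z = 0. [:- z, 1:]) = card {z. poly (?m f) z = 0}"
      by (subst degree_prod_eq_sum_degree) auto
    then have card: "card {z. poly (?m f) z = 0} = d" using fs(1) fac by metis
    let ?E = "{\<tau> \<in> field_embs L. \<forall>x\<in>F. \<tau> x = \<sigma> x}"
    have eval: "\<tau> (poly p \<alpha>) = poly (?m p) (\<tau> \<alpha>)" if "\<tau> \<in> ?E" "poly_over F p" for \<tau> p
    proof -
      have \<tau>: "\<tau> \<in> field_embs L" using that by simp
      have pw: "\<alpha> ^ i \<in> L" for i by (rule subring_C_power[OF L_ring \<alpha>L])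
      have cL: "poly.coeff p i \<in> L" for i using that FL by (auto simp: poly_over_def)
      have "\<tau> (poly p \<alpha>) = (\<Sum>i\<le>degree p. \<tau> (poly.coeff p i * \<alpha> ^ i))"
        unfolding poly_altdef using pw cL L by (intro emb_sum[OF L \<tau>]) (auto simp: subfield_C_def)
      also have "\<dots> = (\<Sum>i\<le>degree p. \<sigma> (poly.coeff p i) * \<tau> \<alpha> ^ i)"
        using that cL pw \<alpha>L by (intro sum.cong) (auto simp: emb_mult[OF L \<tau>] emb_power[OF L \<tau>] poly_over_def)
      also have "\<dots> = poly (?m p) (\<tau> \<alpha>)"
        using that by (simp add: poly_altdef emb_poly_degree[OF F \<sigma>] coeff_map_poly emb)
      finally show ?thesis .
    qed
    have "bij_betw (\<lambda>\<tau>. \<tau> \<alpha>) ?E {z. poly (?m f) z = 0}"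
    proof (rule bij_betw_imageI)
      show "inj_on (\<lambda>\<tau>. \<tau> \<alpha>) ?E"
      proof (rule inj_onI, rule ext)
        fix \<tau> \<tau>' x assume *: "\<tau> \<in> ?E" "\<tau>' \<in> ?E" "\<tau> \<alpha> = \<tau>' \<alpha>"
        show "\<tau> x = \<tau>' x"
        proof (cases "x \<in> L")
          case True
          then obtain p where p: "poly_over F p" "x = poly p \<alpha>" by (auto simp: L_def)
          show ?thesis using eval[OF *(1) p(1)] eval[OF *(2) p(1)] *(3) p(2) by simp
        next
          case False
          then show ?thesis using emb_outside[OF L, of \<tau> x] emb_outside[OF L, of \<tau>' x] *(1,2) by simp
        qed
      qed
      show "(\<lambda>\<tau>. \<tau> \<alpha>) ` ?E = {z. poly (?m f) z = 0}"
      proof (intro equalityI subsetI)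
        fix z assume "z \<in> (\<lambda>\<tau>. \<tau> \<alpha>) ` ?E"
        then obtain \<tau> where \<tau>: "\<tau> \<in> ?E" "z = \<tau> \<alpha>" by blast
        then have "poly (?m f) z = \<tau> 0" using eval[OF \<tau>(1) f(1)] f(3) by simp
        also have "\<dots> = 0" using emb_zero[OF L] \<tau> by simp
        finally show "z \<in> {z. poly (?m f) z = 0}" by simp
      next
        fix z assume z: "z \<in> {z. poly (?m f) z = 0}"
        have "\<forall>x\<in>L. \<exists>p. poly_over F p \<and> poly p \<alpha> = x" by (auto simp: L_def)
        then obtain P where P: "\<And>x. x \<in> L \<Longrightarrow> poly_over F (P x)" "\<And>x. x \<in> L \<Longrightarrow> poly (P x) \<alpha> = x" by metis
        \<comment> \<open>The value at x is taken from a chosen polynomial that represents x;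
          \<open>dvd\<close> shows below that any other representative gives the same value.\<close>
        define \<tau> where "\<tau> x = (if x \<in> L then poly (?m (P x)) z else 0)" for x
        have \<tau>_eval: "\<tau> (poly p \<alpha>) = poly (?m p) z" if p: "poly_over F p" for p
        proof -
          have xL: "poly p \<alpha> \<in> L" using p by (auto simp: L_def)
          define p' where "p' = P (poly p \<alpha>)"
          have p': "poly_over F p'" "poly p' \<alpha> = poly p \<alpha>" unfolding p'_def using P xL by blast+
          have "poly (?m (p - p')) z = 0"
            using p' z by (rule_tac dvd[OF poly_over_diff[OF F p p'(1)]]) auto
          moreover have "?m p = ?m ((p - p') + p')" by simp
          moreover have "\<dots> = ?m (p - p') + ?m p'" by (rule emb_poly_add[OF F \<sigma> poly_over_diff[OF F p p'(1)] p'(1)])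
          ultimately have "poly (?m p) z = poly (?m p') z" by simp
          then show ?thesis using xL by (simp add: \<tau>_def p'_def)
        qed
        have \<tau>F: "\<tau> x = \<sigma> x" if "x \<in> F" for x
        proof -
          have X: "poly_over F [:x:]"
            using that F by (auto simp: poly_over_def coeff_pCons subfield_C_def split: nat.splits)
          show ?thesis using \<tau>_eval[OF X] by (simp add: Polynomial.map_poly_pCons emb)
        qed
        have "\<tau> \<in> field_embs L"
          unfolding field_embs_def
        proof (intro CollectI conjI allI impI ballI)
          show "\<tau> x = 0" if "x \<notin> L" for x using that by (simp add: \<tau>_def)
          show "\<tau> 1 = 1" using \<tau>F[of 1] F emb by (simp add: subfield_C_def)
          fix x y assume "x \<in> L" "y \<in> L"
          then obtain p q where pq: "poly_over F p" "x = poly p \<alpha>" "poly_over F q" "y = poly q \<alpha>" by (auto simp: L_def)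
          show "\<tau> (x + y) = \<tau> x + \<tau> y"
            using \<tau>_eval[OF poly_over_add[OF F pq(1,3)]] \<tau>_eval[OF pq(1)] \<tau>_eval[OF pq(3)] emb_poly_add[OF F \<sigma> pq(1,3)]
            by (simp add: pq)
          show "\<tau> (x * y) = \<tau> x * \<tau> y"
            using \<tau>_eval[OF poly_over_mult[OF F pq(1,3)]] \<tau>_eval[OF pq(1)] \<tau>_eval[OF pq(3)] emb_poly_mult[OF F \<sigma> pq(1,3)]
            by (simp add: pq)
        qed
        moreover have "\<tau> \<alpha> = z"
        proof -
          have X: "poly_over F [:0, 1:]" using F by (auto simp: poly_over_def coeff_pCons subfield_C_def split: nat.splits)
          show ?thesis using \<tau>_eval[OF X] by (simp add: Polynomial.map_poly_pCons emb)
        qed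
        ultimately show "z \<in> (\<lambda>\<tau>. \<tau> \<alpha>) ` ?E" using \<tau>F by (intro image_eqI[of _ _ \<tau>]) auto
      qed
    qed
    then have "card ?E = card {z. poly (?m f) z = 0}" by (rule bij_betw_same_card)
    then show ?thesis using card by simp
  qed
  then show ?thesis unfolding finite_extension_def genL using d0 FL B LB by blast
qed

lemma emb_restrict:
  assumes "F \<subseteq> L" "subfield_C F" "\<tau> \<in> field_embs L"
  shows "(\<lambda>x. if x \<in> F then \<tau> x else 0) \<in> field_embs F"
  using assms by (auto simp: field_embs_def subfield_C_def subset_iff)

text \<open>Products of generators generate the top field. The extensions of \<sigma> to M are
  grouped by their restriction to L: there are r restrictions with s extensions each.\<close>

lemma finite_extension_trans:
  assumes F: "subfield_C F" and L: "subfield_C L"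
    and FL: "finite_extension F L r" and LM: "finite_extension L M s"
  shows "finite_extension F M (r * s)"
proof -
  obtain B where B: "finite B" "card B \<le> r" "L \<subseteq> span_over F B" and r: "r > 0" "F \<subseteq> L"
    and ext: "\<And>\<sigma>. \<sigma> \<in> field_embs F \<Longrightarrow> card {\<tau> \<in> field_embs L. \<forall>x\<in>F. \<tau> x = \<sigma> x} = r"
    using FL by (auto simp: finite_extension_def)
  obtain C where C: "finite C" "card C \<le> s" "M \<subseteq> span_over L C" and s: "s > 0" "L \<subseteq> M"
    and ext': "\<And>\<sigma>. \<sigma> \<in> field_embs L \<Longrightarrow> card {\<tau> \<in> field_embs M. \<forall>x\<in>L. \<tau> x = \<sigma> x} = s"
    using LM by (auto simp: finite_extension_def)
  have R: "subring_C F" by (rule subfield_imp_subring[OF F])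
  have "span_over L C \<subseteq> span_over F (B * C)"
  proof (rule span_closed_subset)
    fix a c assume "a \<in> L" "c \<in> C"
    then show "a * c \<in> span_over F (B * C)" using B(3) by (intro span_mult[OF R]) (auto intro: span_base[OF R])
  qed (auto intro: span_over.zero span_add)
  with C(3) have "M \<subseteq> span_over F (B * C)" by (rule subset_trans)
  moreover have "card (B * C) \<le> card B * card C"
    unfolding set_times_image card_cartesian_product[symmetric]
    using B(1) C(1) by (intro card_image_le finite_cartesian_product)
  then have "card (B * C) \<le> r * s" using mult_le_mono[OF B(2) C(2)] by linarith
  moreover have "finite (B * C)" using B(1) C(1) by (rule finite_set_times)
  moreover have "card {\<tau> \<in> field_embs M. \<forall>x\<in>F. \<tau> x = \<sigma> x} = r * s" if \<sigma>: "\<sigma> \<in> field_embs F" for \<sigma>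
  proof -
    let ?E = "{\<tau> \<in> field_embs L. \<forall>x\<in>F. \<tau> x = \<sigma> x}" and ?X = "\<lambda>\<tau>. {\<omega> \<in> field_embs M. \<forall>x\<in>L. \<omega> x = \<tau> x}"
    have fE: "finite ?E" using card_ge_0_finite[of ?E] ext[OF \<sigma>] r(1) by simp
    have fX: "finite (?X \<tau>)" if "\<tau> \<in> ?E" for \<tau>
    proof -
      have "card (?X \<tau>) = s" using that by (intro ext') simp
      then show ?thesis using s(1) card_ge_0_finite[of "?X \<tau>"] by simp
    qed
    have "{\<tau> \<in> field_embs M. \<forall>x\<in>F. \<tau> x = \<sigma> x} = (\<Union>\<tau>\<in>?E. ?X \<tau>)"
    proof (intro equalityI subsetI)
      fix \<omega> assume \<omega>: "\<omega> \<in> {\<tau> \<in> field_embs M. \<forall>x\<in>F. \<tau> x = \<sigma> x}"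
      let ?\<tau> = "\<lambda>x. if x \<in> L then \<omega> x else 0"
      have "?\<tau> \<in> field_embs L" using emb_restrict[OF s(2) L] \<omega> by blast
      then have "?\<tau> \<in> ?E" using \<omega> r(2) by auto
      moreover have "\<omega> \<in> ?X ?\<tau>" using \<omega> by simp
      ultimately show "\<omega> \<in> (\<Union>\<tau>\<in>?E. ?X \<tau>)" by blast
    next
      fix \<omega> assume "\<omega> \<in> (\<Union>\<tau>\<in>?E. ?X \<tau>)"
      then show "\<omega> \<in> {\<tau> \<in> field_embs M. \<forall>x\<in>F. \<tau> x = \<sigma> x}" using r(2) by (auto simp: subset_iff)
    qed
    moreover have "\<forall>\<tau>\<in>?E. \<forall>\<tau>'\<in>?E. \<tau> \<noteq> \<tau>' \<longrightarrow> ?X \<tau> \<inter> ?X \<tau>' = {}"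
    proof (intro ballI impI)
      fix \<tau> \<tau>' assume *: "\<tau> \<in> ?E" "\<tau>' \<in> ?E" "\<tau> \<noteq> \<tau>'"
      then obtain x where x: "\<tau> x \<noteq> \<tau>' x" by blast
      \<comment> \<open>Embeddings are 0 outside their field, so distinct ones must differ at a
        point of L.\<close>
      then have "x \<in> L" using * by (auto simp: field_embs_def)
      then show "?X \<tau> \<inter> ?X \<tau>' = {}" using x by auto
    qed
    ultimately have "card {\<tau> \<in> field_embs M. \<forall>x\<in>F. \<tau> x = \<sigma> x} = (\<Sum>\<tau>\<in>?E. card (?X \<tau>))"
      using card_UN_disjoint[of ?E ?X] fE fX by simp
    also have "\<dots> = (\<Sum>\<tau>\<in>?E. s)" by (intro sum.cong refl ext') simp
    also have "\<dots> = r * s" using ext[OF \<sigma>] by simp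
    finally show ?thesis .
  qed
  moreover have "F \<subseteq> M" using r(2) s(2) by (rule subset_trans)
  moreover have "r * s > 0" using r(1) s(1) by simp
  ultimately show ?thesis unfolding finite_extension_def by (intro conjI exI[of _ "B * C"] ballI)
qed

lemma finite_extension_refl:
  assumes F: "subfield_C F" shows "finite_extension F F 1"
proof -
  have "F \<subseteq> span_over F {1}" using span_scale_base[of _ F 1 "{1}"] by auto
  moreover have "{\<tau> \<in> field_embs F. \<forall>x\<in>F. \<tau> x = \<sigma> x} = {\<sigma>}" if \<sigma>: "\<sigma> \<in> field_embs F" for \<sigma>
  proof -
    have "\<tau> = \<sigma>" if \<tau>: "\<tau> \<in> field_embs F" "\<forall>x\<in>F. \<tau> x = \<sigma> x" for \<tau>
    proof
      fix x show "\<tau> x = \<sigma> x" using \<tau> \<sigma> by (cases "x \<in> F") (auto simp: field_embs_def)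
    qed
    then show ?thesis using \<sigma> by auto
  qed
  ultimately show ?thesis unfolding finite_extension_def
    by (auto intro!: exI[of _ "{1}"])
qed

lemma algebraic_poly_over:
  assumes F: "subfield_C F" and x: "algebraic x"
  obtains p where "poly_over F p" "p \<noteq> 0" "poly p x = 0"
proof -
  obtain p where p: "\<forall>i. poly.coeff p i \<in> \<int>" "p \<noteq> 0" "poly p x = 0"
    using x by (auto simp: algebraic_def)
  have "poly_over F p" unfolding poly_over_def
    using p(1) subring_C_of_int[OF subfield_imp_subring[OF F]] by (metis Ints_cases)
  then show thesis using that p by blast
qed

lemma finite_extension_gen_field:
  assumes F: "subfield_C F" and S: "finite S" "\<And>s. s \<in> S \<Longrightarrow> algebraic s"
  shows "\<exists>r. finite_extension F (gen_field (F \<union> S)) r"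
  using S
proof (induction S rule: finite_induct)
  case empty
  have "gen_field (F \<union> {}) = F" using gen_field_superset[of F] gen_field_least[OF F, of F] by auto
  then show ?case using finite_extension_refl[OF F] by auto
next
  case (insert a S)
  let ?L = "gen_field (F \<union> S)"
  obtain r where r: "finite_extension F ?L r" using insert by auto
  obtain p where "poly_over ?L p" "p \<noteq> 0" "poly p a = 0"
    using algebraic_poly_over[OF gen_field_subfield, of a] insert.prems by blast
  then obtain s where s: "finite_extension ?L (gen_field (?L \<union> {a})) s"
    using simple_extension[OF gen_field_subfield] by blast
  have "gen_field (?L \<union> {a}) = gen_field (F \<union> insert a S)"
  proof
    have 1: "F \<union> S \<subseteq> gen_field (F \<union> insert a S)" "a \<in> gen_field (F \<union> insert a S)"
      using gen_field_superset[of "F \<union> insert a S"] by auto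
    have "?L \<subseteq> gen_field (F \<union> insert a S)"
      by (rule gen_field_least[OF gen_field_subfield 1(1)])
    then show "gen_field (?L \<union> {a}) \<subseteq> gen_field (F \<union> insert a S)"
      using 1(2) by (intro gen_field_least gen_field_subfield) auto
    have "F \<union> S \<subseteq> gen_field (?L \<union> {a})" "a \<in> gen_field (?L \<union> {a})"
      using gen_field_superset[of "?L \<union> {a}"] gen_field_superset[of "F \<union> S"] by auto
    then show "gen_field (F \<union> insert a S) \<subseteq> gen_field (?L \<union> {a})"
      by (intro gen_field_least gen_field_subfield) auto
  qed
  then show ?case using finite_extension_trans[OF F gen_field_subfield r s] by auto
qed

lemma finite_extension_dim_le: "subfield_C F \<Longrightarrow> finite_extension F L r \<Longrightarrow> dim_le F L r"
  unfolding finite_extension_def by (blast intro: dim_le_span)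

lemma field_embs_Rats: "field_embs \<rat> = {\<lambda>x. if x \<in> \<rat> then x else 0}"
proof -
  note Q = subfield_C_Rats
  have "\<sigma> x = x" if \<sigma>: "\<sigma> \<in> field_embs \<rat>" and x: "x \<in> \<rat>" for \<sigma> x
  proof -
    obtain a b where x': "x = of_int a / of_int b" "b > 0" using x by (auto elim: Rats_cases')
    have int: "\<sigma> (of_int k) = of_int k" for k
      by (cases k rule: int_cases2) (auto simp: emb_of_nat[OF Q \<sigma>] emb_uminus[OF Q \<sigma>])
    have "\<sigma> x * of_int b = \<sigma> (x * of_int b)" using x by (simp add: emb_mult[OF Q \<sigma>] int)
    also have "\<dots> = x * of_int b" using x' int by simp
    finally show ?thesis using x'(2) by (subst (asm) mult_cancel_right) simp
  qed
  moreover have "(\<lambda>x. if x \<in> \<rat> then x else 0) \<in> field_embs \<rat>" by (auto simp: field_embs_def)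
  moreover have "\<sigma> x = 0" if "\<sigma> \<in> field_embs \<rat>" "x \<notin> \<rat>" for \<sigma> x using that by (auto simp: field_embs_def)
  ultimately show ?thesis by (intro equalityI subsetI) (auto intro!: ext)
qed

text \<open>The rationals have a single embedding, and every embedding of the generated field
  extends it. Hence the degree r is the number of embeddings, by which \<open>weil_height\<close>
  divides.\<close>

lemma gen_field_finite_over_Rats:
  assumes S: "finite S" "\<And>s. s \<in> S \<Longrightarrow> algebraic s"
  obtains r where "finite_extension \<rat> (gen_field S) r" "card (field_embs (gen_field S)) = r" "r > 0"
proof -
  note Q = subfield_C_Rats
  have "\<rat> \<union> S \<subseteq> gen_field S" "S \<subseteq> gen_field (\<rat> \<union> S)"
    using Rats_subset_subfield[OF gen_field_subfield[of S]] gen_field_superset[of S] gen_field_superset[of "\<rat> \<union> S"] by auto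
  then have "gen_field (\<rat> \<union> S) = gen_field S"
    by (intro equalityI gen_field_least gen_field_subfield)
  then obtain r where r: "finite_extension \<rat> (gen_field S) r"
    using finite_extension_gen_field[OF Q S] by auto
  let ?id = "\<lambda>x. if x \<in> \<rat> then x else (0::complex)"
  have "{\<tau> \<in> field_embs (gen_field S). \<forall>x\<in>\<rat>. \<tau> x = ?id x} = field_embs (gen_field S)"
  proof -
    have "\<tau> x = x" if \<tau>: "\<tau> \<in> field_embs (gen_field S)" and x: "x \<in> \<rat>" for \<tau> x
    proof -
      have "(\<lambda>x. if x \<in> \<rat> then \<tau> x else 0) \<in> field_embs \<rat>"
        using emb_restrict[OF Rats_subset_subfield[OF gen_field_subfield] Q \<tau>] .
      then have "(\<lambda>x. if x \<in> \<rat> then \<tau> x else 0) = ?id" by (simp add: field_embs_Rats)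
      then show ?thesis using x by metis
    qed
    then show ?thesis by auto
  qed
  then have "card (field_embs (gen_field S)) = r"
    using r unfolding finite_extension_def by (simp add: field_embs_Rats)
  then show thesis using that r by (auto simp: finite_extension_def)
qed

lemma gen_field_algebraic:
  assumes S: "finite S" "\<And>s. s \<in> S \<Longrightarrow> algebraic s" and x: "x \<in> gen_field S"
  shows "algebraic x"
proof -
  note Q = subfield_C_Rats
  obtain r where "finite_extension \<rat> (gen_field S) r" using gen_field_finite_over_Rats[OF S] by blast
  then have "dim_le \<rat> (gen_field S) r" by (rule finite_extension_dim_le[OF Q])
  then obtain p where p: "p \<noteq> 0" "poly_over \<rat> p" "poly p x = 0"
    using algebraic_over_of_dim_le[OF Q subfield_imp_subring[OF gen_field_subfield]] x by blast
  then show ?thesis by (auto simp: algebraic_altdef poly_over_def)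
qed

section \<open>Heights over a fixed field\<close>

lemma gen_field_number_field:
  assumes "finite S" "\<And>s. s \<in> S \<Longrightarrow> algebraic s"
  shows "number_field (gen_field S)"
proof
  show "subfield_C (gen_field S)" by (rule gen_field_subfield)
  show "algebraic x" if "x \<in> gen_field S" for x using gen_field_algebraic[OF assms that] .
  obtain r where "finite_extension \<rat> (gen_field S) r" using gen_field_finite_over_Rats[OF assms] by blast
  then show "\<exists>r. dim_le \<rat> (gen_field S) r" using finite_extension_dim_le[OF subfield_C_Rats] by blast
qed

definition coord_set :: "nat \<Rightarrow> (nat \<Rightarrow> complex) \<Rightarrow> complex set" where
  "coord_set n x = insert 1 (x ` {..<n})"

definition arch_max :: "nat \<Rightarrow> (complex \<Rightarrow> complex) \<Rightarrow> (nat \<Rightarrow> complex) \<Rightarrow> real" where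
  "arch_max n \<sigma> x = Max (insert 1 ((\<lambda>i. cmod (\<sigma> (x i))) ` {..<n}))"

text \<open>The height before division by the degree, over a field K that may be larger than the one
  generated by the coordinates, so that different points share one field.\<close>

definition field_height :: "complex set \<Rightarrow> nat \<Rightarrow> (nat \<Rightarrow> complex) \<Rightarrow> real" where
  "field_height K n x = (\<Sum>\<sigma>\<in>field_embs K. ln (arch_max n \<sigma> x)) +
     ln (real (idx (span_over (ints_of K) (coord_set n x)) (ints_of K)))"

lemma finite_coord_set: "finite (coord_set n x)"
  by (simp add: coord_set_def)

lemma one_in_coord_set: "1 \<in> coord_set n x"
  by (simp add: coord_set_def)

lemma arch_max_ge_one: "1 \<le> arch_max n \<sigma> x"
  by (simp add: arch_max_def)

lemma arch_max_ge: "i < n \<Longrightarrow> cmod (\<sigma> (x i)) \<le> arch_max n \<sigma> x"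
  by (auto simp: arch_max_def)

lemma arch_max_le: "1 \<le> c \<Longrightarrow> (\<And>i. i < n \<Longrightarrow> cmod (\<sigma> (x i)) \<le> c) \<Longrightarrow> arch_max n \<sigma> x \<le> c"
  by (auto simp: arch_max_def)

lemma span_coord_set:
  assumes R: "subring_C R"
  shows "{a0 + (\<Sum>i<n. a i * x i) | a0 a. a0 \<in> R \<and> (\<forall>i<n. a i \<in> R)} = span_over R (coord_set n x)" (is "?I = _")
proof (intro equalityI subsetI)
  fix y assume "y \<in> ?I"
  then obtain a0 a where y: "y = a0 * 1 + (\<Sum>i<n. a i * x i)" "a0 \<in> R" "\<forall>i<n. a i \<in> R" by auto
  show "y \<in> span_over R (coord_set n x)"
    unfolding y(1) using y(2,3) by (intro span_add span_sum span_scale_base) (auto simp: coord_set_def)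
next
  have R0: "0 \<in> R" and Radd: "\<And>a b. a \<in> R \<Longrightarrow> b \<in> R \<Longrightarrow> a + b \<in> R" using R by (auto simp: subring_C_def)
  have "span_over R (coord_set n x) \<subseteq> ?I"
  proof (rule span_closed_subset)
    show "0 \<in> ?I" using R0 by (intro CollectI exI[of _ 0] exI[of _ "\<lambda>_. 0"]) auto
    fix y z assume "y \<in> ?I" "z \<in> ?I"
    then obtain a0 a b0 b where ab: "y = a0 + (\<Sum>i<n. a i * x i)" "a0 \<in> R" "\<forall>i<n. a i \<in> R"
      "z = b0 + (\<Sum>i<n. b i * x i)" "b0 \<in> R" "\<forall>i<n. b i \<in> R" by auto
    have "y + z = (a0 + b0) + (\<Sum>i<n. (a i + b i) * x i)" by (simp add: ab distrib_right sum.distrib)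
    then show "y + z \<in> ?I" using ab Radd
      by (intro CollectI exI[of _ "a0 + b0"] exI[of _ "\<lambda>i. a i + b i"]) auto
  next
    fix a s assume a: "a \<in> R" and "s \<in> coord_set n x"
    then consider "s = 1" | i where "i < n" "s = x i" by (auto simp: coord_set_def)
    then show "a * s \<in> ?I"
    proof cases
      case 1
      then show ?thesis using a R0 by (intro CollectI exI[of _ a] exI[of _ "\<lambda>_. 0"]) auto
    next
      case (2 i)
      have "(\<Sum>j<n. (if j = i then a else 0) * x j) = (\<Sum>j<n. if j = i then a * x j else 0)"
        by (intro sum.cong) auto
      also have "\<dots> = a * x i" using 2 by simp
      finally show ?thesis using a R0 2
        by (intro CollectI exI[of _ 0] exI[of _ "\<lambda>j. if j = i then a else 0"]) auto
    qed
  qed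
  then show "y \<in> ?I" if "y \<in> span_over R (coord_set n x)" for y using that by blast
qed

lemma weil_height_field_height:
  "weil_height (vec n x) = field_height (gen_field (x ` {..<n})) n x / real (card (field_embs (gen_field (x ` {..<n}))))"
proof -
  let ?K = "gen_field (x ` {..<n})"
  have gen: "{vec n x $ i |i. i < n} = x ` {..<n}" by force
  have mx: "{cmod (\<sigma> (vec n x $ i)) |i. i < n} = (\<lambda>i. cmod (\<sigma> (x i))) ` {..<n}" for \<sigma> by force
  have sp: "{a0 + (\<Sum>i<n. a i * vec n x $ i) |a0 a. a0 \<in> ints_of ?K \<and> (\<forall>i<n. a i \<in> ints_of ?K)}
      = span_over (ints_of ?K) (coord_set n x)"
    using span_coord_set[OF subring_ints_of[OF gen_field_subfield[of "x ` {..<n}"]], where n=n and x=x] by simp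
  show ?thesis
    unfolding weil_height_def Let_def dim_vec gen mx sp field_height_def arch_max_def idx_def quot_def ..
qed

text \<open>The embeddings of K are grouped by their restriction to F, and every group has r
  members.\<close>

lemma sum_embs_extension:
  assumes F: "subfield_C F" and K: "finite_extension F K r" and fin: "finite (field_embs F)" "finite (field_embs K)"
  shows "(\<Sum>\<tau>\<in>field_embs K. g (\<lambda>x. if x \<in> F then \<tau> x else 0)) = real r * (\<Sum>\<sigma>\<in>field_embs F. g \<sigma> :: real)"
proof -
  have FK: "F \<subseteq> K" using K by (simp add: finite_extension_def)
  let ?\<rho> = "\<lambda>\<tau> x. if x \<in> F then \<tau> x else (0::complex)"
  have fib: "{\<tau> \<in> field_embs K. ?\<rho> \<tau> = \<sigma>} = {\<tau> \<in> field_embs K. \<forall>x\<in>F. \<tau> x = \<sigma> x}" if "\<sigma> \<in> field_embs F" for \<sigma>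
  proof -
    have "?\<rho> \<tau> = \<sigma> \<longleftrightarrow> (\<forall>x\<in>F. \<tau> x = \<sigma> x)" for \<tau>
    proof
      assume "?\<rho> \<tau> = \<sigma>" then show "\<forall>x\<in>F. \<tau> x = \<sigma> x" by auto
    next
      assume "\<forall>x\<in>F. \<tau> x = \<sigma> x" then show "?\<rho> \<tau> = \<sigma>" using that by (intro ext) (auto simp: field_embs_def)
    qed
    then show ?thesis by blast
  qed
  have "(\<Sum>\<tau>\<in>field_embs K. g (?\<rho> \<tau>)) = (\<Sum>\<sigma>\<in>field_embs F. \<Sum>\<tau>\<in>{\<tau> \<in> field_embs K. ?\<rho> \<tau> = \<sigma>}. g (?\<rho> \<tau>))"
    using emb_restrict[OF FK F] by (intro sum.group[symmetric] fin) auto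
  also have "\<dots> = (\<Sum>\<sigma>\<in>field_embs F. real r * g \<sigma>)"
  proof (rule sum.cong[OF refl])
    fix \<sigma> assume \<sigma>: "\<sigma> \<in> field_embs F"
    have "(\<Sum>\<tau>\<in>{\<tau> \<in> field_embs K. ?\<rho> \<tau> = \<sigma>}. g (?\<rho> \<tau>)) = (\<Sum>\<tau>\<in>{\<tau> \<in> field_embs K. ?\<rho> \<tau> = \<sigma>}. g \<sigma>)"
      by (intro sum.cong) auto
    also have "\<dots> = real (card {\<tau> \<in> field_embs K. ?\<rho> \<tau> = \<sigma>}) * g \<sigma>" by simp
    also have "card {\<tau> \<in> field_embs K. ?\<rho> \<tau> = \<sigma>} = r"
      unfolding fib[OF \<sigma>] using K \<sigma> unfolding finite_extension_def by blast
    finally show "(\<Sum>\<tau>\<in>{\<tau> \<in> field_embs K. ?\<rho> \<tau> = \<sigma>}. g (?\<rho> \<tau>)) = real r * g \<sigma>" .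
  qed
  finally show ?thesis by (simp add: sum_distrib_left)
qed

section \<open>Inequalities for the height over a fixed number field\<close>

locale generated_number_field =
  fixes gens :: "complex set"
  assumes fin_gens: "finite gens" and alg_gens: "\<And>s. s \<in> gens \<Longrightarrow> algebraic s"
begin

definition K where "K = gen_field gens"

sublocale number_field K
  unfolding K_def by (rule gen_field_number_field[OF fin_gens alg_gens])

definition degree_K where "degree_K = card (field_embs K)"

lemma degree_K_pos: "degree_K > 0" and finite_embs: "finite (field_embs K)"
proof -
  obtain r where "card (field_embs K) = r" "r > 0"
    using gen_field_finite_over_Rats[OF fin_gens alg_gens] unfolding K_def by metis
  then show "degree_K > 0" "finite (field_embs K)"
    unfolding degree_K_def using card_ge_0_finite[of "field_embs K"] by auto
qed

abbreviation H where "H \<equiv> field_height K"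

lemma field_height_ideal_index:
  "H n x = (\<Sum>\<sigma>\<in>field_embs K. ln (arch_max n \<sigma> x)) + ln (real (ideal_index (coord_set n x)))"
  by (simp add: field_height_def ideal_index_def)

lemma coord_set_in_field: "(\<And>i. i < n \<Longrightarrow> x i \<in> K) \<Longrightarrow> coord_set n x \<subseteq> K"
  using F by (auto simp: coord_set_def subfield_C_def)

lemma ideal_index_coord_pos: "(\<And>i. i < n \<Longrightarrow> x i \<in> K) \<Longrightarrow> ideal_index (coord_set n x) > 0"
  by (intro ideal_index_pos finite_coord_set one_in_coord_set coord_set_in_field)

text \<open>Passing from the field of the coordinates to K multiplies the archimedean part by
  exactly the relative degree, and the finite part by at most that degree, because
  \<open>idx_extension\<close> bounds the index from above.\<close>

lemma field_height_le_weil_height: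
  assumes x: "\<And>i. i < n \<Longrightarrow> x i \<in> K"
  shows "H n x / degree_K \<le> weil_height (vec n x)"
proof -
  let ?X = "x ` {..<n}"
  let ?F = "gen_field ?X"
  have X: "finite ?X" "\<And>s. s \<in> ?X \<Longrightarrow> algebraic s" using x alg by auto
  interpret F: number_field ?F by (rule gen_field_number_field[OF X])
  have FK: "?F \<subseteq> K" using x by (intro gen_field_least F) auto
  \<comment> \<open>Adjoining the finitely many algebraic generators of K to the smaller field shows
    that K is a finite extension of it.\<close>
  have "K = gen_field (?F \<union> gens)"
  proof
    show "K \<subseteq> gen_field (?F \<union> gens)"
      unfolding K_def using gen_field_superset[of "?F \<union> gens"] by (intro gen_field_least gen_field_subfield) auto
    show "gen_field (?F \<union> gens) \<subseteq> K"
      using FK gen_field_superset[of gens] by (intro gen_field_least F) (auto simp: K_def)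
  qed
  then obtain r where r: "finite_extension ?F K r"
    using finite_extension_gen_field[OF F.F fin_gens alg_gens] by auto
  then have r0: "r > 0" by (simp add: finite_extension_def)
  obtain d where d: "card (field_embs ?F) = d" "d > 0" using gen_field_finite_over_Rats[OF X] by metis
  then have finF: "finite (field_embs ?F)" using card_ge_0_finite by metis
  have deg: "real degree_K = real r * real d"
    using sum_embs_extension[OF F.F r finF finite_embs, of "\<lambda>_. 1"] d by (simp add: degree_K_def)
  have arch: "(\<Sum>\<tau>\<in>field_embs K. ln (arch_max n \<tau> x)) = real r * (\<Sum>\<sigma>\<in>field_embs ?F. ln (arch_max n \<sigma> x))"
  proof -
    have "arch_max n \<tau> x = arch_max n (\<lambda>y. if y \<in> ?F then \<tau> y else 0) x" for \<tau>
    proof -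
      have "(\<lambda>i. cmod (\<tau> (x i))) ` {..<n} = (\<lambda>i. cmod (if x i \<in> ?F then \<tau> (x i) else 0)) ` {..<n}"
        using gen_field_superset[of ?X] by (intro image_cong) auto
      then show ?thesis by (simp add: arch_max_def)
    qed
    then show ?thesis using sum_embs_extension[OF F.F r finF finite_embs, of "\<lambda>\<sigma>. ln (arch_max n \<sigma> x)"] by simp
  qed
  have cF: "coord_set n x \<subseteq> ?F"
    using gen_field_superset[of ?X] F.F by (auto simp: coord_set_def subfield_C_def)
  have "finite (quot (F.\<I> (coord_set n x)) (ints_of ?F))"
    by (rule F.finite_quot_span[OF finite_coord_set cF one_in_coord_set])
  then have "ideal_index (coord_set n x) \<le> F.ideal_index (coord_set n x) ^ r"
    using idx_extension[OF F.algebraic_field_axioms algebraic_field_axioms FK finite_extension_dim_le[OF F.F r] one_in_coord_set]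
    by (simp add: ideal_index_def F.ideal_index_def)
  then have "real (ideal_index (coord_set n x)) \<le> real (F.ideal_index (coord_set n x)) ^ r"
    by (simp flip: of_nat_power)
  moreover have "0 < real (ideal_index (coord_set n x))" using ideal_index_coord_pos[of n x] x by simp
  ultimately have "ln (real (ideal_index (coord_set n x))) \<le> ln (real (F.ideal_index (coord_set n x)) ^ r)"
    by (rule ln_mono)
  also have "\<dots> = real r * ln (real (F.ideal_index (coord_set n x)))"
    using F.ideal_index_pos[OF finite_coord_set cF one_in_coord_set] by (simp add: ln_realpow)
  finally have "H n x \<le> real r * field_height ?F n x"
    unfolding field_height_def arch ideal_index_def F.ideal_index_def by (simp add: distrib_left)
  then have "H n x / degree_K \<le> (real r * field_height ?F n x) / (real r * real d)"
    unfolding deg by (intro divide_right_mono) auto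
  also have "\<dots> = weil_height (vec n x)"
    using r0 d by (simp add: weil_height_field_height)
  finally show ?thesis .
qed

lemma field_height_nonneg:
  assumes "\<And>i. i < n \<Longrightarrow> x i \<in> K"
  shows "0 \<le> H n x"
  unfolding field_height_ideal_index using arch_max_ge_one ideal_index_coord_pos[OF assms]
  by (intro add_nonneg_nonneg sum_nonneg ln_ge_zero) (auto simp: Suc_leI)

lemma field_height_one: "H n (\<lambda>_. 1) = 0"
proof -
  have "coord_set n (\<lambda>_. 1) = {1}" by (auto simp: coord_set_def)
  moreover have "ideal_index {1} = 1"
  proof -
    have "ideal_index {1} \<le> card {0::complex}" unfolding ideal_index_def span_one
      by (rule idx_le_card(2)[OF O_additive]) auto
    then show ?thesis using ideal_index_pos[of "{1}"] F by (simp add: subfield_C_def)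
  qed
  moreover have "arch_max n \<sigma> (\<lambda>_. 1) = 1" if "\<sigma> \<in> field_embs K" for \<sigma>
    using emb_one[OF F that] by (intro antisym arch_max_ge_one arch_max_le) auto
  ultimately show ?thesis by (simp add: field_height_ideal_index)
qed

text \<open>At each embedding the maximum is submultiplicative. For the finite part, the new
  coordinates lie in the product of the two coordinate sets, whose index is
  submultiplicative.\<close>

lemma field_height_mult_le:
  assumes x: "\<And>i. i < n \<Longrightarrow> x i \<in> K" and y: "\<And>i. i < n \<Longrightarrow> y i \<in> K"
  shows "H n (\<lambda>i. x i * y i) \<le> H n x + H n y"
proof -
  have "ln (arch_max n \<sigma> (\<lambda>i. x i * y i)) \<le> ln (arch_max n \<sigma> x) + ln (arch_max n \<sigma> y)"
    if \<sigma>: "\<sigma> \<in> field_embs K" for \<sigma>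
  proof -
    note one = arch_max_ge_one[of n \<sigma>]
    have "1 * 1 \<le> arch_max n \<sigma> x * arch_max n \<sigma> y" using one[of x] one[of y] by (intro mult_mono) auto
    then have "arch_max n \<sigma> (\<lambda>i. x i * y i) \<le> arch_max n \<sigma> x * arch_max n \<sigma> y"
    proof (intro arch_max_le)
      fix i assume i: "i < n"
      have "cmod (\<sigma> (x i)) * cmod (\<sigma> (y i)) \<le> arch_max n \<sigma> x * arch_max n \<sigma> y"
        using one[of x] i by (intro mult_mono arch_max_ge) auto
      then show "cmod (\<sigma> (x i * y i)) \<le> arch_max n \<sigma> x * arch_max n \<sigma> y"
        using emb_mult[OF F \<sigma> x[OF i] y[OF i]] by (simp add: norm_mult)
    qed simp
    moreover have "ln (arch_max n \<sigma> x * arch_max n \<sigma> y) = ln (arch_max n \<sigma> x) + ln (arch_max n \<sigma> y)"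
      using one[of x] one[of y] by (simp add: ln_mult)
    moreover have "0 < arch_max n \<sigma> (\<lambda>i. x i * y i)" using one[of "\<lambda>i. x i * y i"] by linarith
    ultimately show ?thesis by (metis ln_mono)
  qed
  then have arch: "(\<Sum>\<sigma>\<in>field_embs K. ln (arch_max n \<sigma> (\<lambda>i. x i * y i))) \<le>
      (\<Sum>\<sigma>\<in>field_embs K. ln (arch_max n \<sigma> x)) + (\<Sum>\<sigma>\<in>field_embs K. ln (arch_max n \<sigma> y))"
    unfolding sum.distrib[symmetric] by (rule sum_mono)
  let ?X = "coord_set n x" and ?Y = "coord_set n y" and ?Z = "coord_set n (\<lambda>i. x i * y i)"
  have X: "finite ?X" "?X \<subseteq> K" "1 \<in> ?X" and Y: "finite ?Y" "?Y \<subseteq> K" "1 \<in> ?Y"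
    using x y by (auto intro: finite_coord_set one_in_coord_set dest!: coord_set_in_field[THEN subsetD, rotated])
  have "?Z \<subseteq> ?X * ?Y"
  proof
    fix z assume "z \<in> ?Z"
    then consider "z = 1 * 1" | i where "i < n" "z = x i * y i" by (auto simp: coord_set_def)
    then show "z \<in> ?X * ?Y"
    proof cases
      case 1
      then show ?thesis using set_times_intro[OF X(3) Y(3)] by metis
    next
      case (2 i)
      then have "x i \<in> ?X" "y i \<in> ?Y" by (auto simp: coord_set_def)
      then show ?thesis using 2 by auto
    qed
  qed
  moreover have one: "1 \<in> ?X * ?Y" using set_times_intro[OF X(3) Y(3)] by simp
  ultimately have "ideal_index ?Z \<le> ideal_index (?X * ?Y)"
    using X Y by (intro ideal_index_mono finite_set_times set_times_in_field span_subset_mono one_in_coord_set)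
  also have "\<dots> \<le> ideal_index ?X * ideal_index ?Y" by (rule ideal_index_times_le[OF X Y])
  finally have "real (ideal_index ?Z) \<le> real (ideal_index ?X) * real (ideal_index ?Y)"
    by (simp flip: of_nat_mult)
  moreover have "ideal_index ?Z > 0" by (rule ideal_index_coord_pos) (use x y F_mult in auto)
  ultimately have "ln (real (ideal_index ?Z)) \<le> ln (real (ideal_index ?X) * real (ideal_index ?Y))"
    by (intro ln_mono) auto
  also have "\<dots> = ln (real (ideal_index ?X)) + ln (real (ideal_index ?Y))"
    using ideal_index_pos[OF X] ideal_index_pos[OF Y] by (simp add: ln_mult)
  finally show ?thesis using arch unfolding field_height_ideal_index by linarith
qed

text \<open>The maximum at an embedding is attained at 1 or at a coordinate, and the m-th power of
  either occurs on the right. The finite part is the bound for powers of generators.\<close>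

lemma field_height_power_ge:
  assumes x: "\<And>i. i < n \<Longrightarrow> x i \<in> K"
  shows "real m * H n x \<le> H n (\<lambda>i. x i ^ m)"
proof -
  have "real m * ln (arch_max n \<sigma> x) \<le> ln (arch_max n \<sigma> (\<lambda>i. x i ^ m))" if \<sigma>: "\<sigma> \<in> field_embs K" for \<sigma>
  proof -
    have "arch_max n \<sigma> x \<in> insert 1 ((\<lambda>i. cmod (\<sigma> (x i))) ` {..<n})"
      unfolding arch_max_def by (rule Max_in) auto
    then consider "arch_max n \<sigma> x = 1" | i where "i < n" "arch_max n \<sigma> x = cmod (\<sigma> (x i))" by auto
    then have "arch_max n \<sigma> x ^ m \<le> arch_max n \<sigma> (\<lambda>i. x i ^ m)"
    proof cases
      case 1
      then show ?thesis by (simp add: arch_max_ge_one)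
    next
      case (2 i)
      then have "arch_max n \<sigma> x ^ m = cmod (\<sigma> (x i ^ m))"
        using emb_power[OF F \<sigma> x] by (simp add: norm_power)
      then show ?thesis using arch_max_ge[of i n \<sigma> "\<lambda>i. x i ^ m"] 2 by simp
    qed
    moreover have "arch_max n \<sigma> x > 0" using arch_max_ge_one[of n \<sigma> x] by linarith
    ultimately show ?thesis by (metis ln_mono ln_realpow zero_less_power)
  qed
  then have arch: "real m * (\<Sum>\<sigma>\<in>field_embs K. ln (arch_max n \<sigma> x)) \<le>
      (\<Sum>\<sigma>\<in>field_embs K. ln (arch_max n \<sigma> (\<lambda>i. x i ^ m)))"
    unfolding sum_distrib_left by (rule sum_mono)
  have "(\<lambda>s. s ^ m) ` coord_set n x = coord_set n (\<lambda>i. x i ^ m)"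
    by (auto simp: coord_set_def image_image)
  then have "ideal_index (coord_set n x) ^ m \<le> ideal_index (coord_set n (\<lambda>i. x i ^ m))"
    using ideal_index_power_ge[of "coord_set n x" m] coord_set_in_field[of n x] x
    by (simp add: finite_coord_set one_in_coord_set)
  then have "real (ideal_index (coord_set n x)) ^ m \<le> real (ideal_index (coord_set n (\<lambda>i. x i ^ m)))"
    by (simp flip: of_nat_power)
  then have "real m * ln (real (ideal_index (coord_set n x))) \<le> ln (real (ideal_index (coord_set n (\<lambda>i. x i ^ m))))"
    using ideal_index_coord_pos[of n x] x by (metis ln_mono ln_realpow of_nat_0_less_iff zero_less_power)
  then show ?thesis using arch unfolding field_height_ideal_index by (simp add: distrib_left)
qed

end

section \<open>Subadditive functions on integer matrices\<close>

text \<open>Matrices are functions of two indices, and \<open>w_cong\<close> restricts attention to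
  the N by N block. The intended \<open>w B\<close> is the height, over a fixed field, of the image
  of a fixed point under the monomial map with exponents B.\<close>

locale subadditive_matrix_function =
  fixes N :: nat and w :: "(nat \<Rightarrow> nat \<Rightarrow> int) \<Rightarrow> real"
  assumes w_cong: "\<And>B C. (\<And>i j. i < N \<Longrightarrow> j < N \<Longrightarrow> B i j = C i j) \<Longrightarrow> w B = w C"
    and w_nonneg: "\<And>B. 0 \<le> w B"
    and w_zero: "w (\<lambda>_ _. 0) = 0"
    and w_add: "\<And>B C. w (\<lambda>i j. B i j + C i j) \<le> w B + w C"
    and w_id: "\<And>m::nat. real m * w (\<lambda>i j. of_bool (i = j)) \<le> w (\<lambda>i j. int m * of_bool (i = j))"
begin

lemma w_multiple: "w (\<lambda>i j. int m * B i j) \<le> real m * w B"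
proof (induction m)
  case (Suc m)
  have "w (\<lambda>i j. int (Suc m) * B i j) = w (\<lambda>i j. int m * B i j + B i j)"
    by (intro w_cong) (simp add: algebra_simps)
  also have "\<dots> \<le> w (\<lambda>i j. int m * B i j) + w B" by (rule w_add)
  finally show ?case using Suc by (simp add: algebra_simps)
qed (simp add: w_zero)

lemma w_sum: "finite S \<Longrightarrow> w (\<lambda>i j. \<Sum>p\<in>S. f p i j) \<le> (\<Sum>p\<in>S. w (f p))"
proof (induction S rule: finite_induct)
  case (insert p S)
  have "w (\<lambda>i j. \<Sum>p\<in>insert p S. f p i j) = w (\<lambda>i j. f p i j + (\<Sum>p\<in>S. f p i j))"
    using insert by simp
  also have "\<dots> \<le> w (f p) + w (\<lambda>i j. \<Sum>p\<in>S. f p i j)" by (rule w_add)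
  finally show ?case using insert by simp
qed (simp add: w_zero)

definition unit_entry :: "nat \<times> nat \<Rightarrow> nat \<Rightarrow> nat \<Rightarrow> int" where
  "unit_entry p i j = of_bool (p = (i, j))"

text \<open>Both signs of each matrix unit enter because subadditivity gives no upper bound for
  w(-B) in terms of w(B).\<close>

definition entry_bound :: real where
  "entry_bound = (\<Sum>p\<in>{..<N} \<times> {..<N}. w (unit_entry p) + w (\<lambda>i j. - unit_entry p i j))"

lemma entry_bound_nonneg: "0 \<le> entry_bound"
  unfolding entry_bound_def by (intro sum_nonneg add_nonneg_nonneg w_nonneg)

text \<open>E is the sum of its entries times matrix units, and an entry e costs at most
  \<bar>e\<bar> times the value at the unit with the sign of e.\<close>

lemma w_le_entry_bound:
  assumes M: "\<And>i j. i < N \<Longrightarrow> j < N \<Longrightarrow> \<bar>real_of_int (E i j)\<bar> \<le> M"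
  shows "w E \<le> entry_bound * M"
proof -
  let ?S = "{..<N} \<times> {..<N}"
  define f where "f p i j = E (fst p) (snd p) * unit_entry p i j" for p i j
  have "w E = w (\<lambda>i j. \<Sum>p\<in>?S. f p i j)"
  proof (rule w_cong)
    fix i j assume ij: "i < N" "j < N"
    have "(\<Sum>p\<in>?S. f p i j) = (\<Sum>p\<in>?S. if p = (i, j) then E i j else 0)"
      by (intro sum.cong) (auto simp: f_def unit_entry_def)
    then show "E i j = (\<Sum>p\<in>?S. f p i j)" using ij by simp
  qed
  also have "\<dots> \<le> (\<Sum>p\<in>?S. w (f p))" by (rule w_sum) simp
  also have "\<dots> \<le> (\<Sum>p\<in>?S. (w (unit_entry p) + w (\<lambda>i j. - unit_entry p i j)) * M)"
  proof (rule sum_mono)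
    fix p assume p: "p \<in> ?S"
    let ?e = "E (fst p) (snd p)" and ?b = "w (unit_entry p) + w (\<lambda>i j. - unit_entry p i j)"
    have "w (f p) \<le> real (nat \<bar>?e\<bar>) * ?b"
    proof (cases "?e \<ge> 0")
      case True
      have "w (f p) = w (\<lambda>i j. int (nat \<bar>?e\<bar>) * unit_entry p i j)"
        using True by (intro w_cong) (simp add: f_def)
      also have "\<dots> \<le> real (nat \<bar>?e\<bar>) * w (unit_entry p)" by (rule w_multiple)
      also have "\<dots> \<le> real (nat \<bar>?e\<bar>) * ?b" by (intro mult_left_mono) (auto simp: w_nonneg)
      finally show ?thesis .
    next
      case False
      have "w (f p) = w (\<lambda>i j. int (nat \<bar>?e\<bar>) * (- unit_entry p i j))"
        using False by (intro w_cong) (simp add: f_def)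
      also have "\<dots> \<le> real (nat \<bar>?e\<bar>) * w (\<lambda>i j. - unit_entry p i j)" by (rule w_multiple)
      also have "\<dots> \<le> real (nat \<bar>?e\<bar>) * ?b" by (intro mult_left_mono) (auto simp: w_nonneg)
      finally show ?thesis .
    qed
    also have "\<dots> \<le> M * ?b"
      using M[of "fst p" "snd p"] p by (intro mult_right_mono) (auto simp: w_nonneg)
    finally show "w (f p) \<le> ?b * M" by (simp add: mult.commute)
  qed
  also have "\<dots> = entry_bound * M" unfolding entry_bound_def sum_distrib_right ..
  finally show ?thesis .
qed

text \<open>The scaled matrix \<open>T \<cdot> I\<close> is approximated by \<open>\<lfloor>aT\<rfloor> B + \<lfloor>bT\<rfloor> C\<close> with an error
  \<open>O(T\<epsilon> + 1)\<close>; dividing by \<open>T \<rightarrow> \<infinity>\<close> removes the rounding errors.\<close>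
lemma w_id_approx:
  assumes ab: "0 \<le> a" "0 \<le> b"
    and approx: "\<And>i j. i < N \<Longrightarrow> j < N \<Longrightarrow> \<bar>a * of_int (B i j) + b * of_int (C i j) - of_bool (i = j)\<bar> \<le> \<epsilon>"
  shows "w (\<lambda>i j. of_bool (i = j)) \<le> a * w B + b * w C + entry_bound * \<epsilon>"
proof -
  let ?I = "\<lambda>i j. of_bool (i = j) :: int" and ?S = "{..<N} \<times> {..<N}"
  \<comment> \<open>Bound for the rounding error: replacing a * T and b * T by their floors changes
    each coefficient by at most 1.\<close>
  define D where "D = (\<Sum>(i, j)\<in>?S. \<bar>real_of_int (B i j)\<bar> + \<bar>real_of_int (C i j)\<bar>)"
  have D: "\<bar>real_of_int (B i j)\<bar> + \<bar>real_of_int (C i j)\<bar> \<le> D" if "i < N" "j < N" for i j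
    unfolding D_def using that
    by (intro order_trans[OF _ member_le_sum[of "(i, j)" ?S]]) auto
  have main: "real T * w ?I \<le> real T * (a * w B + b * w C + entry_bound * \<epsilon>) + entry_bound * D" for T :: nat
  proof -
    define k where "k = nat \<lfloor>a * real T\<rfloor>"
    define l where "l = nat \<lfloor>b * real T\<rfloor>"
    have k: "real k \<le> a * real T" "a * real T - 1 \<le> real k"
      using ab by (auto simp: k_def)
    have l: "real l \<le> b * real T" "b * real T - 1 \<le> real l"
      using ab by (auto simp: l_def)
    define E where "E i j = int T * ?I i j - int k * B i j - int l * C i j" for i j
    have "\<bar>real_of_int (E i j)\<bar> \<le> real T * \<epsilon> + D" if ij: "i < N" "j < N" for i j
    proof -
      have "real_of_int (E i j) = - (real T * (a * of_int (B i j) + b * of_int (C i j) - of_bool (i = j)))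
          + ((a * real T - real k) * of_int (B i j) + (b * real T - real l) * of_int (C i j))"
        by (simp add: E_def algebra_simps)
      also have "\<bar>\<dots>\<bar> \<le> real T * \<bar>a * of_int (B i j) + b * of_int (C i j) - of_bool (i = j)\<bar>
          + (\<bar>a * real T - real k\<bar> * \<bar>of_int (B i j)\<bar> + \<bar>b * real T - real l\<bar> * \<bar>of_int (C i j)\<bar>)"
        unfolding abs_mult[symmetric]
        by (intro order_trans[OF abs_triangle_ineq] add_mono) (auto simp: abs_mult)
      also have "\<dots> \<le> real T * \<epsilon> + (1 * \<bar>of_int (B i j)\<bar> + 1 * \<bar>of_int (C i j)\<bar>)"
        using k l by (intro add_mono mult_left_mono mult_right_mono approx ij) auto
      finally show ?thesis using D[OF ij] by simp
    qed
    then have E: "w E \<le> entry_bound * (real T * \<epsilon> + D)" by (rule w_le_entry_bound)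
    have "real T * w ?I \<le> w (\<lambda>i j. int T * ?I i j)" by (rule w_id)
    also have "\<dots> = w (\<lambda>i j. (int k * B i j + int l * C i j) + E i j)"
      by (intro w_cong) (simp add: E_def)
    also have "\<dots> \<le> w (\<lambda>i j. int k * B i j + int l * C i j) + w E" by (rule w_add)
    also have "\<dots> \<le> w (\<lambda>i j. int k * B i j) + w (\<lambda>i j. int l * C i j) + w E" by (intro add_right_mono w_add)
    also have "\<dots> \<le> real k * w B + real l * w C + entry_bound * (real T * \<epsilon> + D)"
      by (intro add_mono w_multiple E)
    also have "\<dots> \<le> (a * real T) * w B + (b * real T) * w C + entry_bound * (real T * \<epsilon> + D)"
      using k l by (intro add_mono mult_right_mono order_refl w_nonneg)
    finally show ?thesis by (simp add: algebra_simps)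
  qed
  show ?thesis
  proof (rule ccontr)
    assume "\<not> ?thesis"
    \<comment> \<open>The gap is strictly positive, so T times the gap eventually exceeds the fixed
      rounding term.\<close>
    then obtain T :: nat where "entry_bound * D < real T * (w ?I - (a * w B + b * w C + entry_bound * \<epsilon>))"
      using reals_Archimedean3[of "w ?I - (a * w B + b * w C + entry_bound * \<epsilon>)"] by auto
    then show False using main[of T] by (simp add: algebra_simps)
  qed
qed

end

section \<open>Powers of diagonalizable matrices\<close>

text \<open>Infinitely many exponents k share a box of mesh 1/R with some k0. Since all u i have
  modulus 1, closeness of the k-th and k0-th powers means that the (k - k0)-th powers are close to
  1.\<close>

lemma unit_powers_recurrent:
  fixes u :: "nat \<Rightarrow> complex"
  assumes u: "\<And>i. i < n \<Longrightarrow> cmod (u i) = 1" and "\<epsilon> > 0"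
  obtains k where "k \<ge> m" "\<And>i. i < n \<Longrightarrow> cmod (u i ^ k - 1) < \<epsilon>"
proof -
  \<comment> \<open>The real and the imaginary part each contribute an error below 1/R.\<close>
  obtain R :: nat where R: "R > 0" "2 / real R < \<epsilon>"
  proof -
    obtain R :: nat where "2 / \<epsilon> < real R" using reals_Archimedean2 by blast
    moreover then have "0 < real R" using \<open>\<epsilon> > 0\<close> by (meson divide_pos_pos less_trans zero_less_numeral)
    ultimately show thesis using that[of R] \<open>\<epsilon> > 0\<close> by (simp add: field_simps)
  qed
  define box where "box k = restrict (\<lambda>i. (\<lfloor>Re (u i ^ k) * real R\<rfloor>, \<lfloor>Im (u i ^ k) * real R\<rfloor>)) {..<n}" for k :: nat
  let ?B = "{- int R..int R} \<times> {- int R..int R}"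
  have "box k \<in> PiE {..<n} (\<lambda>_. ?B)" for k
  proof -
    have "\<lfloor>x * real R\<rfloor> \<in> {- int R..int R}" if "\<bar>x\<bar> \<le> 1" for x :: real
    proof -
      have "\<bar>x * real R\<bar> \<le> real R" using that by (simp add: abs_mult mult_left_le_one_le)
      then show ?thesis by (auto simp: le_floor_iff floor_le_iff abs_le_iff)
    qed
    moreover have "\<bar>Re (u i ^ k)\<bar> \<le> 1" "\<bar>Im (u i ^ k)\<bar> \<le> 1" if "i < n" for i
      using abs_Re_le_cmod[of "u i ^ k"] abs_Im_le_cmod[of "u i ^ k"] u[OF that] by (simp_all add: norm_power)
    ultimately show ?thesis by (auto simp: box_def)
  qed
  then have "finite (range box)"
    by (intro finite_subset[of "range box" "PiE {..<n} (\<lambda>_. ?B)"] finite_PiE) auto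
  then obtain k0 where inf: "infinite {k. box k = box k0}"
    using pigeonhole_infinite[of "UNIV :: nat set" box] by auto
  obtain k where k: "box k = box k0" "k \<ge> k0 + m"
    using inf unfolding infinite_nat_iff_unbounded_le by blast
  show thesis
  proof (rule that[of "k - k0"])
    show "k - k0 \<ge> m" using k by simp
    fix i assume i: "i < n"
    have "box k i = box k0 i" using k by simp
    then have fl: "\<lfloor>Re (u i ^ k) * real R\<rfloor> = \<lfloor>Re (u i ^ k0) * real R\<rfloor>" "\<lfloor>Im (u i ^ k) * real R\<rfloor> = \<lfloor>Im (u i ^ k0) * real R\<rfloor>"
      using i by (auto simp: box_def)
    have close: "\<bar>x - y\<bar> < 1 / real R" if "\<lfloor>x * real R\<rfloor> = \<lfloor>y * real R\<rfloor>" for x y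
    proof -
      have "\<bar>x * real R - y * real R\<bar> < 1" using that by linarith
      also have "x * real R - y * real R = (x - y) * real R" by (simp add: algebra_simps)
      finally show ?thesis using R by (simp add: abs_mult pos_less_divide_eq)
    qed
    have "cmod (u i ^ k - u i ^ k0) \<le> \<bar>Re (u i ^ k - u i ^ k0)\<bar> + \<bar>Im (u i ^ k - u i ^ k0)\<bar>" by (rule cmod_le)
    also have "\<dots> < 2 / real R" using close[OF fl(1)] close[OF fl(2)] by simp
    finally have "cmod (u i ^ k - u i ^ k0) < \<epsilon>" using R by simp
    moreover have "u i ^ k - u i ^ k0 = u i ^ k0 * (u i ^ (k - k0) - 1)"
      using k by (simp add: algebra_simps flip: power_add)
    ultimately show "cmod (u i ^ (k - k0) - 1) < \<epsilon>" using u[OF i] by (simp add: norm_mult norm_power)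
  qed
qed

section \<open>Diagonal matrices and diagonalizations\<close>

definition diag_of :: "nat \<Rightarrow> (nat \<Rightarrow> complex) \<Rightarrow> complex mat" where
  "diag_of n d = mat n n (\<lambda>(i, j). if i = j then d i else 0)"

lemma diag_of_carrier [simp]: "diag_of n d \<in> carrier_mat n n"
  by (simp add: diag_of_def)

lemma mult_mat_entry:
  fixes A B :: "complex mat"
  assumes "A \<in> carrier_mat n n" "B \<in> carrier_mat n n" "i < n" "j < n"
  shows "(A * B) $$ (i, j) = (\<Sum>l<n. A $$ (i, l) * B $$ (l, j))"
  using assms by (auto simp: scalar_prod_def atLeast0LessThan)

lemma diag_of_mult: "diag_of n d * diag_of n e = diag_of n (\<lambda>i. d i * e i)"
proof (rule eq_matI)
  fix i j assume ij: "i < dim_row (diag_of n (\<lambda>i. d i * e i))" "j < dim_col (diag_of n (\<lambda>i. d i * e i))"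
  then have "i < n" "j < n" by (auto simp: diag_of_def)
  then have "(diag_of n d * diag_of n e) $$ (i, j) = (\<Sum>l<n. if l = i then d i * (if i = j then e i else 0) else 0)"
    unfolding mult_mat_entry[OF diag_of_carrier diag_of_carrier \<open>i < n\<close> \<open>j < n\<close>]
    by (intro sum.cong) (auto simp: diag_of_def)
  then show "(diag_of n d * diag_of n e) $$ (i, j) = diag_of n (\<lambda>i. d i * e i) $$ (i, j)"
    using \<open>i < n\<close> \<open>j < n\<close> by (simp add: diag_of_def)
qed (auto simp: diag_of_def)

lemma diag_of_power: "diag_of n d ^\<^sub>m k = diag_of n (\<lambda>i. d i ^ k)"
proof (induction k)
  case 0
  show ?case by (rule eq_matI) (auto simp: diag_of_def)
next
  case (Suc k)
  then show ?case by (simp add: diag_of_mult mult.commute)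
qed

lemma diagonal_mat_diag_of: "D \<in> carrier_mat n n \<Longrightarrow> diagonal_mat D \<Longrightarrow> D = diag_of n (\<lambda>i. D $$ (i, i))"
  by (rule eq_matI) (auto simp: diag_of_def diagonal_mat_def)

text \<open>Serves to recognise the Jordan normal form of a diagonalizable matrix: all blocks have
  size 1.\<close>

lemma diag_of_jordan_matrix: "jordan_matrix (map (\<lambda>i. (1, d i)) [0..<n]) = diag_of n d"
proof -
  have "jordan_matrix (map (Pair 1) ds) = diag_of (length ds) ((!) ds)" for ds :: "complex list"
  proof (induction ds)
    case Nil
    show ?case by (rule eq_matI) (auto simp: jordan_matrix_def diag_of_def)
  next
    case (Cons a ds)
    have len: "sum_list (map fst (map (Pair (1::nat)) ds)) = length ds" by (induction ds) auto
    have "jordan_matrix (map (Pair 1) (a # ds)) = four_block_mat (jordan_block 1 a) (0\<^sub>m 1 (length ds))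
        (0\<^sub>m (length ds) 1) (diag_of (length ds) ((!) ds))"
      by (simp only: list.map jordan_matrix_Cons len Cons.IH)
    also have "\<dots> = diag_of (length (a # ds)) ((!) (a # ds))"
      by (rule eq_matI) (auto simp: diag_of_def nth_Cons' less_Suc_eq_0_disj split: if_splits)
    finally show ?case .
  qed
  from this[of "map d [0..<n]"] have "jordan_matrix (map (\<lambda>i. (1, d i)) [0..<n]) = diag_of n ((!) (map d [0..<n]))"
    by (simp add: comp_def)
  also have "\<dots> = diag_of n d" by (rule eq_matI) (auto simp: diag_of_def)
  finally show ?thesis .
qed

locale diagonalized =
  fixes n :: nat and M P Q :: "complex mat" and d :: "nat \<Rightarrow> complex"
  assumes wit: "similar_mat_wit M (diag_of n d) P Q" and M: "M \<in> carrier_mat n n"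
begin

lemma PQ: "P * Q = 1\<^sub>m n" "Q * P = 1\<^sub>m n" "M = P * diag_of n d * Q" "P \<in> carrier_mat n n" "Q \<in> carrier_mat n n"
  using similar_mat_witD2[OF M wit] by blast+

lemma similar: "similar_mat M (diag_of n d)"
  using wit unfolding similar_mat_def by blast

lemma upper: "upper_triangular (diag_of n d)"
  by (auto simp: upper_triangular_def diag_of_def)

lemma spectrum_eq: "spectrum M = d ` {..<n}"
proof -
  have "char_poly M = (\<Prod>a\<leftarrow>diag_mat (diag_of n d). [:- a, 1:])"
    using char_poly_similar[OF similar] char_poly_upper_triangular[OF diag_of_carrier upper] by simp
  moreover have "diag_mat (diag_of n d) = map d [0..<n]"
    by (auto simp: diag_mat_def diag_of_def)
  ultimately have "char_poly M = (\<Prod>a\<leftarrow>map d [0..<n]. [:- a, 1:])" by simp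
  then show ?thesis
    unfolding spectrum_root_char_poly[OF M] by (auto simp: poly_prod_list prod_list_zero_iff)
qed

lemma det_eq: "det M = (\<Prod>i<n. d i)"
proof -
  have "det M = prod_list (diag_mat (diag_of n d))"
    using det_similar[OF similar] det_upper_triangular[OF upper diag_of_carrier] by simp
  then show ?thesis by (simp add: prod_list_diag_prod diag_of_def atLeast0LessThan)
qed

text \<open>\<open>jordan_ell\<close> reads the block sizes off an arbitrary choice of Jordan normal
  form; uniqueness up to order shows that the chosen one has blocks of size 1 only. For n > 0 the
  spectral radius is attained, so the maximum is 1.\<close>

lemma jordan_ell_zero:
  assumes "n > 0"
  shows "jordan_ell M = 0"
proof -
  let ?as = "map (\<lambda>i. (1::nat, d i)) [0..<n]"
  have nf: "jordan_nf M ?as"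
    unfolding jordan_nf_def diag_of_jordan_matrix using similar by auto
  then have "jordan_nf M (SOME n_as. jordan_nf M n_as)" by (rule someI)
  from jordan_nf_unique[OF this nf]
  have set: "set (SOME n_as. jordan_nf M n_as) = (\<lambda>i. (1, d i)) ` {..<n}"
    by (auto simp: atLeast0LessThan)
  obtain i where "i < n" "cmod (d i) = spectral_radius M"
    using spectral_radius_mem_max(1)[OF M] assms spectrum_eq by auto
  then have "{k. \<exists>a. (k, a) \<in> set (SOME n_as. jordan_nf M n_as) \<and> cmod a = spectral_radius M} = {1}"
    unfolding set by auto
  then show ?thesis unfolding jordan_ell_def Let_def by simp
qed

lemma power_entry:
  assumes "i < n" "j < n"
  shows "(M ^\<^sub>m k) $$ (i, j) = (\<Sum>l<n. P $$ (i, l) * d l ^ k * Q $$ (l, j))"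
proof -
  have eq: "M ^\<^sub>m k = P * diag_of n (\<lambda>i. d i ^ k) * Q"
    using similar_mat_wit_pow_id[OF wit] by (simp add: diag_of_power)
  have "(P * diag_of n (\<lambda>i. d i ^ k)) $$ (i, l) = P $$ (i, l) * d l ^ k" if "l < n" for l
  proof -
    have "(P * diag_of n (\<lambda>i. d i ^ k)) $$ (i, l) = (\<Sum>m<n. if m = l then P $$ (i, l) * d l ^ k else 0)"
      unfolding mult_mat_entry[OF PQ(4) diag_of_carrier assms(1) that]
      by (intro sum.cong) (use that in \<open>auto simp: diag_of_def\<close>)
    then show ?thesis using that by simp
  qed
  then show ?thesis unfolding eq
    using mult_mat_entry[OF mult_carrier_mat[OF PQ(4) diag_of_carrier] PQ(5) assms] by simp
qed

lemma unit_entry_sum: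
  assumes "i < n" "j < n"
  shows "(\<Sum>l<n. P $$ (i, l) * Q $$ (l, j)) = of_bool (i = j)"
proof -
  have "(P * Q) $$ (i, j) = (\<Sum>l<n. P $$ (i, l) * Q $$ (l, j))"
    by (rule mult_mat_entry[OF PQ(4,5) assms])
  moreover have "(P * Q) $$ (i, j) = of_bool (i = j)"
    unfolding PQ(1) using assms by simp
  ultimately show ?thesis by metis
qed

text \<open>Bounds the loss in passing from eigenvalues to entries, uniformly in the entry. The
  summand 1 keeps it positive, so that tolerances can be divided by it.\<close>

definition condition_const :: real where
  "condition_const = 1 + (\<Sum>(i, j)\<in>{..<n} \<times> {..<n}. \<Sum>l<n. cmod (P $$ (i, l)) * cmod (Q $$ (l, j)))"

lemma condition_const_pos: "condition_const > 0"
  unfolding condition_const_def by (intro add_pos_nonneg sum_nonneg) (auto intro!: sum_nonneg)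

text \<open>As P * Q = 1, subtracting the identity replaces each c l by c l - 1.\<close>

lemma combination_near_id:
  assumes c: "\<And>l. l < n \<Longrightarrow> cmod (c l - 1) \<le> \<eta>" and ij: "i < n" "j < n"
  shows "cmod ((\<Sum>l<n. P $$ (i, l) * c l * Q $$ (l, j)) - of_bool (i = j)) \<le> condition_const * \<eta>"
proof -
  have \<eta>: "0 \<le> \<eta>" using c[OF ij(1)] norm_ge_zero order_trans by blast
  have "(\<Sum>l<n. P $$ (i, l) * c l * Q $$ (l, j)) - of_bool (i = j) = (\<Sum>l<n. P $$ (i, l) * (c l - 1) * Q $$ (l, j))"
    unfolding unit_entry_sum[OF ij, symmetric] sum_subtractf[symmetric] by (simp add: algebra_simps)
  also have "cmod \<dots> \<le> (\<Sum>l<n. cmod (P $$ (i, l) * (c l - 1) * Q $$ (l, j)))" by (rule norm_sum)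
  also have "\<dots> \<le> (\<Sum>l<n. (cmod (P $$ (i, l)) * cmod (Q $$ (l, j))) * \<eta>)"
  proof (rule sum_mono)
    fix l assume "l \<in> {..<n}"
    then have "(cmod (P $$ (i, l)) * cmod (Q $$ (l, j))) * cmod (c l - 1) \<le> (cmod (P $$ (i, l)) * cmod (Q $$ (l, j))) * \<eta>"
      using c by (intro mult_left_mono) auto
    then show "cmod (P $$ (i, l) * (c l - 1) * Q $$ (l, j)) \<le> (cmod (P $$ (i, l)) * cmod (Q $$ (l, j))) * \<eta>"
      by (simp add: norm_mult mult_ac)
  qed
  also have "\<dots> = (\<Sum>l<n. cmod (P $$ (i, l)) * cmod (Q $$ (l, j))) * \<eta>" by (simp add: sum_distrib_right)
  also have "\<dots> \<le> condition_const * \<eta>"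
  proof (rule mult_right_mono[OF _ \<eta>])
    have "(\<Sum>l<n. cmod (P $$ (i, l)) * cmod (Q $$ (l, j)))
        \<le> (\<Sum>(i, j)\<in>{..<n} \<times> {..<n}. \<Sum>l<n. cmod (P $$ (i, l)) * cmod (Q $$ (l, j)))"
      using ij by (intro order_trans[OF _ member_le_sum[of "(i, j)"]]) (auto intro!: sum_nonneg)
    then show "(\<Sum>l<n. cmod (P $$ (i, l)) * cmod (Q $$ (l, j))) \<le> condition_const" by (simp add: condition_const_def)
  qed
  finally show ?thesis .
qed

text \<open>M' is c times the inverse of M. That P and Q are shared with M is essential:
  combinations of powers of both matrices can then be examined one eigenvalue at a time.\<close>

lemma cofactor_diagonalized:
  assumes M': "M' \<in> carrier_mat n n" "M * M' = c \<cdot>\<^sub>m 1\<^sub>m n" and d: "\<And>i. i < n \<Longrightarrow> d i \<noteq> 0"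
  shows "diagonalized n M' P Q (\<lambda>i. c / d i)"
proof
  let ?D = "diag_of n d" and ?D' = "diag_of n (\<lambda>i. 1 / d i)" and ?E = "diag_of n (\<lambda>i. c / d i)"
  let ?X = "P * ?D' * Q"
  note carr = PQ(4,5) diag_of_carrier
  have X: "?X \<in> carrier_mat n n" using carr by (meson mult_carrier_mat)
  have DD: "?D' * ?D = 1\<^sub>m n"
    unfolding diag_of_mult by (rule eq_matI) (use d in \<open>auto simp: diag_of_def\<close>)
  have "?X * M = P * ?D' * (Q * P) * ?D * Q"
    unfolding PQ(3) using carr by (simp add: assoc_mult_mat[of _ n n _ n _ n] mult_carrier_mat[of _ n n _ n])
  also have "\<dots> = P * (?D' * ?D) * Q"
    unfolding PQ(2) right_mult_one_mat[OF mult_carrier_mat[OF PQ(4) diag_of_carrier]]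
    using carr by (simp add: assoc_mult_mat[of _ n n _ n _ n] mult_carrier_mat[of _ n n _ n])
  also have "\<dots> = 1\<^sub>m n" unfolding DD using carr PQ(1) by simp
  finally have XM: "?X * M = 1\<^sub>m n" .
  have "M' = (?X * M) * M'" unfolding XM using M'(1) by simp
  also have "\<dots> = ?X * (M * M')" using X M M'(1) by (rule assoc_mult_mat)
  also have "\<dots> = c \<cdot>\<^sub>m ?X" unfolding M'(2) 
    by (simp only: mult_smult_distrib[OF X one_carrier_mat] right_mult_one_mat[OF X])
  also have "\<dots> = P * (c \<cdot>\<^sub>m ?D') * Q"
    using carr by (simp add: mult_smult_distrib[of _ n n _ n] mult_smult_assoc_mat[of _ n n _ n] mult_carrier_mat[of _ n n _ n])
  also have "c \<cdot>\<^sub>m ?D' = ?E" by (rule eq_matI) (auto simp: diag_of_def)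
  finally have "M' = P * ?E * Q" .
  then show "similar_mat_wit M' ?E P Q"
    using PQ(1,2) carr M'(1) by (intro similar_mat_witI) auto
  show "M' \<in> carrier_mat n n" by fact
qed

end

section \<open>The canonical height inequalities\<close>

definition monomial_map :: "nat \<Rightarrow> (nat \<Rightarrow> complex) \<Rightarrow> (nat \<Rightarrow> nat \<Rightarrow> int) \<Rightarrow> nat \<Rightarrow> complex" where
  "monomial_map N p B i = (\<Prod>j<N. p j powi B i j)"

lemma subfield_C_powi: "subfield_C F \<Longrightarrow> x \<in> F \<Longrightarrow> x powi k \<in> F"
  using subring_C_power[OF subfield_imp_subring, of F] by (auto simp: power_int_def subfield_C_def)

text \<open>Adding exponent matrices multiplies the monomial images coordinatewise, and m times the
  identity gives m-th powers, so the locale assumptions become the height inequalities over the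
  field of the point. That field also contains the monomials with negative exponents.\<close>

lemma subadditive_field_height:
  assumes p: "\<And>i. i < N \<Longrightarrow> p i \<noteq> 0" "\<And>i. i < N \<Longrightarrow> algebraic (p i)"
  shows "subadditive_matrix_function N (\<lambda>B. field_height (gen_field (p ` {..<N})) N (monomial_map N p B))"
proof -
  interpret generated_number_field "p ` {..<N}" by standard (use p in auto)
  have pK: "p i \<in> K" if "i < N" for i
    using gen_field_superset[of "p ` {..<N}"] that by (auto simp: K_def)
  have mK: "monomial_map N p B i \<in> K" for B i
    unfolding monomial_map_def by (intro subring_C_prod FR subfield_C_powi F pK) auto
  have cong: "H N x = H N y" if "\<And>i. i < N \<Longrightarrow> x i = y i" for x y
  proof -
    have "x ` {..<N} = y ` {..<N}" using that by auto
    then have "coord_set N x = coord_set N y" by (simp add: coord_set_def)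
    moreover have "(\<lambda>i. cmod (\<sigma> (x i))) ` {..<N} = (\<lambda>i. cmod (\<sigma> (y i))) ` {..<N}" for \<sigma>
      using that by (intro image_cong) auto
    ultimately show ?thesis by (simp add: field_height_def arch_max_def)
  qed
  show ?thesis
    unfolding K_def[symmetric]
  proof
    show "H N (monomial_map N p B) = H N (monomial_map N p C)"
      if "\<And>i j. i < N \<Longrightarrow> j < N \<Longrightarrow> B i j = C i j" for B C
      by (rule cong) (simp add: monomial_map_def that)
    show "0 \<le> H N (monomial_map N p B)" for B using field_height_nonneg[of N "monomial_map N p B"] mK by simp
    have "H N (monomial_map N p (\<lambda>_ _. 0)) = H N (\<lambda>_. 1)" by (rule cong) (simp add: monomial_map_def)
    then show "H N (monomial_map N p (\<lambda>_ _. 0)) = 0" by (simp add: field_height_one)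
    show "H N (monomial_map N p (\<lambda>i j. B i j + C i j)) \<le> H N (monomial_map N p B) + H N (monomial_map N p C)" for B C
    proof -
      have "H N (monomial_map N p (\<lambda>i j. B i j + C i j)) = H N (\<lambda>i. monomial_map N p B i * monomial_map N p C i)"
        unfolding monomial_map_def prod.distrib[symmetric]
        by (rule cong, rule prod.cong) (auto simp: power_int_add p(1))
      then show ?thesis using field_height_mult_le[of N "monomial_map N p B" "monomial_map N p C"] mK by simp
    qed
    show "real m * H N (monomial_map N p (\<lambda>i j. of_bool (i = j))) \<le> H N (monomial_map N p (\<lambda>i j. int m * of_bool (i = j)))" for m
    proof -
      have "H N (monomial_map N p (\<lambda>i j. int m * of_bool (i = j))) = H N (\<lambda>i. monomial_map N p (\<lambda>i j. of_bool (i = j)) i ^ m)"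
        unfolding monomial_map_def prod_power_distrib
        by (rule cong, rule prod.cong) auto
      then show ?thesis using field_height_power_ge[of N "monomial_map N p (\<lambda>i j. of_bool (i = j))" m] mK by simp
    qed
  qed
qed

text \<open>The point of the quantifier order is that C depends on P alone, so \<epsilon> may shrink
  while the matrices and coefficients change with it.\<close>

lemma weil_height_approx:
  assumes P: "P \<in> Gm N"
  shows "\<exists>C\<ge>0. (\<forall>A\<in>carrier_mat N N. 0 \<le> weil_height (phi A P)) \<and>
    (\<forall>A\<in>carrier_mat N N. \<forall>B\<in>carrier_mat N N. \<forall>a\<ge>0. \<forall>b\<ge>0. \<forall>\<epsilon>.
      (\<forall>i<N. \<forall>j<N. \<bar>a * of_int (A $$ (i, j)) + b * of_int (B $$ (i, j)) - of_bool (i = j)\<bar> \<le> \<epsilon>) \<longrightarrow>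
      weil_height P \<le> a * weil_height (phi A P) + b * weil_height (phi B P) + C * \<epsilon>)"
proof -
  define p where "p i = P $ i" for i
  have p: "\<And>i. i < N \<Longrightarrow> p i \<noteq> 0" "\<And>i. i < N \<Longrightarrow> algebraic (p i)" and dim: "dim_vec P = N"
    using P by (auto simp: Gm_def p_def)
  interpret generated_number_field "p ` {..<N}" by standard (use p in auto)
  interpret w: subadditive_matrix_function N "\<lambda>B. H N (monomial_map N p B)"
    using subadditive_field_height[OF p] by (simp add: K_def)
  have pK: "p i \<in> K" if "i < N" for i
    using gen_field_superset[of "p ` {..<N}"] that by (auto simp: K_def)
  have phi: "phi A P = vec N (monomial_map N p (\<lambda>i j. A $$ (i, j)))" if "A \<in> carrier_mat N N" for A
    using that by (intro eq_vecI) (auto simp: phi_def monomial_map_def p_def)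
  have ge: "H N (monomial_map N p (\<lambda>i j. A $$ (i, j))) / degree_K \<le> weil_height (phi A P)" if "A \<in> carrier_mat N N" for A
    unfolding phi[OF that] monomial_map_def
    by (intro field_height_le_weil_height subring_C_prod FR subfield_C_powi F pK) auto
  \<comment> \<open>Here the comparison with the height over K is an equality: the identity matrix
    returns P, and K is generated by the coordinates of P.\<close>
  have id: "weil_height P = H N (monomial_map N p (\<lambda>i j. of_bool (i = j))) / degree_K"
  proof -
    have m: "monomial_map N p (\<lambda>i j. of_bool (i = j)) i = p i" if "i < N" for i
    proof -
      have "monomial_map N p (\<lambda>i j. of_bool (i = j)) i = (\<Prod>j<N. if j = i then p j else 1)"
        unfolding monomial_map_def by (intro prod.cong) auto
      then show ?thesis using that by simp
    qed
    have "P = vec N (monomial_map N p (\<lambda>i j. of_bool (i = j)))"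
      by (rule eq_vecI) (auto simp: m dim p_def)
    moreover have "monomial_map N p (\<lambda>i j. of_bool (i = j)) ` {..<N} = p ` {..<N}"
      using m by (intro image_cong) auto
    ultimately show ?thesis
      using weil_height_field_height[of N "monomial_map N p (\<lambda>i j. of_bool (i = j))"] by (simp add: K_def degree_K_def)
  qed
  have d: "real degree_K > 0" using degree_K_pos by simp
  show ?thesis
  proof (intro exI[of _ "w.entry_bound / degree_K"] conjI ballI allI impI)
    show "0 \<le> w.entry_bound / degree_K" using w.entry_bound_nonneg by simp
    fix A :: "int mat" assume AN: "A \<in> carrier_mat N N"
    show "0 \<le> weil_height (phi A P)"
    proof -
      have "0 \<le> H N (monomial_map N p (\<lambda>i j. A $$ (i, j))) / degree_K"
        using w.w_nonneg[of "\<lambda>i j. A $$ (i, j)"] by simp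
      then show ?thesis using ge[OF AN] by linarith
    qed
    fix B and a b \<epsilon> :: real assume B: "B \<in> carrier_mat N N" and ab: "0 \<le> a" "0 \<le> b"
      and approx: "\<forall>i<N. \<forall>j<N. \<bar>a * of_int (A $$ (i, j)) + b * of_int (B $$ (i, j)) - of_bool (i = j)\<bar> \<le> \<epsilon>"
    let ?w = "\<lambda>A. H N (monomial_map N p (\<lambda>i j. A $$ (i, j)))"
    have "weil_height P \<le> (a * ?w A + b * ?w B + w.entry_bound * \<epsilon>) / degree_K"
      unfolding id using approx d
      by (intro divide_right_mono w.w_id_approx[OF ab]) auto
    also have "\<dots> = a * (?w A / degree_K) + b * (?w B / degree_K) + w.entry_bound / degree_K * \<epsilon>"
      by (simp add: add_divide_distrib)
    also have "\<dots> \<le> a * weil_height (phi A P) + b * weil_height (phi B P) + w.entry_bound / degree_K * \<epsilon>"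
      using ge AN B ab by (intro add_mono mult_left_mono order_refl) auto
    finally show "weil_height P \<le> a * weil_height (phi A P) + b * weil_height (phi B P) + w.entry_bound / degree_K * \<epsilon>" .
  qed
qed

text \<open>For all large k both f and g stay below their limits superior plus e, so a lower bound
  on f k + g k at arbitrarily large k limits how small the sum of the two can be.\<close>

lemma le_limsup_add:
  fixes f g :: "nat \<Rightarrow> real"
  assumes C: "0 \<le> C" and nonneg: "\<And>k. 0 \<le> f k" "\<And>k. 0 \<le> g k"
    and freq: "\<And>\<epsilon> m. 0 < \<epsilon> \<Longrightarrow> \<exists>k\<ge>m. c \<le> f k + g k + C * \<epsilon>"
  shows "ereal c \<le> limsup (\<lambda>k. ereal (f k)) + limsup (\<lambda>k. ereal (g k))"
proof (rule ccontr)
  let ?F = "limsup (\<lambda>k. ereal (f k))" and ?G = "limsup (\<lambda>k. ereal (g k))"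
  assume neg: "\<not> ?thesis"
  \<comment> \<open>Nonnegativity excludes -\<infinity>, so failure of the claim forces both limits
    superior to be finite.\<close>
  have pos: "0 \<le> ?F" "0 \<le> ?G"
    using nonneg by (auto intro!: le_Limsup)
  with neg obtain u v where uv: "?F = ereal u" "?G = ereal v"
    by (cases ?F; cases ?G) auto
  with neg have "u + v < c" by simp
  \<comment> \<open>A third of the gap: one share each for f, for g and for the error term, where
    \<epsilon> = e / (C + 1) gives C * \<epsilon> \<le> e.\<close>
  define e where "e = (c - (u + v)) / 3"
  have e: "e > 0" using \<open>u + v < c\<close> by (simp add: e_def)
  have "eventually (\<lambda>k. ereal (f k) < ereal (u + e)) sequentially" "eventually (\<lambda>k. ereal (g k) < ereal (v + e)) sequentially"
    using Limsup_lessD[of sequentially "\<lambda>k. ereal (f k)" "ereal (u + e)"] Limsup_lessD[of sequentially "\<lambda>k. ereal (g k)" "ereal (v + e)"] uv e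
    by simp_all
  then have "eventually (\<lambda>k. f k < u + e \<and> g k < v + e) sequentially"
    by (auto intro: eventually_conj)
  then obtain m where m: "\<And>k. k \<ge> m \<Longrightarrow> f k < u + e \<and> g k < v + e" by (auto simp: eventually_sequentially)
  have "0 < e / (C + 1)" using e C by simp
  then obtain k where k: "k \<ge> m" "c \<le> f k + g k + C * (e / (C + 1))" using freq by blast
  have "C * (e / (C + 1)) \<le> e" using e C by (simp add: field_simps)
  then have "c < u + e + (v + e) + e" using k m[OF k(1)] by linarith
  then show False by (simp add: e_def field_simps)
qed

text \<open>The adjugate times the sign of the determinant is a witness for the choice in
  \<open>dual_mat\<close>.\<close>

lemma dual_mat_props:
  assumes A: "A \<in> carrier_mat N N"
  shows "dual_mat A \<in> carrier_mat N N" "A * dual_mat A = \<bar>det A\<bar> \<cdot>\<^sub>m 1\<^sub>m N"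
proof -
  let ?B = "sgn (det A) \<cdot>\<^sub>m adj_mat A"
  have "?B \<in> carrier_mat N N" using adj_mat(1)[OF A] by simp
  moreover have "A * ?B = \<bar>det A\<bar> \<cdot>\<^sub>m 1\<^sub>m N"
    unfolding mult_smult_distrib[OF A adj_mat(1)[OF A]] adj_mat(2)[OF A]
    by (rule eq_matI) (auto simp: abs_sgn mult.commute)
  ultimately have "?B \<in> carrier_mat (dim_row A) (dim_row A) \<and> A * ?B = of_int \<bar>det A\<bar> \<cdot>\<^sub>m 1\<^sub>m (dim_row A)"
    using A by simp
  from someI[where P = "\<lambda>B. B \<in> carrier_mat (dim_row A) (dim_row A) \<and> A * B = of_int \<bar>det A\<bar> \<cdot>\<^sub>m 1\<^sub>m (dim_row A)", OF this]
  show "dual_mat A \<in> carrier_mat N N" "A * dual_mat A = \<bar>det A\<bar> \<cdot>\<^sub>m 1\<^sub>m N"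
    using A unfolding dual_mat_def by auto
qed

text \<open>The exponent of the polynomial factor in the normalisation is 0 here, so only the powers
  of \<delta> remain.\<close>

lemma can_height_plus_diagonalized:
  assumes "diagonalized N (map_mat of_int A) S T d" "N > 0"
    and "spectral_radius (map_mat of_int A) = \<delta>"
  shows "can_height_plus A P = limsup (\<lambda>k. ereal (weil_height (phi (A ^\<^sub>m k) P) / \<delta> ^ k))"
  using diagonalized.jordan_ell_zero[OF assms(1,2)] assms(3) by (simp add: can_height_plus_def)

lemma integer_power_entry:
  assumes dg: "diagonalized N (map_mat of_int A) S T d" and A: "A \<in> carrier_mat N N" and ij: "i < N" "j < N"
  shows "complex_of_int ((A ^\<^sub>m k) $$ (i, j)) = (\<Sum>l<N. S $$ (i, l) * d l ^ k * T $$ (l, j))"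
proof -
  have "map_mat of_int (A ^\<^sub>m k) = (map_mat of_int A :: complex mat) ^\<^sub>m k"
    by (rule of_int_hom.mat_hom_pow[OF A])
  then have "complex_of_int ((A ^\<^sub>m k) $$ (i, j)) = ((map_mat of_int A :: complex mat) ^\<^sub>m k) $$ (i, j)"
    using A ij pow_carrier_mat[OF A, of k] by (metis carrier_matD index_map_mat(1))
  then show ?thesis using diagonalized.power_entry[OF dg ij] by simp
qed

theorem mainTheorem5:
  fixes A :: "int mat" and N :: nat
  assumes "A \<in> carrier_mat N N" and "det A \<noteq> 0" and "diagonalizable_C A"
  shows "(card (cmod ` spectrum (map_mat of_int A :: complex mat)) = 1 \<longrightarrow>
            (\<forall>P \<in> Gm N. ereal (weil_height P) \<le> can_height_plus A P))
       \<and> (card (cmod ` spectrum (map_mat of_int A :: complex mat)) = 2 \<longrightarrow>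
            (\<forall>P \<in> Gm N. ereal (weil_height P) \<le> can_height A P))"
proof -
  note A = assms(1)
  let ?M = "map_mat of_int A :: complex mat"
  have M: "?M \<in> carrier_mat N N" using A by simp
  obtain D where D: "diagonal_mat D" "similar_mat ?M D" using assms(3) by (auto simp: diagonalizable_C_def)
  then obtain S T where ST: "similar_mat_wit ?M D S T" by (auto simp: similar_mat_def)
  define d where "d i = D $$ (i, i)" for i
  have "D = diag_of N d"
    unfolding d_def using diagonal_mat_diag_of[OF _ D(1)] similar_mat_witD2(5)[OF M ST] by blast
  then have dg: "diagonalized N ?M S T d" using ST M by unfold_locales auto
  interpret diagonalized N ?M S T d by (rule dg)
  define c where "c = real_of_int \<bar>det A\<bar>"
  have c: "c > 0" using assms(2) by (simp add: c_def)
  have "(\<Prod>i<N. d i) \<noteq> 0" using det_eq assms(2) by (metis of_int_eq_0_iff of_int_hom.hom_det)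
  then have d0: "d i \<noteq> 0" if "i < N" for i using that by simp
  define A' where "A' = dual_mat A"
  have A': "A' \<in> carrier_mat N N" "A * A' = \<bar>det A\<bar> \<cdot>\<^sub>m 1\<^sub>m N" using dual_mat_props[OF A] by (auto simp: A'_def)
  have "?M * map_mat of_int A' = map_mat of_int (A * A')" by (rule of_int_hom.mat_hom_mult[OF A A'(1), symmetric])
  also have "\<dots> = complex_of_real c \<cdot>\<^sub>m 1\<^sub>m N" unfolding A'(2) by (rule eq_matI) (auto simp: c_def simp del: of_int_abs)
  finally have dg': "diagonalized N (map_mat of_int A') S T (\<lambda>i. c / d i)"
    using A'(1) d0 by (intro cofactor_diagonalized) auto
  interpret D': diagonalized N "map_mat of_int A'" S T "\<lambda>i. c / d i" by (rule dg')
  have mods: "cmod ` spectrum ?M = (\<lambda>i. cmod (d i)) ` {..<N}" unfolding spectrum_eq by (simp add: image_image)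
  have mods': "cmod ` spectrum (map_mat of_int A') = (\<lambda>i. c / cmod (d i)) ` {..<N}"
    unfolding D'.spectrum_eq image_image using c by (simp add: norm_divide)
  note C0 = condition_const_pos
  \<comment> \<open>Reduces closeness to the identity, entry by entry, to a condition on each
    eigenvalue in the common eigenbasis of A and A'.\<close>
  have entries: "\<bar>a * of_int ((A ^\<^sub>m k) $$ (i, j)) + b * of_int ((A' ^\<^sub>m k) $$ (i, j)) - of_bool (i = j)\<bar> \<le> \<epsilon>"
    if near: "\<And>l. l < N \<Longrightarrow> cmod (a * d l ^ k + b * (c / d l) ^ k - 1) \<le> \<epsilon> / condition_const" and ij: "i < N" "j < N"
    for a b \<epsilon> :: real and i j k
  proof -
    have "complex_of_real (a * of_int ((A ^\<^sub>m k) $$ (i, j)) + b * of_int ((A' ^\<^sub>m k) $$ (i, j)) - of_bool (i = j))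
      = (\<Sum>l<N. S $$ (i, l) * (a * d l ^ k + b * (c / d l) ^ k) * T $$ (l, j)) - of_bool (i = j)"
      using integer_power_entry[OF dg A ij, of k] integer_power_entry[OF dg' A'(1) ij, of k]
      by (simp add: sum.distrib sum_distrib_left algebra_simps)
    also have "cmod \<dots> \<le> condition_const * (\<epsilon> / condition_const)" by (rule combination_near_id[OF near ij])
    finally show ?thesis using C0 by (simp only: norm_of_real) simp
  qed
  have pos: "N > 0" if "card (cmod ` spectrum ?M) \<noteq> 0" using that unfolding mods by (cases N) auto
  show ?thesis
  proof (intro conjI impI ballI)
    fix P assume card: "card (cmod ` spectrum ?M) = 1" and P: "P \<in> Gm N"
    then have N: "N > 0" using pos by simp
    obtain \<delta> where \<delta>: "cmod ` spectrum ?M = {\<delta>}" using card by (auto simp: card_1_singleton_iff)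
    then have rad: "spectral_radius ?M = \<delta>" by (simp add: spectral_radius_def)
    have dl: "cmod (d l) = \<delta>" if "l < N" for l using \<delta> mods that by auto
    have \<delta>0: "\<delta> > 0" using dl[OF N] d0[OF N] by auto
    obtain C where C: "0 \<le> C" and nonneg: "\<forall>A\<in>carrier_mat N N. 0 \<le> weil_height (phi A P)"
      and approx: "\<forall>A\<in>carrier_mat N N. \<forall>B\<in>carrier_mat N N. \<forall>a\<ge>0. \<forall>b\<ge>0. \<forall>\<epsilon>.
        (\<forall>i<N. \<forall>j<N. \<bar>a * of_int (A $$ (i, j)) + b * of_int (B $$ (i, j)) - of_bool (i = j)\<bar> \<le> \<epsilon>) \<longrightarrow>
        weil_height P \<le> a * weil_height (phi A P) + b * weil_height (phi B P) + C * \<epsilon>"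
      using weil_height_approx[OF P] by blast
    \<comment> \<open>One modulus is handled by the two-term estimate with second sequence 0;
      accordingly the powers of A' enter below with coefficient 0.\<close>
    have "ereal (weil_height P) \<le> limsup (\<lambda>k. ereal (weil_height (phi (A ^\<^sub>m k) P) / \<delta> ^ k)) + limsup (\<lambda>k::nat. ereal 0)"
    proof (rule le_limsup_add[OF C])
      show "0 \<le> weil_height (phi (A ^\<^sub>m k) P) / \<delta> ^ k" for k using nonneg pow_carrier_mat[OF A] \<delta>0 by simp
      fix \<epsilon> :: real and m :: nat assume "0 < \<epsilon>"
      then have "0 < \<epsilon> / condition_const" using C0 by simp
      moreover have "cmod (d l / \<delta>) = 1" if "l < N" for l using dl[OF that] \<delta>0 by (simp add: norm_divide)
      ultimately obtain k where k: "k \<ge> m" "\<And>l. l < N \<Longrightarrow> cmod ((d l / \<delta>) ^ k - 1) < \<epsilon> / condition_const"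
        using unit_powers_recurrent[of N "\<lambda>l. d l / \<delta>"] by metis
      have "weil_height P \<le> 1 / \<delta> ^ k * weil_height (phi (A ^\<^sub>m k) P) + 0 * weil_height (phi (A' ^\<^sub>m k) P) + C * \<epsilon>"
      proof (rule approx[rule_format, OF pow_carrier_mat[OF A] pow_carrier_mat[OF A'(1)]])
        show "\<bar>1 / \<delta> ^ k * of_int ((A ^\<^sub>m k) $$ (i, j)) + 0 * of_int ((A' ^\<^sub>m k) $$ (i, j)) - of_bool (i = j)\<bar> \<le> \<epsilon>"
          if "i < N" "j < N" for i j
        proof (rule entries[OF _ that])
          show "cmod (complex_of_real (1 / \<delta> ^ k) * d l ^ k + complex_of_real 0 * (c / d l) ^ k - 1) \<le> \<epsilon> / condition_const" if "l < N" for l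
            using k(2)[OF that] by (simp add: power_divide)
        qed
      qed (use \<delta>0 in auto)
      then show "\<exists>k\<ge>m. weil_height P \<le> weil_height (phi (A ^\<^sub>m k) P) / \<delta> ^ k + 0 + C * \<epsilon>" using k(1) by auto
    qed simp
    then show "ereal (weil_height P) \<le> can_height_plus A P"
      unfolding can_height_plus_diagonalized[OF dg N rad] by (simp add: Limsup_const)
  next
    fix P assume card: "card (cmod ` spectrum ?M) = 2" and P: "P \<in> Gm N"
    then have N: "N > 0" using pos by simp
    obtain \<delta> \<delta>' where \<delta>: "cmod ` spectrum ?M = {\<delta>, \<delta>'}" "\<delta>' < \<delta>"
      using card unfolding card_2_iff by (metis insert_commute linorder_neq_iff)
    then have rad: "spectral_radius ?M = \<delta>" by (simp add: spectral_radius_def)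
    have dl: "cmod (d l) = \<delta> \<or> cmod (d l) = \<delta>'" if "l < N" for l using \<delta> mods that by auto
    have "\<delta>' \<in> (\<lambda>i. cmod (d i)) ` {..<N}" "\<delta> \<in> (\<lambda>i. cmod (d i)) ` {..<N}" using \<delta> mods by auto
    then have \<delta>0: "\<delta>' > 0" using d0 by auto
    have "cmod ` spectrum (map_mat of_int A') = (\<lambda>x. c / x) ` ((\<lambda>i. cmod (d i)) ` {..<N})"
      unfolding mods' image_image ..
    also have "\<dots> = {c / \<delta>, c / \<delta>'}" using \<delta> mods by simp
    \<comment> \<open>The map x \<mapsto> c / x reverses the order, so the smaller modulus \<delta>'
      determines the spectral radius of A'.\<close>
    finally have rad': "spectral_radius (map_mat of_int A') = c / \<delta>'"
      using c \<delta>0 \<delta> by (simp add: spectral_radius_def max_def frac_le)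
    obtain C where C: "0 \<le> C" and nonneg: "\<forall>A\<in>carrier_mat N N. 0 \<le> weil_height (phi A P)"
      and approx: "\<forall>A\<in>carrier_mat N N. \<forall>B\<in>carrier_mat N N. \<forall>a\<ge>0. \<forall>b\<ge>0. \<forall>\<epsilon>.
        (\<forall>i<N. \<forall>j<N. \<bar>a * of_int (A $$ (i, j)) + b * of_int (B $$ (i, j)) - of_bool (i = j)\<bar> \<le> \<epsilon>) \<longrightarrow>
        weil_height P \<le> a * weil_height (phi A P) + b * weil_height (phi B P) + C * \<epsilon>"
      using weil_height_approx[OF P] by blast
    have "ereal (weil_height P) \<le> limsup (\<lambda>k. ereal (weil_height (phi (A ^\<^sub>m k) P) / \<delta> ^ k))
        + limsup (\<lambda>k. ereal (weil_height (phi (A' ^\<^sub>m k) P) / (c / \<delta>') ^ k))"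
    proof (rule le_limsup_add[OF C])
      show "0 \<le> weil_height (phi (A ^\<^sub>m k) P) / \<delta> ^ k" for k using nonneg pow_carrier_mat[OF A] \<delta> \<delta>0 by simp
      show "0 \<le> weil_height (phi (A' ^\<^sub>m k) P) / (c / \<delta>') ^ k" for k
        using nonneg pow_carrier_mat[OF A'(1)] c \<delta>0 by simp
      fix \<epsilon> :: real and m :: nat assume "0 < \<epsilon>"
      \<comment> \<open>Half of the tolerance is for the recurrence of numbers of modulus 1, half
        for the decaying term.\<close>
      define \<eta> where "\<eta> = \<epsilon> / condition_const / 2"
      have \<eta>: "0 < \<eta>" using C0 \<open>0 < \<epsilon>\<close> by (simp add: \<eta>_def)
      have ratio: "0 \<le> \<delta>' / \<delta>" "\<delta>' / \<delta> < 1" using \<delta> \<delta>0 by auto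
      then have "(\<lambda>k. (\<delta>' / \<delta>) ^ k) \<longlonglongrightarrow> 0" by (intro LIMSEQ_realpow_zero)
      then have "eventually (\<lambda>k. (\<delta>' / \<delta>) ^ k < \<eta>) sequentially" using \<eta> by (rule order_tendstoD(2))
      then obtain m1 where m1: "\<And>k. k \<ge> m1 \<Longrightarrow> (\<delta>' / \<delta>) ^ k < \<eta>" by (auto simp: eventually_sequentially)
      \<comment> \<open>After normalisation an eigenvalue contributes d l / \<delta> from A and
        \<delta>' / d l from A'. With exactly two moduli, one of these, \<open>u l\<close>, has
        modulus 1, and the other has modulus \<delta>' / \<delta> < 1, so its powers tend to
        0.\<close>
      define u where "u l = (if cmod (d l) = \<delta> then d l / \<delta> else \<delta>' / d l)" for l
      have "cmod (u l) = 1" if "l < N" for l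
        using dl[OF that] \<delta> \<delta>0 by (auto simp: u_def norm_divide)
      then obtain k where k: "k \<ge> max m m1" "\<And>l. l < N \<Longrightarrow> cmod (u l ^ k - 1) < \<eta>"
        using unit_powers_recurrent[of N u \<eta> "max m m1"] \<eta> by metis
      have "weil_height P \<le> 1 / \<delta> ^ k * weil_height (phi (A ^\<^sub>m k) P) + 1 / (c / \<delta>') ^ k * weil_height (phi (A' ^\<^sub>m k) P) + C * \<epsilon>"
      proof (rule approx[rule_format, OF pow_carrier_mat[OF A] pow_carrier_mat[OF A'(1)]])
        show "\<bar>1 / \<delta> ^ k * of_int ((A ^\<^sub>m k) $$ (i, j)) + 1 / (c / \<delta>') ^ k * of_int ((A' ^\<^sub>m k) $$ (i, j)) - of_bool (i = j)\<bar> \<le> \<epsilon>"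
          if "i < N" "j < N" for i j
        proof (rule entries[OF _ that])
          fix l assume l: "l < N"
          define v where "v = (if cmod (d l) = \<delta> then \<delta>' / d l else d l / \<delta>)"
          have v: "cmod v = \<delta>' / \<delta>" using dl[OF l] \<delta> \<delta>0 by (auto simp: v_def norm_divide)
          \<comment> \<open>The determinant cancels: (c / d l) / (c / \<delta>') = \<delta>' / d
            l.\<close>
          have "complex_of_real (1 / \<delta> ^ k) * d l ^ k + complex_of_real (1 / (c / \<delta>') ^ k) * (c / d l) ^ k
              = (d l / \<delta>) ^ k + (\<delta>' / d l) ^ k"
            using c \<delta>0 d0[OF l] by (simp add: power_divide)
          also have "\<dots> = u l ^ k + v ^ k" by (simp add: u_def v_def)
          finally have "cmod (complex_of_real (1 / \<delta> ^ k) * d l ^ k + complex_of_real (1 / (c / \<delta>') ^ k) * (c / d l) ^ k - 1)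
              = cmod ((u l ^ k - 1) + v ^ k)" by (simp add: algebra_simps)
          also have "\<dots> \<le> cmod (u l ^ k - 1) + cmod (v ^ k)" by (rule norm_triangle_ineq)
          also have "\<dots> \<le> \<eta> + \<eta>" using k(2)[OF l] m1[of k] k(1) by (simp add: norm_power v)
          also have "\<dots> = \<epsilon> / condition_const" by (simp add: \<eta>_def)
          finally show "cmod (complex_of_real (1 / \<delta> ^ k) * d l ^ k + complex_of_real (1 / (c / \<delta>') ^ k) * (c / d l) ^ k - 1) \<le> \<epsilon> / condition_const" .
        qed
      qed (use \<delta> \<delta>0 c in auto)
      then show "\<exists>k\<ge>m. weil_height P \<le> weil_height (phi (A ^\<^sub>m k) P) / \<delta> ^ k
          + weil_height (phi (A' ^\<^sub>m k) P) / (c / \<delta>') ^ k + C * \<epsilon>" using k(1) by (intro exI[of _ k]) simp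
    qed
    then show "ereal (weil_height P) \<le> can_height A P"
      unfolding can_height_def can_height_minus_def A'_def[symmetric]
        can_height_plus_diagonalized[OF dg N rad] can_height_plus_diagonalized[OF dg' N rad'] .
  qed
qed

end
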